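(* Let $X$ be a second-countable locally compact Hausdorff space and let $\kappa$ be a perfect kernel on $X$ satisfying the domination principle and the $h$-Ugaheri maximum principle for some $h\in[1,\infty)$. Let $A\subset X$ be an arbitrary set with $\mathrm{cap}_*A>0$, and let $\omega\in\mathfrak M^+$, $\omega\neq0$, be bounded and such that $U^\omega$ is continuous on every compact subset of $A$ and $\sup_{x\in A}U^\omega(x)<\infty$. Then there exists a $K_\sigma$-set $A_0\subset A$ (that is, a countable union of compact subsets of $X$, contained in $A$) such that $$\omega^A=\omega^{A_0}=\omega^{*A_0},$$ where $\omega^A$ and $\omega^{A_0}$ are the inner balayages of $\omega$ to $A$ and $A_0$, and $\omega^{*A_0}$ is the outer balayage of $\omega$ to $A_0$ (all of which exist and are unique).
   Context: Measures and energies. $\mathfrak M$ is the space of (signed, real-valued) Radon measures on $X$ with the vague topology (pointwise convergence on $C_0(X)$, the continuous functions $X\to\mathbb R$ of compact support); $\mathfrak M^+$ is the cone of positive ones. A kernel on $X$ is a symmetric lower semicontinuous function $\kappa:X\times X\to[0,\infty]$. For $\mu,\nu\in\mathfrak M$, $I(\mu,\nu):=\int\kappa(x,y)\,d(\mu\otimes\nu)(x,y)$ and $U^\mu(x):=\int\kappa(x,y)\,d\mu(y)$, whenever well defined as a finite number or $\pm\infty$; $I(\mu):=I(\mu,\mu)$. $\mathcal E$ is the set of $\mu\in\mathfrak M$ with $I(\mu)$ finite, $\mathcal E^+:=\mathcal E\cap\mathfrak M^+$. The kernel satisfies the energy principle (is strictly positive definite) if $I(\mu)\geqslant0$ for all signed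 $\mu$ (whenever defined), with $I(\mu)=0$ only for $\mu=0$; then $\mathcal E$ is a pre-Hilbert space with inner product $I(\mu,\nu)$ and norm $\|\mu\|:=\sqrt{I(\mu)}$, whose topology is called strong. The kernel is perfect if it satisfies the energy principle, $\mathcal E^+$ is strongly complete, and the strong topology on $\mathcal E^+$ is finer than the induced vague topology. Domination principle: for $\mu\in\mathcal E^+$, $\nu\in\mathfrak M^+$ with $U^\mu\leqslant U^\nu$ $\mu$-a.e., one has $U^\mu\leqslant U^\nu$ on $X$. $h$-Ugaheri maximum principle: for each $\mu\in\mathcal E^+$ with $U^\mu\leqslant c$ $\mu$-a.e., where $c\in(0,\infty)$, one has $U^\mu\leqslant hc$ on $X$. Capacity. For compact $K$, $\mathrm{cap}\,K:=1/\inf\{I(\mu):\mu\in\mathfrak M^+,\ \mathrm{Supp}(\mu)\subset K,\ \mu(X)=1\}$ (with $1/\infty:=0$); $\mathrm{cap}_*Q:=\sup\{\mathrm{cap}\,K: K\subset Q\text{ compact}\}$ (inner capacity); $\mathrm{cap}^*Q:=\inf\{\mathrm{cap}_*D: D\supset Q\text{ open}\}$ (outer capacity). A property holds n.e. (resp. q.e.) on $Q$ if the set of points of $Q$ where it fails has inner (resp. outer) capacity zero. Balayage. $\mu\in\mathfrak M^+$ is concentrated on $Q\subset X$ if $X\setminus Q$ is locally $\mu$-negligible; $\mathcal E^+(Q)$ is the set of $\mu\in\mathcal E^+$ concentrated on $Q$, and $\mathcal E'(Q)$ is its strong closure in $\mathcal E^+$. For $\lambda\in\mathcal E^+$, $\lambda^Q$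 denotes the only measure in $\mathcal E'(Q)$ with $U^{\lambda^Q}=U^\lambda$ n.e. on $Q$ and, for $Q$ Borel, $\lambda^{*Q}$ the only measure in $\mathcal E'(Q)$ with $U^{\lambda^{*Q}}=U^\lambda$ q.e. on $Q$ (both known to exist and be unique here). The inner balayage of $\omega\in\mathfrak M^+$ to $Q$ is the measure $\omega^Q\in\mathcal E'(Q)$ with $I(\omega^Q,\lambda)=I(\lambda^Q,\omega)$ for all $\lambda\in\mathcal E^+$; for $Q$ Borel, the outer balayage of $\omega$ to $Q$ is the measure $\omega^{*Q}\in\mathcal E'(Q)$ with $I(\omega^{*Q},\lambda)=I(\lambda^{*Q},\omega)$ for all $\lambda\in\mathcal E^+$. *)

theory Defs
  imports "HOL-Analysis.Analysis"
begin

text \<open>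
  The space X is the universe of a type \<open>'a\<close>; local compactness is an assumption of the theorem.
\<close>

type_synonym 'a kernel = "'a \<Rightarrow> 'a \<Rightarrow> ennreal"


subsection \<open>Radon measures\<close>

definition radon :: "'a::topological_space measure set" where
  "radon = {\<mu>. sets \<mu> = sets borel \<and>
     (\<forall>K. compact K \<longrightarrow> emeasure \<mu> K < \<infinity>) \<and>
     (\<forall>B\<in>sets borel. emeasure \<mu> B = (SUP K\<in>{K. compact K \<and> K \<subseteq> B}. emeasure \<mu> K))}"

text \<open>
  A signed Radon measure is given by its Jordan decomposition: the pair \<open>(p, n)\<close> of mutually
  singular positive Radon measures stands for \<open>p - n\<close>.  Both parts may have infinite total mass, so
  this is not a set function in general.
\<close>
definition signed_radon :: "('a::topological_space measure \<times> 'a measure) set" where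
  "signed_radon = {(p, n). p \<in> radon \<and> n \<in> radon \<and>
     (\<exists>S\<in>sets borel. emeasure p (- S) = 0 \<and> emeasure n S = 0)}"

definition meas_supp :: "'a::topological_space measure \<Rightarrow> 'a set" where
  "meas_supp \<mu> = {x. \<forall>V. open V \<and> x \<in> V \<longrightarrow> emeasure \<mu> V > 0}"

text \<open>
  \<open>Q\<close> is not assumed to be measurable; \<open>AE\<close> asks for the exceptional set to be contained
  in a null set.
\<close>
definition concentrated_on :: "'a::topological_space measure \<Rightarrow> 'a set \<Rightarrow> bool" where
  "concentrated_on \<mu> Q \<longleftrightarrow> (\<forall>K. compact K \<longrightarrow> (AE x in \<mu>. x \<in> K \<longrightarrow> x \<in> Q))"

text \<open>The topology induced by the vague topology on the cone of positive Radon measures.\<close>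
definition vague_topology :: "'a::topological_space measure topology" where
  "vague_topology = topology_generated_by
     {{\<mu> \<in> radon. (\<integral>x. f x \<partial>\<mu>) \<in> V} | (f :: 'a \<Rightarrow> real) V.
        continuous_on UNIV f \<and> compact (closure {x. f x \<noteq> 0}) \<and> open V}"


subsection \<open>Kernels, potentials and energies\<close>

definition is_kernel :: "'a::topological_space kernel \<Rightarrow> bool" where
  "is_kernel \<kappa> \<longleftrightarrow> (\<forall>x y. \<kappa> x y = \<kappa> y x) \<and> (\<forall>a. open {(x, y). a < \<kappa> x y})"

definition pot :: "'a kernel \<Rightarrow> 'a measure \<Rightarrow> 'a \<Rightarrow> ennreal" where
  "pot \<kappa> \<mu> x = (\<integral>\<^sup>+ y. \<kappa> x y \<partial>\<mu>)"

definition energy :: "'a kernel \<Rightarrow> 'a measure \<Rightarrow> 'a measure \<Rightarrow> ennreal" where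
  "energy \<kappa> \<mu> \<nu> = (\<integral>\<^sup>+ z. \<kappa> (fst z) (snd z) \<partial>(\<mu> \<Otimes>\<^sub>M \<nu>))"

text \<open>
  For a signed Radon measure \<open>(p, n)\<close>, the positive and the negative part of the signed product
  measure are \<open>p \<otimes> p + n \<otimes> n\<close> and \<open>p \<otimes> n + n \<otimes> p\<close>.  The energy is well defined (as a finite
  number or as \<open>\<plusminus>\<infinity>\<close>) unless the integrals of the kernel against both of them are infinite.
\<close>
definition energy_defined :: "'a kernel \<Rightarrow> 'a measure \<Rightarrow> 'a measure \<Rightarrow> bool" where
  "energy_defined \<kappa> p n \<longleftrightarrow>
     energy \<kappa> p p + energy \<kappa> n n < \<infinity> \<or> energy \<kappa> p n + energy \<kappa> n p < \<infinity>"

definition signed_energy :: "'a kernel \<Rightarrow> 'a measure \<Rightarrow> 'a measure \<Rightarrow> ereal" where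
  "signed_energy \<kappa> p n =
     enn2ereal (energy \<kappa> p p + energy \<kappa> n n) - enn2ereal (energy \<kappa> p n + energy \<kappa> n p)"

definition energy_principle :: "'a::topological_space kernel \<Rightarrow> bool" where
  "energy_principle \<kappa> \<longleftrightarrow> (\<forall>(p, n)\<in>signed_radon. energy_defined \<kappa> p n \<longrightarrow>
     0 \<le> signed_energy \<kappa> p n \<and>
     (signed_energy \<kappa> p n = 0 \<longrightarrow> p = null_measure borel \<and> n = null_measure borel))"

definition Eplus :: "'a::topological_space kernel \<Rightarrow> 'a measure set" where
  "Eplus \<kappa> = {\<mu> \<in> radon. energy \<kappa> \<mu> \<mu> < \<infinity>}"

text \<open>
  The energy norm of \<open>\<mu> - \<nu>\<close> for \<open>\<mu>, \<nu>\<close> in \<open>Eplus \<kappa>\<close>: by bilinearity the energy of the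
  difference is given by the same formula although \<open>\<mu>\<close> and \<open>\<nu>\<close> need not be mutually singular.
  The absolute value is redundant there under the energy principle; it makes the function nonnegative
  everywhere, as the locale \<open>Metric_space\<close> requires.
\<close>
definition strong_dist :: "'a kernel \<Rightarrow> 'a measure \<Rightarrow> 'a measure \<Rightarrow> real" where
  "strong_dist \<kappa> \<mu> \<nu> = sqrt \<bar>real_of_ereal (signed_energy \<kappa> \<mu> \<nu>)\<bar>"

definition strong_topology :: "'a::topological_space kernel \<Rightarrow> 'a measure topology" where
  "strong_topology \<kappa> = Metric_space.mtopology (Eplus \<kappa>) (strong_dist \<kappa>)"

definition perfect_kernel :: "'a::topological_space kernel \<Rightarrow> bool" where
  "perfect_kernel \<kappa> \<longleftrightarrow> energy_principle \<kappa> \<and>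
     Metric_space.mcomplete (Eplus \<kappa>) (strong_dist \<kappa>) \<and>
     (\<forall>\<U>. openin (subtopology vague_topology (Eplus \<kappa>)) \<U> \<longrightarrow> openin (strong_topology \<kappa>) \<U>)"

definition domination_principle :: "'a::topological_space kernel \<Rightarrow> bool" where
  "domination_principle \<kappa> \<longleftrightarrow> (\<forall>\<mu>\<in>Eplus \<kappa>. \<forall>\<nu>\<in>radon.
     (AE x in \<mu>. pot \<kappa> \<mu> x \<le> pot \<kappa> \<nu> x) \<longrightarrow> (\<forall>x. pot \<kappa> \<mu> x \<le> pot \<kappa> \<nu> x))"

definition ugaheri_principle :: "'a::topological_space kernel \<Rightarrow> real \<Rightarrow> bool" where
  "ugaheri_principle \<kappa> h \<longleftrightarrow> (\<forall>\<mu>\<in>Eplus \<kappa>. \<forall>c::real. 0 < c \<longrightarrow>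
     (AE x in \<mu>. pot \<kappa> \<mu> x \<le> ennreal c) \<longrightarrow> (\<forall>x. pot \<kappa> \<mu> x \<le> ennreal (h * c)))"


subsection \<open>Capacities\<close>

text \<open>Only used for compact sets; note \<open>1 / \<infinity> = 0\<close> and \<open>1 / 0 = \<infinity>\<close> in \<open>ennreal\<close>.\<close>
definition cap :: "'a::topological_space kernel \<Rightarrow> 'a set \<Rightarrow> ennreal" where
  "cap \<kappa> K = 1 / (INF \<mu>\<in>{\<mu>\<in>radon. meas_supp \<mu> \<subseteq> K \<and> emeasure \<mu> UNIV = 1}. energy \<kappa> \<mu> \<mu>)"

definition inner_cap :: "'a::topological_space kernel \<Rightarrow> 'a set \<Rightarrow> ennreal" where
  "inner_cap \<kappa> Q = (SUP K\<in>{K. compact K \<and> K \<subseteq> Q}. cap \<kappa> K)"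

definition outer_cap :: "'a::topological_space kernel \<Rightarrow> 'a set \<Rightarrow> ennreal" where
  "outer_cap \<kappa> Q = (INF D\<in>{D. open D \<and> Q \<subseteq> D}. inner_cap \<kappa> D)"

definition nearly_everywhere :: "'a::topological_space kernel \<Rightarrow> 'a set \<Rightarrow> ('a \<Rightarrow> bool) \<Rightarrow> bool" where
  "nearly_everywhere \<kappa> Q P \<longleftrightarrow> inner_cap \<kappa> {x\<in>Q. \<not> P x} = 0"

definition quasi_everywhere :: "'a::topological_space kernel \<Rightarrow> 'a set \<Rightarrow> ('a \<Rightarrow> bool) \<Rightarrow> bool" where
  "quasi_everywhere \<kappa> Q P \<longleftrightarrow> outer_cap \<kappa> {x\<in>Q. \<not> P x} = 0"


subsection \<open>Balayage\<close>

definition Eplus_on :: "'a::topological_space kernel \<Rightarrow> 'a set \<Rightarrow> 'a measure set" where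
  "Eplus_on \<kappa> Q = {\<mu> \<in> Eplus \<kappa>. concentrated_on \<mu> Q}"

definition Eclosed_on :: "'a::topological_space kernel \<Rightarrow> 'a set \<Rightarrow> 'a measure set" where
  "Eclosed_on \<kappa> Q = strong_topology \<kappa> closure_of Eplus_on \<kappa> Q"

text \<open>
  Balayage of a measure \<open>\<theta>\<close> of finite energy (the outer version is meant for Borel sets \<open>Q\<close>).
\<close>
definition inner_swept :: "'a::topological_space kernel \<Rightarrow> 'a set \<Rightarrow> 'a measure \<Rightarrow> 'a measure" where
  "inner_swept \<kappa> Q \<theta> = (THE \<nu>. \<nu> \<in> Eclosed_on \<kappa> Q \<and>
     nearly_everywhere \<kappa> Q (\<lambda>x. pot \<kappa> \<nu> x = pot \<kappa> \<theta> x))"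

definition outer_swept :: "'a::topological_space kernel \<Rightarrow> 'a set \<Rightarrow> 'a measure \<Rightarrow> 'a measure" where
  "outer_swept \<kappa> Q \<theta> = (THE \<nu>. \<nu> \<in> Eclosed_on \<kappa> Q \<and>
     quasi_everywhere \<kappa> Q (\<lambda>x. pot \<kappa> \<nu> x = pot \<kappa> \<theta> x))"

text \<open>
  Balayage of a measure \<open>\<omega>\<close> of possibly infinite energy.  Existence and uniqueness are not built
  into the relations.
\<close>
definition is_inner_balayage ::
    "'a::topological_space kernel \<Rightarrow> 'a set \<Rightarrow> 'a measure \<Rightarrow> 'a measure \<Rightarrow> bool" where
  "is_inner_balayage \<kappa> Q \<omega> \<nu> \<longleftrightarrow> \<nu> \<in> Eclosed_on \<kappa> Q \<and>
     (\<forall>\<theta>\<in>Eplus \<kappa>. energy \<kappa> \<nu> \<theta> = energy \<kappa> (inner_swept \<kappa> Q \<theta>) \<omega>)"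

definition is_outer_balayage ::
    "'a::topological_space kernel \<Rightarrow> 'a set \<Rightarrow> 'a measure \<Rightarrow> 'a measure \<Rightarrow> bool" where
  "is_outer_balayage \<kappa> Q \<omega> \<nu> \<longleftrightarrow> \<nu> \<in> Eclosed_on \<kappa> Q \<and>
     (\<forall>\<theta>\<in>Eplus \<kappa>. energy \<kappa> \<nu> \<theta> = energy \<kappa> (outer_swept \<kappa> Q \<theta>) \<omega>)"

definition inner_balayage :: "'a::topological_space kernel \<Rightarrow> 'a set \<Rightarrow> 'a measure \<Rightarrow> 'a measure" where
  "inner_balayage \<kappa> Q \<omega> = (THE \<nu>. is_inner_balayage \<kappa> Q \<omega> \<nu>)"

definition outer_balayage :: "'a::topological_space kernel \<Rightarrow> 'a set \<Rightarrow> 'a measure \<Rightarrow> 'a measure" where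
  "outer_balayage \<kappa> Q \<omega> = (THE \<nu>. is_outer_balayage \<kappa> Q \<omega> \<nu>)"

end

theory Submission
  imports Defs
begin

text \<open>
  Strong completeness turns a minimizing sequence of \<open>\<parallel>\<mu>\<parallel>\<^sup>2 - 2 \<integral> U\<^sup>\<omega> d\<mu>\<close> over the measures on a compact
  \<open>K \<subseteq> A\<close> into a minimizer \<open>\<nu>\<^sub>K\<close>, because \<open>U\<^sup>\<omega>\<close> is continuous on \<open>K\<close> and strong convergence implies
  vague convergence. Variation gives \<open>U\<^sup>\<nu> = U\<^sup>\<omega>\<close> \<open>\<nu>\<close>-a.e. for \<open>\<nu> = \<nu>\<^sub>K\<close>, so \<open>U\<^sup>\<nu> \<le> U\<^sup>\<omega>\<close> by domination, and
  integrating against the equilibrium measure of \<open>K\<close>, whose potential is at most \<open>h\<close>, bounds the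
  energies uniformly in \<open>K\<close>. Since these energies increase with \<open>K\<close>, some increasing sequence
  \<open>K\<^sub>n\<close> exhausts their supremum; \<open>\<nu>\<^sub>K\<close> along it is Cauchy, and its limit \<open>\<nu>\<close> is the balayage to every
  \<open>Q\<close> between \<open>A\<^sub>0 = \<Union>K\<^sub>n\<close> and \<open>A\<close>, as \<open>U\<^sup>\<nu> = U\<^sup>\<omega>\<close> n.e. on \<open>A\<close> while \<open>U\<^sup>\<nu> \<le> U\<^sup>\<omega>\<close> everywhere. The same
  argument for measures of finite energy yields the swept measures. On the \<open>K\<^sub>\<sigma>\<close>-set \<open>A\<^sub>0\<close> inner and
  outer sweeping coincide: the exceptional set is itself a \<open>K\<^sub>\<sigma>\<close>-set, and compact sets of capacity
  zero have outer capacity zero.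
\<close>

section \<open>Locally compact second countable spaces\<close>

text \<open>Two obstacles shape the argument. The measure \<omega> may have infinite energy, so it
  is not a vector of the pre-Hilbert space, and integrating its potential need not be a strongly
  continuous functional. And \<open>A\<close> is arbitrary, possibly non-measurable, so nothing is
  minimized over measures on \<open>A\<close> directly. On a compact \<open>K \<subseteq> A\<close>
  both disappear: the mass of a measure on \<open>K\<close> is at most a constant times its norm,
  and on \<open>K\<close> the potential of \<omega> agrees with a continuous function of compact
  support. A third difficulty comes from the closure: measures in
  \<open>Eclosed_on \<kappa> Q\<close> need not be concentrated on \<open>Q\<close>, so an equality
  n.e. on \<open>Q\<close> cannot be integrated against them. Against finite-energy potentials,
  strong continuity bridges the gap; against the potential of \<omega>, one inequality comes from
  lower semicontinuity along strongly convergent sequences and the other from the pointwise bound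
  that domination provides. Only positive measures occur, so a signed measure is always handled as a
  pair, with \<open>sq p n\<close> in the role of the squared norm of p - n.\<close>

lemma Hausdorff_space_euclidean_t2: "Hausdorff_space (euclidean :: 'a::t2_space topology)"
  unfolding Hausdorff_space_def disjnt_def topspace_euclidean open_openin[symmetric]
  by (intro allI impI, elim conjE, drule hausdorff) blast

lemma compact_closure_subset:
  fixes L :: "'a::t2_space set"
  assumes "compact L" "S \<subseteq> L"
  shows "compact (closure S)"
proof -
  have "closure S \<subseteq> L" using assms by (simp add: closure_minimal compact_imp_closed)
  then have "closure S = L \<inter> closure S" by blast
  then show ?thesis using compact_Int_closed[OF assms(1) closed_closure] by metis
qed

text \<open>Normality is what Urysohn's lemma and Tietze's theorem require: local compactness gives
  regularity, and second countability upgrades it. The countable basis of the type class is restated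
  for the abstract topology \<open>euclidean\<close>.\<close>

lemma locally_compact_imp_normal_space:
  assumes "locally_compact_space (euclidean :: 'a::{second_countable_topology, t2_space} topology)"
  shows "normal_space (euclidean :: 'a topology)"
proof -
  have h: "Hausdorff_space (euclidean :: 'a topology)"
    by (rule Hausdorff_space_euclidean_t2)
  have r: "regular_space (euclidean :: 'a topology)"
    using locally_compact_Hausdorff_imp_regular_space[OF assms h] .
  have s: "second_countable (euclidean :: 'a topology)"
  proof -
    obtain B :: "'a set set" where B: "countable B" "topological_basis B"
      using ex_countable_basis by blast
    then show ?thesis unfolding second_countable_def
      using topological_basis_open[OF B(2)] topological_basisE[OF B(2)]
      by (intro exI[of _ B]) (simp, metis)
  qed
  show ?thesis
    using regular_second_countable_imp_hereditarily_normal_space[OF conjI[OF r s]]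
    unfolding hereditarily_def by (metis order_refl subtopology_topspace)
qed

lemma compact_neighbourhood:
  fixes K U :: "'a::{second_countable_topology, t2_space} set"
  assumes lc: "locally_compact_space (euclidean :: 'a topology)"
    and K: "compact K" and U: "open U" "K \<subseteq> U"
  obtains V L where "open V" "compact L" "K \<subseteq> V" "V \<subseteq> L" "L \<subseteq> U"
proof -
  have h: "Hausdorff_space (euclidean :: 'a topology)"
    by (rule Hausdorff_space_euclidean_t2)
  have nb: "neighbourhood_base_of (compactin euclidean) (euclidean :: 'a topology)"
    using lc h locally_compact_space_neighbourhood_base by blast
  have "\<exists>V L. open V \<and> compact L \<and> x \<in> V \<and> V \<subseteq> L \<and> L \<subseteq> U" if "x \<in> K" for x
  proof -
    have "\<exists>V L. openin euclidean V \<and> compactin euclidean L \<and> x \<in> V \<and> V \<subseteq> L \<and> L \<subseteq> U"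
      using nb[unfolded neighbourhood_base_of, rule_format, of U x] U that by auto
    then show ?thesis by simp
  qed
  then obtain V L where VL: "\<And>x. x \<in> K \<Longrightarrow> open (V x) \<and> compact (L x) \<and> x \<in> V x \<and> V x \<subseteq> L x \<and> L x \<subseteq> U"
    by metis
  obtain D where D: "D \<subseteq> K" "finite D" "K \<subseteq> (\<Union>x\<in>D. V x)"
    using compactE_image[OF K, of K V] VL by blast
  show thesis
  proof
    show "open (\<Union>x\<in>D. V x)" using D VL by blast
    show "compact (\<Union>x\<in>D. L x)" using D VL by (intro compact_UN) auto
    show "K \<subseteq> (\<Union>x\<in>D. V x)" by fact
    show "(\<Union>x\<in>D. V x) \<subseteq> (\<Union>x\<in>D. L x)" using D VL by blast
    show "(\<Union>x\<in>D. L x) \<subseteq> U" using D VL by blast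
  qed
qed

text \<open>The function vanishes off the intermediate open set \<open>V\<close>, not just off
  \<open>U\<close>: its support then lies in the compact \<open>L\<close>, which makes it a test
  function of the vague topology.\<close>

lemma compact_bump:
  fixes K U :: "'a::{second_countable_topology, t2_space} set"
  assumes lc: "locally_compact_space (euclidean :: 'a topology)"
    and K: "compact K" and U: "open U" "K \<subseteq> U"
  obtains f :: "'a \<Rightarrow> real" where "continuous_on UNIV f" "compact (closure {x. f x \<noteq> 0})"
    "\<And>x. 0 \<le> f x" "\<And>x. f x \<le> 1" "\<And>x. x \<in> K \<Longrightarrow> f x = 1" "\<And>x. x \<notin> U \<Longrightarrow> f x = 0"
proof -
  obtain V L where VL: "open V" "compact L" "K \<subseteq> V" "V \<subseteq> L" "L \<subseteq> U"
    using compact_neighbourhood[OF lc K U] .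
  have 1: "closedin euclidean (- V)" "closedin euclidean K" "disjnt (- V) K"
    using VL K by (auto simp: disjnt_def compact_imp_closed)
  obtain f where f: "continuous_map euclidean (subtopology euclideanreal {0..1}) f"
      "f ` (- V) \<subseteq> {0}" "f ` K \<subseteq> {1}"
    using Urysohn_lemma[OF locally_compact_imp_normal_space[OF lc] 1, of 0 1] by auto
  have c: "continuous_on UNIV f" and r: "\<And>x. 0 \<le> f x \<and> f x \<le> 1"
    using f(1) by (auto simp: continuous_map_in_subtopology)
  have "{x. f x \<noteq> 0} \<subseteq> L" using f(2) VL by blast
  then have cc: "compact (closure {x. f x \<noteq> 0})" by (rule compact_closure_subset[OF VL(2)])
  show thesis
  proof (rule that[OF c cc])
    show "f x = 0" if "x \<notin> U" for x using that VL f(2) by blast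
    show "f x = 1" if "x \<in> K" for x using that f(3) by blast
  qed (use r in auto)
qed

text \<open>Tietze's extension is uncontrolled far from \<open>K\<close>; multiplying it by a bump
  equal to 1 on \<open>K\<close> makes its support compact and does not change it on
  \<open>K\<close>.\<close>

lemma compact_supported_extension:
  fixes K :: "'a::{second_countable_topology, t2_space} set" and f :: "'a \<Rightarrow> real"
  assumes lc: "locally_compact_space (euclidean :: 'a topology)"
    and K: "compact K" and f: "continuous_on K f"
  obtains g :: "'a \<Rightarrow> real" where "continuous_on UNIV g" "compact (closure {x. g x \<noteq> 0})"
    "\<And>x. x \<in> K \<Longrightarrow> g x = f x"
proof -
  obtain b where b: "continuous_on UNIV b" "compact (closure {x. b x \<noteq> 0})" "\<And>x. x \<in> K \<Longrightarrow> b x = (1::real)"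
    by (rule compact_bump[OF lc K open_UNIV subset_UNIV]) metis
  have "continuous_map (subtopology euclidean K) euclideanreal f"
    using f by simp
  then obtain g where g: "continuous_map euclidean euclideanreal g" "\<And>x. x \<in> K \<Longrightarrow> g x = f x"
    using Tietze_extension_realinterval[OF locally_compact_imp_normal_space[OF lc], of K UNIV f] K
    by (auto simp: compact_imp_closed)
  show thesis
  proof
    show "continuous_on UNIV (\<lambda>x. b x * g x)" using b g by (intro continuous_intros) auto
    have "{x. b x * g x \<noteq> 0} \<subseteq> closure {x. b x \<noteq> 0}" using closure_subset by fastforce
    then show "compact (closure {x. b x * g x \<noteq> 0})" by (rule compact_closure_subset[OF b(2)])
    show "b x * g x = f x" if "x \<in> K" for x using that b g by simp
  qed
qed

text \<open>Each \<open>F n\<close> lies in the interior of the next set, so that a bump function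
  fits between \<open>F n\<close> and the complement of \<open>F (Suc n)\<close>.\<close>

lemma compact_exhaustion:
  fixes U :: "'a::{second_countable_topology, t2_space} set"
  assumes lc: "locally_compact_space (euclidean :: 'a topology)" and U: "open U"
  obtains F :: "nat \<Rightarrow> 'a set" where "\<And>n. compact (F n)" "\<And>n. F n \<subseteq> interior (F (Suc n))"
    "(\<Union>n. F n) = U" "incseq F"
proof -
  obtain B :: "'a set set" where B: "countable B" "topological_basis B"
    using ex_countable_basis by blast
  define C where "C = {b\<in>B. \<exists>L. compact L \<and> b \<subseteq> L \<and> L \<subseteq> U}"
  have CU: "U \<subseteq> \<Union>C"
  proof
    fix x assume x: "x \<in> U"
    obtain V L where VL: "open V" "compact L" "{x} \<subseteq> V" "V \<subseteq> L" "L \<subseteq> U"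
      using compact_neighbourhood[OF lc, of "{x}" U] U x by auto
    obtain b where "b \<in> B" "x \<in> b" "b \<subseteq> V" using topological_basisE[OF B(2) VL(1)] VL(3) by blast
    then show "x \<in> \<Union>C" using VL by (auto simp: C_def)
  qed
  have "\<forall>b\<in>C. \<exists>L. compact L \<and> b \<subseteq> L \<and> L \<subseteq> U" by (auto simp: C_def)
  then obtain L where L: "\<And>b. b \<in> C \<Longrightarrow> compact (L b) \<and> b \<subseteq> L b \<and> L b \<subseteq> U" by metis
  have cC: "countable C" using B(1) by (auto simp: C_def)
  \<comment> \<open>If \<open>C\<close> is empty then so is \<open>U\<close>, by \<open>CU\<close>,
    and the default \<open>{}\<close> is harmless.\<close>
  define G where "G n = (if C = {} then {} else L (from_nat_into C n))" for n
  have G: "compact (G n)" "G n \<subseteq> U" for n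
    using L from_nat_into[of C n] by (auto simp: G_def)
  have GU: "U \<subseteq> (\<Union>n. G n)"
  proof
    fix x assume "x \<in> U"
    then obtain b where b: "b \<in> C" "x \<in> b" using CU by blast
    then have "x \<in> G (to_nat_on C b)" using L cC by (auto simp: G_def)
    then show "x \<in> (\<Union>n. G n)" by blast
  qed
  have "\<exists>F. \<forall>n. (compact (F n) \<and> F n \<subseteq> U) \<and> (F n \<union> G n \<subseteq> interior (F (Suc n)))"
  proof (rule dependent_nat_choice)
    show "\<exists>x. compact x \<and> x \<subseteq> U" by (intro exI[of _ "{}"]) auto
  next
    fix x n assume x: "compact x \<and> x \<subseteq> U"
    have "compact (x \<union> G n)" "x \<union> G n \<subseteq> U" using x G by (auto intro: compact_Un)
    from compact_neighbourhood[OF lc this(1) U this(2)]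
    obtain V M where VM: "open V" "compact M" "x \<union> G n \<subseteq> V" "V \<subseteq> M" "M \<subseteq> U" .
    then have "V \<subseteq> interior M" by (simp add: interior_maximal)
    then show "\<exists>y. (compact y \<and> y \<subseteq> U) \<and> x \<union> G n \<subseteq> interior y"
      using VM by (intro exI[of _ M]) auto
  qed
  then obtain F where F: "\<And>n. compact (F n)" "\<And>n. F n \<subseteq> U" "\<And>n. F n \<union> G n \<subseteq> interior (F (Suc n))" by blast
  show thesis
  proof (rule that[of F])
    show "compact (F n)" "F n \<subseteq> interior (F (Suc n))" for n using F by auto
    have "G n \<subseteq> F (Suc n)" for n using F(3)[of n] interior_subset by blast
    then have "(\<Union>n. G n) \<subseteq> (\<Union>n. F n)" by (intro UN_least) blast
    moreover have "(\<Union>n. F n) \<subseteq> U" using F(2) by (rule UN_least)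
    ultimately show "(\<Union>n. F n) = U" using GU by (meson order_antisym order_trans)
    show "incseq F"
    proof (rule incseq_SucI)
      show "F n \<subseteq> F (Suc n)" for n using F(3)[of n] interior_subset[of "F (Suc n)"] by blast
    qed
  qed
qed

section \<open>Sums and regularity of Radon measures\<close>

definition madd :: "'a::topological_space measure \<Rightarrow> 'a measure \<Rightarrow> 'a measure" where
  "madd p q = measure_of UNIV (sets borel) (\<lambda>B. emeasure p B + emeasure q B)"

lemma sets_madd [simp, measurable_cong]: "sets (madd p q) = sets borel"
  unfolding madd_def by (metis sets.sets_measure_of_eq space_borel)

lemma emeasure_madd:
  assumes p: "sets p = sets borel" and q: "sets q = sets borel" and B: "B \<in> sets borel"
  shows "emeasure (madd p q) B = emeasure p B + emeasure q B"
  unfolding madd_def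
proof (rule emeasure_measure_of_sigma)
  show "sigma_algebra (UNIV :: 'a set) (sets borel)" by (metis sets.sigma_algebra_axioms space_borel)
  show "positive (sets borel) (\<lambda>B. emeasure p B + emeasure q B)" by (simp add: positive_def)
  show "countably_additive (sets borel) (\<lambda>B. emeasure p B + emeasure q B)"
    unfolding countably_additive_def
  proof (intro allI impI)
    fix A :: "nat \<Rightarrow> 'a set" assume A: "range A \<subseteq> sets borel" "disjoint_family A"
    show "(\<Sum>i. emeasure p (A i) + emeasure q (A i)) = emeasure p (\<Union> (range A)) + emeasure q (\<Union> (range A))"
      using A p q by (subst suminf_add[symmetric]) (auto simp: suminf_emeasure)
  qed
qed (fact B)

lemma nn_integral_madd:
  assumes p: "sets p = sets borel" and q: "sets q = sets borel" and f: "f \<in> borel_measurable borel"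
  shows "(\<integral>\<^sup>+x. f x \<partial>madd p q) = (\<integral>\<^sup>+x. f x \<partial>p) + (\<integral>\<^sup>+x. f x \<partial>q)"
  using f
proof (induction rule: borel_measurable_induct)
  case (cong f g)
  then have "f = g" by auto
  then show ?case using cong by simp
next
  case (set A)
  then show ?case using p q by (simp add: emeasure_madd)
next
  case (mult u c)
  note [measurable_cong] = p q
  have [measurable]: "u \<in> borel_measurable borel" by fact
  have "u \<in> borel_measurable p" "u \<in> borel_measurable q" "u \<in> borel_measurable (madd p q)" by measurable
  then show ?case using mult by (simp add: nn_integral_cmult distrib_left)
next
  case (add u v)
  note [measurable_cong] = p q
  have [measurable]: "u \<in> borel_measurable borel" "v \<in> borel_measurable borel" by fact+
  have "u \<in> borel_measurable p" "u \<in> borel_measurable q" "u \<in> borel_measurable (madd p q)"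
     "v \<in> borel_measurable p" "v \<in> borel_measurable q" "v \<in> borel_measurable (madd p q)" by measurable
  then show ?case using add by (simp add: nn_integral_add add_ac)
next
  case (seq U)
  note [measurable_cong] = p q
  have [measurable]: "U i \<in> borel_measurable borel" for i using seq by simp
  have m: "U i \<in> borel_measurable p" "U i \<in> borel_measurable q" "U i \<in> borel_measurable (madd p q)" for i
    by measurable
  have inc: "incseq (\<lambda>i. \<integral>\<^sup>+x. U i x \<partial>M)" for M
    using seq(3) by (auto simp: incseq_def le_fun_def intro!: nn_integral_mono)
  have mc: "(\<integral>\<^sup>+x. Sup (range U) x \<partial>M) = (SUP i. \<integral>\<^sup>+x. U i x \<partial>M)"
    if "\<And>i. U i \<in> borel_measurable M" for M
    using nn_integral_monotone_convergence_SUP[of U M] seq(3) that by (simp add: image_comp)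
  have "(\<integral>\<^sup>+x. Sup (range U) x \<partial>madd p q) = (SUP i. \<integral>\<^sup>+x. U i x \<partial>madd p q)"
    using m(3) by (rule mc)
  also have "\<dots> = (SUP i. (\<integral>\<^sup>+x. U i x \<partial>p) + (\<integral>\<^sup>+x. U i x \<partial>q))" by (simp only: seq.IH)
  also have "\<dots> = (SUP i. \<integral>\<^sup>+x. U i x \<partial>p) + (SUP i. \<integral>\<^sup>+x. U i x \<partial>q)"
    by (intro ennreal_SUP_add inc)
  also have "\<dots> = (\<integral>\<^sup>+x. Sup (range U) x \<partial>p) + (\<integral>\<^sup>+x. Sup (range U) x \<partial>q)"
    using mc[OF m(1)] mc[OF m(2)] by simp
  finally show ?case .
qed

section \<open>Inner regularity of Radon measures\<close>

lemma sets_radon: "\<mu> \<in> radon \<Longrightarrow> sets \<mu> = sets borel"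
  by (simp add: radon_def)

lemma space_radon: "\<mu> \<in> radon \<Longrightarrow> space \<mu> = UNIV"
  by (metis sets_eq_imp_space_eq sets_radon space_borel)

lemma radon_compact_finite: "\<mu> \<in> radon \<Longrightarrow> compact K \<Longrightarrow> emeasure \<mu> K < \<infinity>"
  by (simp add: radon_def)

lemma radon_SUP:
  "\<mu> \<in> radon \<Longrightarrow> B \<in> sets borel \<Longrightarrow> emeasure \<mu> B = (SUP K\<in>{K. compact K \<and> K \<subseteq> B}. emeasure \<mu> K)"
  by (simp add: radon_def)

lemma radon_pos_compact:
  assumes "\<mu> \<in> radon" "B \<in> sets borel" "emeasure \<mu> B > c"
  obtains K where "compact K" "K \<subseteq> B" "emeasure \<mu> K > c"
proof -
  have "\<exists>K\<in>{K. compact K \<and> K \<subseteq> B}. c < emeasure \<mu> K"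
    using assms radon_SUP[OF assms(1,2)] by (simp add: less_SUP_iff)
  then show thesis using that by blast
qed

lemma compact_borel: "compact K \<Longrightarrow> K \<in> sets (borel :: 'a::t2_space measure)"
  by (simp add: borel_closed compact_imp_closed)

text \<open>Intersecting with a compact set makes the measures finite, so inner regularity can be
  expressed by a small difference set instead of a supremum. In this form it passes easily to sums
  and to dominated measures.\<close>

lemma radon_inner_approx:
  fixes \<mu> :: "'a::t2_space measure"
  assumes \<mu>: "\<mu> \<in> radon" and B: "B \<in> sets borel" and L: "compact L" and e: "0 < (e::ennreal)"
  obtains C where "compact C" "C \<subseteq> B \<inter> L" "emeasure \<mu> (B \<inter> L - C) \<le> e"
proof -
  have BL: "B \<inter> L \<in> sets borel" using B compact_borel[OF L] by blast
  have fin: "emeasure \<mu> (B \<inter> L) < \<infinity>"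
    using radon_compact_finite[OF \<mu> L] emeasure_mono[of "B \<inter> L" L \<mu>] compact_borel[OF L] sets_radon[OF \<mu>]
    by (simp add: le_less_trans)
  obtain C where C: "compact C" "C \<subseteq> B \<inter> L" "emeasure \<mu> (B \<inter> L) \<le> emeasure \<mu> C + e"
  proof (cases "emeasure \<mu> (B \<inter> L) = 0")
    case True then show thesis using that[of "{}"] by simp
  next
    case False
    have "emeasure \<mu> (B \<inter> L) - e < emeasure \<mu> (B \<inter> L)"
      using False fin e by (simp add: ennreal_between(1) zero_less_iff_neq_zero)
    then obtain C where C: "compact C" "C \<subseteq> B \<inter> L" "emeasure \<mu> (B \<inter> L) - e < emeasure \<mu> C"
      using radon_pos_compact[OF \<mu> BL] by blast
    then have "emeasure \<mu> (B \<inter> L) \<le> emeasure \<mu> C + e"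
      by (metis add.commute ennreal_minus_le_iff less_imp_le)
    then show thesis using that C by blast
  qed
  have Cb: "C \<in> sets \<mu>" "B \<inter> L \<in> sets \<mu>" using C(1) compact_borel sets_radon[OF \<mu>] BL by auto
  have "emeasure \<mu> (B \<inter> L - C) = emeasure \<mu> (B \<inter> L) - emeasure \<mu> C"
    using Cb C(2) radon_compact_finite[OF \<mu> C(1)] by (intro emeasure_Diff) auto
  also have "\<dots> \<le> e"
    using C(3) fin by (auto simp: ennreal_minus_le_iff add.commute)
  finally show thesis using that C by blast
qed

text \<open>A compact exhaustion cuts \<open>B\<close> into increasing pieces
  \<open>B \<inter> F n\<close> of finite measure, to which the local approximation applies;
  sigma-compactness thus recovers inner regularity even on sets of infinite measure.\<close>

lemma radonI:
  fixes \<mu> :: "'a::{second_countable_topology, t2_space} measure"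
  assumes lc: "locally_compact_space (euclidean :: 'a topology)"
    and s: "sets \<mu> = sets borel" and fin: "\<And>K. compact K \<Longrightarrow> emeasure \<mu> K < \<infinity>"
    and ap: "\<And>B L e. B \<in> sets borel \<Longrightarrow> compact L \<Longrightarrow> 0 < (e::real) \<Longrightarrow>
       \<exists>C. compact C \<and> C \<subseteq> B \<inter> L \<and> emeasure \<mu> (B \<inter> L - C) \<le> ennreal e"
  shows "\<mu> \<in> radon"
  unfolding radon_def mem_Collect_eq
proof (intro conjI allI impI ballI s fin)
  fix B :: "'a set" assume B: "B \<in> sets borel"
  let ?S = "SUP K\<in>{K. compact K \<and> K \<subseteq> B}. emeasure \<mu> K"
  obtain F :: "nat \<Rightarrow> 'a set" where F: "\<And>n. compact (F n)" "(\<Union>n. F n) = UNIV" "incseq F"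
    using compact_exhaustion[OF lc open_UNIV] by metis
  have m: "B \<inter> F n \<in> sets \<mu>" for n using B F(1) compact_borel s by (metis sets.Int)
  have "emeasure \<mu> B = emeasure \<mu> (\<Union>n. B \<inter> F n)" using F(2) by (metis Int_UNIV_right Int_UN_distrib)
  also have "\<dots> = (SUP n. emeasure \<mu> (B \<inter> F n))"
    using F(3) m by (intro SUP_emeasure_incseq[symmetric]) (auto simp: incseq_def)
  also have "\<dots> \<le> ?S"
  proof (rule SUP_least)
    fix n
    show "emeasure \<mu> (B \<inter> F n) \<le> ?S"
    proof (rule ennreal_le_epsilon)
      fix e :: real assume e: "0 < e"
      obtain C where C: "compact C" "C \<subseteq> B \<inter> F n" "emeasure \<mu> (B \<inter> F n - C) \<le> ennreal e"
        using ap[OF B F(1) e] by blast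
      have Cb: "C \<in> sets \<mu>" using C(1) compact_borel s by auto
      have eq: "emeasure \<mu> (B \<inter> F n) = emeasure \<mu> C + emeasure \<mu> (B \<inter> F n - C)"
      proof -
        have "C \<union> (B \<inter> F n - C) = B \<inter> F n" using C(2) by blast
        then show ?thesis
          using plus_emeasure[of C \<mu> "B \<inter> F n - C"] Cb sets.Diff[OF m[of n] Cb] by simp
      qed
      have "emeasure \<mu> C \<le> ?S" by (rule SUP_upper[where f="emeasure \<mu>"]) (use C in simp)
      then show "emeasure \<mu> (B \<inter> F n) \<le> ?S + ennreal e" unfolding eq using C(3) by (rule add_mono)
    qed
  qed
  finally have 1: "emeasure \<mu> B \<le> ?S" .
  have "?S \<le> emeasure \<mu> B"
  proof (rule SUP_least)
    show "emeasure \<mu> K \<le> emeasure \<mu> B" if "K \<in> {K. compact K \<and> K \<subseteq> B}" for K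
      using emeasure_mono[of K B \<mu>] that B s by simp
  qed
  with 1 show "emeasure \<mu> B = ?S" by (rule order_antisym)
qed

text \<open>A compact set that approximates for \<open>\<mu>\<close> also approximates for
  \<open>p\<close>, at a smaller tolerance. Multiples, bounded densities and the parts of a Jordan
  decomposition are all covered by this.\<close>

lemma radon_dominated:
  fixes \<mu> :: "'a::{second_countable_topology, t2_space} measure"
  assumes lc: "locally_compact_space (euclidean :: 'a topology)"
    and \<mu>: "\<mu> \<in> radon" and s: "sets p = sets borel"
    and le: "\<And>B. B \<in> sets borel \<Longrightarrow> emeasure p B \<le> ennreal c * emeasure \<mu> B"
  shows "p \<in> radon"
proof (rule radonI[OF lc s])
  show "emeasure p K < \<infinity>" if "compact K" for K
    using le[OF compact_borel[OF that]] radon_compact_finite[OF \<mu> that]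
    by (metis ennreal_less_top ennreal_mult_less_top infinity_ennreal_def le_less_trans)
next
  fix B L :: "'a set" and e :: real assume B: "B \<in> sets borel" and L: "compact L" and e: "0 < e"
  \<comment> \<open>The summand 1 covers \<open>c = 0\<close>, and the absolute value covers
    negative \<open>c\<close>, for which \<open>ennreal c\<close> is 0.\<close>
  define d where "d = e / (\<bar>c\<bar> + 1)"
  have d: "0 < d" "\<bar>c\<bar> * d \<le> e" using e by (auto simp: d_def field_simps)
  obtain C where C: "compact C" "C \<subseteq> B \<inter> L" "emeasure \<mu> (B \<inter> L - C) \<le> ennreal d"
    using radon_inner_approx[OF \<mu> B L, of "ennreal d"] d(1) by auto
  have "emeasure p (B \<inter> L - C) \<le> ennreal c * emeasure \<mu> (B \<inter> L - C)"
    using B compact_borel[OF L] compact_borel[OF C(1)] by (intro le) auto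
  also have "\<dots> \<le> ennreal \<bar>c\<bar> * ennreal d" using C by (intro mult_mono ennreal_leI) auto
  also have "\<dots> \<le> ennreal e" using d by (simp flip: ennreal_mult add: ennreal_leI)
  finally show "\<exists>C. compact C \<and> C \<subseteq> B \<inter> L \<and> emeasure p (B \<inter> L - C) \<le> ennreal e" using C by blast
qed

lemma radon_madd:
  fixes p q :: "'a::{second_countable_topology, t2_space} measure"
  assumes lc: "locally_compact_space (euclidean :: 'a topology)"
    and p: "p \<in> radon" and q: "q \<in> radon"
  shows "madd p q \<in> radon"
proof (rule radonI[OF lc sets_madd])
  note em = emeasure_madd[OF sets_radon[OF p] sets_radon[OF q]]
  show "emeasure (madd p q) K < \<infinity>" if "compact K" for K
    using radon_compact_finite[OF p that] radon_compact_finite[OF q that] em[OF compact_borel[OF that]] by simp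
  fix B L :: "'a set" and e :: real assume B: "B \<in> sets borel" and L: "compact L" and e: "0 < e"
  have e2: "0 < ennreal (e/2)" using e by simp
  obtain C where C: "compact C" "C \<subseteq> B \<inter> L" "emeasure p (B \<inter> L - C) \<le> ennreal (e/2)"
    using radon_inner_approx[OF p B L e2] by blast
  obtain D where D: "compact D" "D \<subseteq> B \<inter> L" "emeasure q (B \<inter> L - D) \<le> ennreal (e/2)"
    using radon_inner_approx[OF q B L e2] by blast
  have b: "B \<inter> L - (C \<union> D) \<in> sets borel" "B \<inter> L - C \<in> sets p" "B \<inter> L - D \<in> sets q"
    using B L C(1) D(1) compact_borel sets_radon[OF p] sets_radon[OF q] by auto
  have "emeasure (madd p q) (B \<inter> L - (C \<union> D)) = emeasure p (B \<inter> L - (C \<union> D)) + emeasure q (B \<inter> L - (C \<union> D))"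
    by (rule em[OF b(1)])
  also have "\<dots> \<le> emeasure p (B \<inter> L - C) + emeasure q (B \<inter> L - D)"
    using b by (intro add_mono emeasure_mono) auto
  also have "\<dots> \<le> ennreal (e/2) + ennreal (e/2)" using C D by (intro add_mono) auto
  also have "\<dots> = ennreal e" using e by (simp flip: ennreal_plus)
  finally show "\<exists>C. compact C \<and> C \<subseteq> B \<inter> L \<and> emeasure (madd p q) (B \<inter> L - C) \<le> ennreal e"
    using C D by (intro exI[of _ "C \<union> D"]) (auto intro: compact_Un)
qed

lemma radon_scale:
  fixes p :: "'a::{second_countable_topology, t2_space} measure"
  assumes lc: "locally_compact_space (euclidean :: 'a topology)" and p: "p \<in> radon"
  shows "scale_measure (ennreal c) p \<in> radon"
  by (rule radon_dominated[OF lc p, of _ c]) (simp_all add: sets_radon[OF p])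

lemma radon_density:
  fixes p :: "'a::{second_countable_topology, t2_space} measure"
  assumes lc: "locally_compact_space (euclidean :: 'a topology)" and p: "p \<in> radon"
    and g: "g \<in> borel_measurable borel" "\<And>x. g x \<le> 1"
  shows "density p g \<in> radon"
proof (rule radon_dominated[OF lc p, of _ 1])
  show "sets (density p g) = sets borel" using sets_radon[OF p] by simp
  fix B :: "'a set" assume B: "B \<in> sets borel"
  note [measurable_cong] = sets_radon[OF p]
  have "emeasure (density p g) B = (\<integral>\<^sup>+x. g x * indicator B x \<partial>p)"
    using g B sets_radon[OF p] by (intro emeasure_density) auto
  also have "\<dots> \<le> (\<integral>\<^sup>+x. indicator B x \<partial>p)"
    using g(2) by (intro nn_integral_mono) (auto simp: indicator_def)
  also have "\<dots> = emeasure p B" using B sets_radon[OF p] by simp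
  finally show "emeasure (density p g) B \<le> ennreal 1 * emeasure p B" by simp
qed

lemma radon_sigma_finite:
  fixes \<mu> :: "'a::{second_countable_topology, t2_space} measure"
  assumes lc: "locally_compact_space (euclidean :: 'a topology)" and \<mu>: "\<mu> \<in> radon"
  shows "sigma_finite_measure \<mu>"
proof -
  obtain F :: "nat \<Rightarrow> 'a set" where F: "\<And>n. compact (F n)" "(\<Union>n. F n) = UNIV"
    using compact_exhaustion[OF lc open_UNIV] by metis
  have "\<forall>a\<in>range F. emeasure \<mu> a \<noteq> \<infinity>"
    using radon_compact_finite[OF \<mu>] F(1) by (auto simp: less_top)
  moreover have "range F \<subseteq> sets \<mu>" using F(1) compact_borel sets_radon[OF \<mu>] by auto
  ultimately show ?thesis
    using F(2) space_radon[OF \<mu>] by (intro sigma_finite_measure.intro exI[of _ "range F"]) auto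
qed

text \<open>Local negligibility becomes negligibility because countably many compact sets cover the
  space.\<close>

lemma concentrated_on_iff_AE:
  fixes \<mu> :: "'a::{second_countable_topology, t2_space} measure"
  assumes lc: "locally_compact_space (euclidean :: 'a topology)"
  shows "concentrated_on \<mu> Q \<longleftrightarrow> (AE x in \<mu>. x \<in> Q)"
proof
  assume c: "concentrated_on \<mu> Q"
  obtain F :: "nat \<Rightarrow> 'a set" where F: "\<And>n. compact (F n)" "(\<Union>n. F n) = UNIV"
    using compact_exhaustion[OF lc open_UNIV] by metis
  have "AE x in \<mu>. \<forall>n. x \<in> F n \<longrightarrow> x \<in> Q"
    using c F(1) unfolding concentrated_on_def AE_all_countable by blast
  then show "AE x in \<mu>. x \<in> Q"
  proof (rule AE_mp, intro AE_I2 impI)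
    fix x assume *: "\<forall>n. x \<in> F n \<longrightarrow> x \<in> Q"
    have "x \<in> (\<Union>n. F n)" using F(2) by simp
    then show "x \<in> Q" using * by blast
  qed
next
  assume "AE x in \<mu>. x \<in> Q"
  then show "concentrated_on \<mu> Q" unfolding concentrated_on_def by (auto elim: AE_mp)
qed

lemma radon_null_measure [simp]: "null_measure borel \<in> radon"
  by (auto simp: radon_def image_constant_conv)

lemma integrable_compact_support:
  fixes f :: "'a::{second_countable_topology, t2_space} \<Rightarrow> real"
  assumes \<mu>: "\<mu> \<in> radon" and f: "continuous_on UNIV f" and c: "compact (closure {x. f x \<noteq> 0})"
  shows "integrable \<mu> f"
proof -
  let ?C = "closure {x. f x \<noteq> 0}"
  have "bounded (f ` ?C)" using c f continuous_on_subset by (intro compact_imp_bounded compact_continuous_image) auto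
  then obtain b where b: "\<And>x. x \<in> ?C \<Longrightarrow> norm (f x) \<le> b" unfolding bounded_iff by blast
  have fm: "f \<in> borel_measurable \<mu>" using borel_measurable_continuous_onI[OF f] sets_radon[OF \<mu>]
    by (simp cong: measurable_cong_sets)
  have Cm: "?C \<in> sets \<mu>" using sets_radon[OF \<mu>] by simp
  show ?thesis
  proof (rule integrableI_bounded_set[where A="?C" and B=b])
    show "emeasure \<mu> ?C < \<infinity>" by (rule radon_compact_finite[OF \<mu> c])
    show "AE x\<in>?C in \<mu>. norm (f x) \<le> b" using b by auto
    show "AE x in \<mu>. x \<notin> ?C \<longrightarrow> f x = 0" using closure_subset[of "{x. f x \<noteq> 0}"] by auto
  qed (use Cm fm in auto)
qed

section \<open>The energy form\<close>

locale lc_kernel =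
  fixes \<kappa> :: "'a::{second_countable_topology, t2_space} kernel"
  assumes lc: "locally_compact_space (euclidean :: 'a topology)"
    and ker: "is_kernel \<kappa>"
begin

lemma kernel_sym: "\<kappa> x y = \<kappa> y x"
  using ker unfolding is_kernel_def by simp

text \<open>Lower semicontinuity makes the kernel Borel on the product space, and second
  countability identifies that Borel algebra with the product algebra, as Fubini's theorem
  requires.\<close>

lemma kernel_measurable [measurable]:
  "case_prod \<kappa> \<in> borel_measurable (borel \<Otimes>\<^sub>M borel)"
proof -
  have "case_prod \<kappa> \<in> borel_measurable borel"
  proof (rule borel_measurableI_greater)
    fix a
    have "{z \<in> space borel. a < (case z of (x, y) \<Rightarrow> \<kappa> x y)} = {(x, y). a < \<kappa> x y}" by auto
    moreover have "open {(x, y). a < \<kappa> x y}" using ker unfolding is_kernel_def by blast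
    ultimately show "{z \<in> space borel. a < (case z of (x, y) \<Rightarrow> \<kappa> x y)} \<in> sets borel" by simp
  qed
  then show ?thesis by (simp add: borel_prod)
qed

lemma pot_measurable:
  assumes "\<mu> \<in> radon" shows "pot \<kappa> \<mu> \<in> borel_measurable borel"
proof -
  interpret sigma_finite_measure \<mu> by (rule radon_sigma_finite[OF lc assms])
  note [measurable_cong] = sets_radon[OF assms]
  show ?thesis unfolding pot_def by measurable
qed

lemma pot_measurable':
  assumes "\<mu> \<in> radon" "sets \<nu> = sets borel" shows "pot \<kappa> \<mu> \<in> borel_measurable \<nu>"
  using pot_measurable[OF assms(1)] assms(2) by (simp cong: measurable_cong_sets)

lemma energy_eq_pot:
  assumes "\<mu> \<in> radon" "\<nu> \<in> radon"
  shows "energy \<kappa> \<mu> \<nu> = (\<integral>\<^sup>+x. pot \<kappa> \<nu> x \<partial>\<mu>)"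
proof -
  interpret sigma_finite_measure \<nu> by (rule radon_sigma_finite[OF lc assms(2)])
  note [measurable_cong] = sets_radon[OF assms(1)] sets_radon[OF assms(2)]
  have "case_prod \<kappa> \<in> borel_measurable (\<mu> \<Otimes>\<^sub>M \<nu>)" by measurable
  then show ?thesis unfolding energy_def pot_def
    by (subst nn_integral_fst[symmetric]) (auto simp: case_prod_beta')
qed

lemma energy_sym:
  assumes "\<mu> \<in> radon" "\<nu> \<in> radon"
  shows "energy \<kappa> \<mu> \<nu> = energy \<kappa> \<nu> \<mu>"
proof -
  interpret pair_sigma_finite \<mu> \<nu>
    using radon_sigma_finite[OF lc assms(1)] radon_sigma_finite[OF lc assms(2)] by (rule pair_sigma_finite.intro)
  note [measurable_cong] = sets_radon[OF assms(1)] sets_radon[OF assms(2)]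
  have m: "(\<lambda>(x, y). \<kappa> x y) \<in> borel_measurable (\<mu> \<Otimes>\<^sub>M \<nu>)" by measurable
  have "energy \<kappa> \<mu> \<nu> = (\<integral>\<^sup>+x. \<integral>\<^sup>+y. \<kappa> x y \<partial>\<nu> \<partial>\<mu>)"
    unfolding energy_eq_pot[OF assms] pot_def ..
  also have "\<dots> = (\<integral>\<^sup>+y. \<integral>\<^sup>+x. \<kappa> x y \<partial>\<mu> \<partial>\<nu>)" by (rule Fubini'[OF m, symmetric])
  also have "\<dots> = energy \<kappa> \<nu> \<mu>"
    unfolding energy_eq_pot[OF assms(2,1)] pot_def by (simp add: kernel_sym)
  finally show ?thesis .
qed

lemmas madd_radon [simp, intro] = radon_madd[OF lc]
lemmas scale_radon [simp, intro] = radon_scale[OF lc]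

lemma energy_madd_left:
  assumes "p \<in> radon" "q \<in> radon" "\<nu> \<in> radon"
  shows "energy \<kappa> (madd p q) \<nu> = energy \<kappa> p \<nu> + energy \<kappa> q \<nu>"
  using assms by (simp add: energy_eq_pot nn_integral_madd sets_radon pot_measurable)

lemma energy_madd_right:
  assumes "p \<in> radon" "q \<in> radon" "\<nu> \<in> radon"
  shows "energy \<kappa> \<nu> (madd p q) = energy \<kappa> \<nu> p + energy \<kappa> \<nu> q"
  using energy_madd_left[OF assms] assms by (simp add: energy_sym[of \<nu>])

lemma energy_scale_left:
  assumes "p \<in> radon" "\<nu> \<in> radon"
  shows "energy \<kappa> (scale_measure (ennreal c) p) \<nu> = ennreal c * energy \<kappa> p \<nu>"
  using assms by (simp add: energy_eq_pot nn_integral_scale_measure pot_measurable' sets_radon)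

lemma energy_scale_right:
  assumes "p \<in> radon" "\<nu> \<in> radon"
  shows "energy \<kappa> \<nu> (scale_measure (ennreal c) p) = ennreal c * energy \<kappa> \<nu> p"
  using energy_scale_left[OF assms] assms by (simp add: energy_sym[of \<nu>])

text \<open>Fatou's lemma along a convergent sequence, applied to the lower semicontinuous sections
  of the kernel; sequences detect closed sets since the space is first countable.\<close>

lemma pot_lsc:
  assumes "\<mu> \<in> radon" shows "open {x. a < pot \<kappa> \<mu> x}"
proof -
  have "closed {x. pot \<kappa> \<mu> x \<le> a}"
  proof (subst closed_sequential_limits, intro allI impI, elim conjE)
    fix s :: "nat \<Rightarrow> 'a" and l assume s: "\<forall>n. s n \<in> {x. pot \<kappa> \<mu> x \<le> a}" "s \<longlonglongrightarrow> l"
    have lim: "\<kappa> l y \<le> liminf (\<lambda>n. \<kappa> (s n) y)" for y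
      unfolding le_Liminf_iff
    proof (intro allI impI)
      fix b assume b: "b < \<kappa> l y"
      have "(\<lambda>n. (s n, y)) \<longlonglongrightarrow> (l, y)" using s(2) by (intro tendsto_intros)
      moreover have "open {(x, y). b < \<kappa> x y}" using ker unfolding is_kernel_def by blast
      ultimately have "\<forall>\<^sub>F n in sequentially. (s n, y) \<in> {(x, y). b < \<kappa> x y}"
        using b by (intro topological_tendstoD) auto
      then show "\<forall>\<^sub>F n in sequentially. b < \<kappa> (s n) y" by simp
    qed
    note [measurable_cong] = sets_radon[OF assms]
    have "pot \<kappa> \<mu> l \<le> (\<integral>\<^sup>+y. liminf (\<lambda>n. \<kappa> (s n) y) \<partial>\<mu>)"
      unfolding pot_def by (intro nn_integral_mono lim)
    also have "\<dots> \<le> liminf (\<lambda>n. \<integral>\<^sup>+y. \<kappa> (s n) y \<partial>\<mu>)"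
      by (intro nn_integral_liminf) measurable
    also have "\<dots> \<le> liminf (\<lambda>n. a)"
      using s(1) by (intro Liminf_mono) (simp add: pot_def)
    also have "\<dots> = a" by (simp add: Liminf_const)
    finally show "l \<in> {x. pot \<kappa> \<mu> x \<le> a}" by simp
  qed
  moreover have "- {x. pot \<kappa> \<mu> x \<le> a} = {x. a < pot \<kappa> \<mu> x}" by auto
  ultimately show ?thesis unfolding closed_def by simp
qed

end

text \<open>With \<open>f\<close> and \<open>g\<close> the densities of \<open>p\<close> and
  \<open>q\<close> with respect to their sum, the common part \<open>m\<close> has density
  \<open>min (f x) (g x)\<close>, and the remainders live on the disjoint sets where
  \<open>g x < f x\<close> and \<open>f x < g x\<close>. The energy principle speaks of mutually
  singular pairs only; this makes it applicable to arbitrary pairs.\<close>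

lemma Jordan_decomposition_radon:
  fixes p q :: "'a::{second_countable_topology, t2_space} measure"
  assumes lc: "locally_compact_space (euclidean :: 'a topology)"
    and p: "p \<in> radon" and q: "q \<in> radon"
  obtains p' q' m where "(p', q') \<in> signed_radon" "m \<in> radon" "p = madd p' m" "q = madd q' m"
proof -
  define s where "s = madd p q"
  have s: "s \<in> radon" unfolding s_def by (rule radon_madd[OF lc p q])
  interpret s: sigma_finite_measure s by (rule radon_sigma_finite[OF lc s])
  note S = sets_radon[OF p] sets_radon[OF q] sets_radon[OF s]
  note [measurable_cong] = S(3)
  have em: "emeasure s B = emeasure p B + emeasure q B" if "B \<in> sets borel" for B
    unfolding s_def using that by (rule emeasure_madd[OF S(1,2)])
  have ac: "absolutely_continuous s p" "absolutely_continuous s q"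
    unfolding absolutely_continuous_def null_sets_def using em S by auto
  obtain f where f: "f \<in> borel_measurable s" "density s f = p"
    using s.Radon_Nikodym[OF ac(1)] S by auto
  obtain g where g: "g \<in> borel_measurable s" "density s g = q"
    using s.Radon_Nikodym[OF ac(2)] S by auto
  have [measurable]: "f \<in> borel_measurable borel" "g \<in> borel_measurable borel"
    using f(1) g(1) S(3) by (simp_all cong: measurable_cong_sets)
  \<comment> \<open>The strict comparison makes the subtracted value finite, so
    \<open>f' x + h x = f x\<close> holds in \<open>ennreal\<close> even where a density is
    infinite.\<close>
  define f' where "f' x = (if g x < f x then f x - g x else 0)" for x
  define g' where "g' x = (if f x < g x then g x - f x else 0)" for x
  define h where "h x = min (f x) (g x)" for x
  have [measurable]: "f' \<in> borel_measurable borel" "g' \<in> borel_measurable borel" "h \<in> borel_measurable borel"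
    unfolding f'_def[abs_def] g'_def[abs_def] h_def[abs_def] by measurable
  have sum: "f x = f' x + h x" "g x = g' x + h x" for x
    by (auto simp: f'_def g'_def h_def min_def diff_add_cancel_ennreal)
  have dom: "density s u \<in> radon" if u: "u \<in> borel_measurable borel" "\<And>x. u x \<le> v x" and
      v: "v \<in> borel_measurable borel" "density s v \<in> radon" for u v
  proof (rule radon_dominated[OF lc v(2), of _ 1])
    show "sets (density s u) = sets borel" using S by simp
    fix B :: "'a set" assume B: "B \<in> sets borel"
    have "emeasure (density s u) B = (\<integral>\<^sup>+x. u x * indicator B x \<partial>s)"
      using u B S by (intro emeasure_density) auto
    also have "\<dots> \<le> (\<integral>\<^sup>+x. v x * indicator B x \<partial>s)"
      using u(2) by (intro nn_integral_mono mult_right_mono) auto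
    also have "\<dots> = emeasure (density s v) B"
      using v B S by (intro emeasure_density[symmetric]) auto
    finally show "emeasure (density s u) B \<le> ennreal 1 * emeasure (density s v) B" by simp
  qed
  have r: "density s f' \<in> radon" "density s g' \<in> radon" "density s h \<in> radon"
  proof -
    have "f' x \<le> f x" "g' x \<le> g x" "h x \<le> f x" for x
      by (auto simp: f'_def g'_def h_def intro: diff_le_self_ennreal)
    then show "density s f' \<in> radon" "density s g' \<in> radon" "density s h \<in> radon"
      by (auto intro!: dom[of f' f] dom[of g' g] dom[of h f] simp: f(2) g(2) p q)
  qed
  have eq: "density s (\<lambda>x. u x + v x) = madd (density s u) (density s v)"
    if [measurable]: "u \<in> borel_measurable borel" "v \<in> borel_measurable borel" for u v
  proof (rule measure_eqI)
    fix B assume "B \<in> sets (density s (\<lambda>x. u x + v x))"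
    then have [measurable]: "B \<in> sets borel" using S by simp
    have B: "B \<in> sets s" using S by simp
    have m: "u \<in> borel_measurable s" "v \<in> borel_measurable s" "(\<lambda>x. u x + v x) \<in> borel_measurable s" by measurable
    have "emeasure (density s (\<lambda>x. u x + v x)) B = (\<integral>\<^sup>+x. u x * indicator B x + v x * indicator B x \<partial>s)"
      using B m by (simp add: emeasure_density distrib_right)
    also have "\<dots> = (\<integral>\<^sup>+x. u x * indicator B x \<partial>s) + (\<integral>\<^sup>+x. v x * indicator B x \<partial>s)"
      by (intro nn_integral_add) measurable
    also have "\<dots> = emeasure (madd (density s u) (density s v)) B"
      using B m S by (simp add: emeasure_madd emeasure_density)
    finally show "emeasure (density s (\<lambda>x. u x + v x)) B = emeasure (madd (density s u) (density s v)) B" .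
  qed (use S in simp)
  have [measurable]: "{x. g x < f x} \<in> sets borel" by measurable
  have "emeasure (density s f') (- {x. g x < f x}) = 0" "emeasure (density s g') {x. g x < f x} = 0"
  proof -
    have "emeasure (density s f') (- {x. g x < f x}) = (\<integral>\<^sup>+x. f' x * indicator (- {x. g x < f x}) x \<partial>s)"
      by (intro emeasure_density) measurable
    also have "\<dots> = (\<integral>\<^sup>+x. 0 \<partial>s)" by (intro nn_integral_cong) (auto simp: f'_def indicator_def)
    finally show "emeasure (density s f') (- {x. g x < f x}) = 0" by simp
    have "emeasure (density s g') {x. g x < f x} = (\<integral>\<^sup>+x. g' x * indicator {x. g x < f x} x \<partial>s)"
      by (intro emeasure_density) measurable
    also have "\<dots> = (\<integral>\<^sup>+x. 0 \<partial>s)" by (intro nn_integral_cong) (auto simp: g'_def indicator_def)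
    finally show "emeasure (density s g') {x. g x < f x} = 0" by simp
  qed
  then have sr: "(density s f', density s g') \<in> signed_radon"
    unfolding signed_radon_def using r by auto
  show thesis
  proof (rule that[OF sr r(3)])
    show "p = madd (density s f') (density s h)" "q = madd (density s g') (density s h)"
      using eq[of f' h] eq[of g' h] by (simp_all add: f(2) g(2) sum[symmetric])
  qed
qed

section \<open>Energies of signed measures, expressed through pairs of positive ones\<close>

lemma quadratic_nonneg_bound:
  fixes a b c :: real
  assumes a: "0 \<le> a" and b: "0 \<le> b" and q: "\<And>t. 0 \<le> a + 2 * t * c + t\<^sup>2 * b"
  shows "\<bar>c\<bar> \<le> sqrt a * sqrt b"
proof -
  have "c\<^sup>2 \<le> a * b"
  proof (cases "b = 0")
    case True
    have "c = 0"
    proof (rule ccontr)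
      assume "c \<noteq> 0"
      \<comment> \<open>For \<open>b = 0\<close> this value of \<open>t\<close> turns the expression
        in \<open>q\<close> into -1.\<close>
      then show False using q[of "- (a + 1) / (2 * c)"] True a by (simp add: field_simps)
    qed
    then show ?thesis using True by simp
  next
    case False
    then have "0 \<le> b * (a + 2 * (- c / b) * c + (- c / b)\<^sup>2 * b)" using q[of "- c / b"] b by simp
    also have "\<dots> = a * b - c\<^sup>2" using False by (simp add: field_simps power2_eq_square)
    finally show ?thesis by simp
  qed
  then have "sqrt (c\<^sup>2) \<le> sqrt (a * b)" by (rule real_sqrt_le_mono)
  then show ?thesis by (simp add: real_sqrt_mult)
qed

locale definite_kernel = lc_kernel +
  assumes energy_pr: "energy_principle \<kappa>"
begin

text \<open>\<open>enn2real\<close> sends infinity to 0, so \<open>ip\<close> is meaningful only for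
  finite mutual energy; \<open>energy_finite\<close> guarantees this on
  \<open>Eplus \<kappa>\<close>.\<close>

definition ip :: "'a measure \<Rightarrow> 'a measure \<Rightarrow> real" where
  "ip \<mu> \<nu> = enn2real (energy \<kappa> \<mu> \<nu>)"

lemma Eplus_self_finite: "\<mu> \<in> Eplus \<kappa> \<Longrightarrow> energy \<kappa> \<mu> \<mu> < \<infinity>"
  by (simp add: Eplus_def)

lemma EplusI: "\<mu> \<in> radon \<Longrightarrow> energy \<kappa> \<mu> \<mu> < \<infinity> \<Longrightarrow> \<mu> \<in> Eplus \<kappa>"
  by (simp add: Eplus_def)

lemma Eplus_radon [simp, intro]: "\<mu> \<in> Eplus \<kappa> \<Longrightarrow> \<mu> \<in> radon"
  by (simp add: Eplus_def)

lemma Eplus_sets [simp]: "\<mu> \<in> Eplus \<kappa> \<Longrightarrow> sets \<mu> = sets borel"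
  by (simp add: sets_radon)

lemma ip_nonneg [simp]: "0 \<le> ip \<mu> \<nu>" by (simp add: ip_def)

text \<open>Finite self-energies make the signed energy well defined whatever the mutual energy is.
  An infinite mutual energy would make it minus infinity, against the energy principle.\<close>

lemma singular_energy:
  assumes "(p, n) \<in> signed_radon" "p \<in> Eplus \<kappa>" "n \<in> Eplus \<kappa>"
  shows "energy \<kappa> p n < \<infinity>" "2 * ip p n \<le> ip p p + ip n n"
    "2 * ip p n = ip p p + ip n n \<Longrightarrow> p = null_measure borel \<and> n = null_measure borel"
proof -
  have f: "energy \<kappa> p p < \<infinity>" "energy \<kappa> n n < \<infinity>" using Eplus_self_finite assms(2,3) by auto
  have sy: "energy \<kappa> n p = energy \<kappa> p n" using assms by (intro energy_sym) auto
  have "energy_defined \<kappa> p n" unfolding energy_defined_def using f by simp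
  then have e: "0 \<le> signed_energy \<kappa> p n" "signed_energy \<kappa> p n = 0 \<Longrightarrow> p = null_measure borel \<and> n = null_measure borel"
    using energy_pr assms(1) unfolding energy_principle_def by auto
  obtain a where a: "energy \<kappa> p p = ennreal a" "a \<ge> 0" using f by (cases "energy \<kappa> p p") auto
  obtain b where b: "energy \<kappa> n n = ennreal b" "b \<ge> 0" using f by (cases "energy \<kappa> n n") auto
  show fin: "energy \<kappa> p n < \<infinity>"
  proof (rule ccontr)
    assume "\<not> energy \<kappa> p n < \<infinity>"
    then have "energy \<kappa> p n = \<infinity>" by (simp add: less_top[symmetric])
    then have "signed_energy \<kappa> p n = ereal (a + b) - \<infinity>"
      unfolding signed_energy_def using a b by (simp add: sy flip: ennreal_plus)
    then show False using e(1) by simp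
  qed
  then obtain c where c: "energy \<kappa> p n = ennreal c" "c \<ge> 0" by (cases "energy \<kappa> p n") auto
  have "signed_energy \<kappa> p n = ereal (a + b - 2 * c)"
    unfolding signed_energy_def using a b c by (simp add: sy flip: ennreal_plus)
  then show "2 * ip p n \<le> ip p p + ip n n"
    "2 * ip p n = ip p p + ip n n \<Longrightarrow> p = null_measure borel \<and> n = null_measure borel"
    using e a b c by (auto simp: ip_def zero_ereal_def)
qed

text \<open>Both measures are a common part \<open>m\<close> plus mutually singular parts
  \<open>p\<close> and \<open>n\<close>. In the energy of the difference all terms containing
  \<open>m\<close> cancel, so \<open>singular_energy\<close> decides; if that energy is 0, the
  singular parts vanish and only \<open>m\<close> remains on both sides.\<close>

lemma Eplus_energy:
  assumes "\<mu> \<in> Eplus \<kappa>" "\<nu> \<in> Eplus \<kappa>"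
  shows energy_finite: "energy \<kappa> \<mu> \<nu> < \<infinity>" and ip_psd: "2 * ip \<mu> \<nu> \<le> ip \<mu> \<mu> + ip \<nu> \<nu>"
    and ip_definite: "2 * ip \<mu> \<nu> = ip \<mu> \<mu> + ip \<nu> \<nu> \<Longrightarrow> \<mu> = \<nu>"
proof -
  have R: "\<mu> \<in> radon" "\<nu> \<in> radon" using assms by auto
  obtain p n m where J: "(p, n) \<in> signed_radon" "m \<in> radon" "\<mu> = madd p m" "\<nu> = madd n m"
    by (rule Jordan_decomposition_radon[OF lc R])
  have pn: "p \<in> radon" "n \<in> radon" using J(1) by (auto simp: signed_radon_def)
  have 1: "energy \<kappa> \<mu> \<mu> = energy \<kappa> p p + energy \<kappa> p m + (energy \<kappa> p m + energy \<kappa> m m)"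
    unfolding J(3) using pn J(2) by (simp add: energy_madd_left energy_madd_right energy_sym[of m p])
  have 2: "energy \<kappa> \<nu> \<nu> = energy \<kappa> n n + energy \<kappa> n m + (energy \<kappa> n m + energy \<kappa> m m)"
    unfolding J(4) using pn J(2) by (simp add: energy_madd_left energy_madd_right energy_sym[of m n])
  have 3: "energy \<kappa> \<mu> \<nu> = energy \<kappa> p n + energy \<kappa> n m + (energy \<kappa> p m + energy \<kappa> m m)"
    unfolding J(3,4) using pn J(2) by (simp add: energy_madd_left energy_madd_right energy_sym[of m n])
  have f: "energy \<kappa> p p < \<infinity>" "energy \<kappa> n n < \<infinity>" "energy \<kappa> p m < \<infinity>" "energy \<kappa> n m < \<infinity>" "energy \<kappa> m m < \<infinity>"
    using Eplus_self_finite[OF assms(1)] Eplus_self_finite[OF assms(2)] unfolding 1 2 by auto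
  have E: "p \<in> Eplus \<kappa>" "n \<in> Eplus \<kappa>" using pn f by (auto intro: EplusI)
  note S = singular_energy[OF J(1) E]
  show "energy \<kappa> \<mu> \<nu> < \<infinity>" using 3 f S(1) by simp
  have r: "ip \<mu> \<mu> = ip p p + 2 * ip p m + ip m m" "ip \<nu> \<nu> = ip n n + 2 * ip n m + ip m m"
     "ip \<mu> \<nu> = ip p n + ip n m + ip p m + ip m m"
    unfolding ip_def 1 2 3 using f S(1) by (simp_all add: enn2real_plus)
  show "2 * ip \<mu> \<nu> \<le> ip \<mu> \<mu> + ip \<nu> \<nu>" using S(2) r by simp
  assume "2 * ip \<mu> \<nu> = ip \<mu> \<mu> + ip \<nu> \<nu>"
  then have "2 * ip p n = ip p p + ip n n" using r by simp
  then show "\<mu> = \<nu>" using S(3) J(3,4) by simp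
qed

lemma energy_ip:
  assumes "\<mu> \<in> Eplus \<kappa>" "\<nu> \<in> Eplus \<kappa>"
  shows "energy \<kappa> \<mu> \<nu> = ennreal (ip \<mu> \<nu>)"
  using energy_finite[OF assms] by (simp add: ip_def)

lemma ip_sym: "\<mu> \<in> Eplus \<kappa> \<Longrightarrow> \<nu> \<in> Eplus \<kappa> \<Longrightarrow> ip \<mu> \<nu> = ip \<nu> \<mu>"
  by (simp add: ip_def energy_sym)

lemma Eplus_madd [simp, intro]:
  assumes "\<mu> \<in> Eplus \<kappa>" "\<nu> \<in> Eplus \<kappa>" shows "madd \<mu> \<nu> \<in> Eplus \<kappa>"
  using assms energy_finite[OF assms] energy_finite[OF assms(2,1)]
    Eplus_self_finite[OF assms(1)] Eplus_self_finite[OF assms(2)]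
  by (intro EplusI) (simp_all add: energy_madd_left energy_madd_right)

lemma Eplus_scale [simp, intro]:
  assumes "\<mu> \<in> Eplus \<kappa>" shows "scale_measure (ennreal c) \<mu> \<in> Eplus \<kappa>"
  using assms Eplus_self_finite[OF assms(1)]
  by (intro EplusI) (simp_all add: energy_scale_left energy_scale_right ennreal_mult_less_top)

lemma ip_madd:
  assumes "\<mu> \<in> Eplus \<kappa>" "\<nu> \<in> Eplus \<kappa>" "\<rho> \<in> Eplus \<kappa>"
  shows "ip (madd \<mu> \<nu>) \<rho> = ip \<mu> \<rho> + ip \<nu> \<rho>" "ip \<rho> (madd \<mu> \<nu>) = ip \<rho> \<mu> + ip \<rho> \<nu>"
  using assms energy_finite by (auto simp: ip_def energy_madd_left energy_madd_right enn2real_plus)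

lemma ip_scale:
  assumes "\<mu> \<in> Eplus \<kappa>" "\<rho> \<in> Eplus \<kappa>" "0 \<le> c"
  shows "ip (scale_measure (ennreal c) \<mu>) \<rho> = c * ip \<mu> \<rho>" "ip \<rho> (scale_measure (ennreal c) \<mu>) = c * ip \<rho> \<mu>"
  using assms by (auto simp: ip_def energy_scale_left energy_scale_right enn2real_mult)

lemma Eplus_null [simp, intro]: "null_measure borel \<in> Eplus \<kappa>"
proof -
  have "energy \<kappa> (null_measure borel) (null_measure borel) = 0"
    by (simp add: energy_eq_pot pot_def)
  then show ?thesis by (intro EplusI) simp_all
qed

lemma ip_null [simp]: "\<mu> \<in> Eplus \<kappa> \<Longrightarrow> ip \<mu> (null_measure borel) = 0" "\<mu> \<in> Eplus \<kappa> \<Longrightarrow> ip (null_measure borel) \<mu> = 0"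
  by (simp_all add: ip_def energy_eq_pot pot_def)

text \<open>The squared energy norm of the signed measure p - n.\<close>

definition sq :: "'a measure \<Rightarrow> 'a measure \<Rightarrow> real" where
  "sq p n = ip p p + ip n n - 2 * ip p n"

lemma sq_nonneg: "p \<in> Eplus \<kappa> \<Longrightarrow> n \<in> Eplus \<kappa> \<Longrightarrow> 0 \<le> sq p n"
  using ip_psd[of p n] by (simp add: sq_def)

lemma strong_dist_eq:
  assumes "p \<in> Eplus \<kappa>" "n \<in> Eplus \<kappa>" shows "strong_dist \<kappa> p n = sqrt (sq p n)"
proof -
  have "signed_energy \<kappa> p n = ereal (sq p n)"
    unfolding signed_energy_def sq_def using assms
    by (simp add: energy_ip ip_sym[of n p] flip: ennreal_plus)
  then show ?thesis using sq_nonneg[OF assms] by (simp add: strong_dist_def)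
qed

text \<open>Cauchy-Schwarz for p - n against p' - n', from the nonnegative energy of (p - n) + t (p'
  - n').\<close>

lemma signed_Cauchy_Schwarz:
  assumes E: "p \<in> Eplus \<kappa>" "n \<in> Eplus \<kappa>" "p' \<in> Eplus \<kappa>" "n' \<in> Eplus \<kappa>"
  shows "\<bar>ip p p' - ip p n' - ip n p' + ip n n'\<bar> \<le> sqrt (sq p n) * sqrt (sq p' n')"
proof (rule quadratic_nonneg_bound)
  fix t :: real
  show "0 \<le> sq p n + 2 * t * (ip p p' - ip p n' - ip n p' + ip n n') + t\<^sup>2 * sq p' n'"
  proof (cases "0 \<le> t")
    case True
    have "0 \<le> sq (madd p (scale_measure (ennreal t) p')) (madd n (scale_measure (ennreal t) n'))"
      using E by (intro sq_nonneg) auto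
    then show ?thesis using E True
      by (simp add: sq_def ip_madd ip_scale ip_sym[of p' p] ip_sym[of p' n] ip_sym[of n' p] ip_sym[of n' n]
          ip_sym[of n' p'] algebra_simps power2_eq_square)
  next
    case False
    \<comment> \<open>A positive measure cannot be scaled by a negative factor; interchanging
      \<open>p'\<close> and \<open>n'\<close> supplies the sign instead.\<close>
    define u where "u = - t"
    have "0 \<le> sq (madd p (scale_measure (ennreal u) n')) (madd n (scale_measure (ennreal u) p'))"
      using E by (intro sq_nonneg) auto
    then show ?thesis using E False unfolding u_def
      by (simp add: sq_def ip_madd ip_scale ip_sym[of p' p] ip_sym[of p' n] ip_sym[of n' p] ip_sym[of n' n]
          ip_sym[of n' p'] algebra_simps power2_eq_square)
  qed
qed (use E sq_nonneg in auto)

lemma sq_null [simp]: "\<mu> \<in> Eplus \<kappa> \<Longrightarrow> sq \<mu> (null_measure borel) = ip \<mu> \<mu>"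
  by (simp add: sq_def)

lemma ip_lipschitz:
  assumes "p \<in> Eplus \<kappa>" "n \<in> Eplus \<kappa>" "\<mu> \<in> Eplus \<kappa>"
  shows "\<bar>ip p \<mu> - ip n \<mu>\<bar> \<le> strong_dist \<kappa> p n * sqrt (ip \<mu> \<mu>)"
  using signed_Cauchy_Schwarz[OF assms Eplus_null] assms by (simp add: strong_dist_eq)

lemma ip_Cauchy_Schwarz:
  assumes "p \<in> Eplus \<kappa>" "\<mu> \<in> Eplus \<kappa>"
  shows "ip p \<mu> \<le> sqrt (ip p p) * sqrt (ip \<mu> \<mu>)"
  using signed_Cauchy_Schwarz[OF assms(1) Eplus_null assms(2) Eplus_null] assms by simp

sublocale M: Metric_space "Eplus \<kappa>" "strong_dist \<kappa>"
proof
  show "0 \<le> strong_dist \<kappa> p n" for p n unfolding strong_dist_def by (rule real_sqrt_ge_zero[OF abs_ge_zero])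
  show "strong_dist \<kappa> p n = strong_dist \<kappa> n p" for p n
    by (simp add: strong_dist_def signed_energy_def add.commute)
  show "strong_dist \<kappa> p n = 0 \<longleftrightarrow> p = n" if "p \<in> Eplus \<kappa>" "n \<in> Eplus \<kappa>" for p n
    using ip_definite[OF that] that by (auto simp: strong_dist_eq sq_def)
next
  fix p n r assume E: "p \<in> Eplus \<kappa>" "n \<in> Eplus \<kappa>" "r \<in> Eplus \<kappa>"
  \<comment> \<open>Expansion of the squared norm of (p - n) + (n - r).\<close>
  have "sq p r = sq p n + 2 * (ip p n - ip p r - ip n n + ip n r) + sq n r"
    using E by (simp add: sq_def ip_sym[of n p])
  also have "\<dots> \<le> sq p n + 2 * (sqrt (sq p n) * sqrt (sq n r)) + sq n r"
    using signed_Cauchy_Schwarz[OF E(1,2,2,3)] by simp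
  also have "\<dots> = (sqrt (sq p n) + sqrt (sq n r))\<^sup>2"
    using E by (simp add: power2_sum sq_nonneg)
  finally have "sqrt (sq p r) \<le> sqrt ((sqrt (sq p n) + sqrt (sq n r))\<^sup>2)" by (rule real_sqrt_le_mono)
  then show "strong_dist \<kappa> p r \<le> strong_dist \<kappa> p n + strong_dist \<kappa> n r"
    using E by (simp add: strong_dist_eq sq_nonneg)
qed

end

section \<open>Strong convergence\<close>

text \<open>Reduces the integral of a lower semicontinuous function to the measures of its open
  superlevel sets, on which vague convergence acts. Measurability in \<open>t\<close> is needed for
  Fatou's lemma. The factor \<open>indicator {0..}\<close> matters because \<open>ennreal t\<close>
  is 0 for every negative \<open>t\<close>.\<close>

lemma layer_cake:
  fixes g :: "'a::topological_space \<Rightarrow> ennreal"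
  assumes sf: "sigma_finite_measure \<mu>" and s: "sets \<mu> = sets borel" and g: "g \<in> borel_measurable borel"
  shows "(\<integral>\<^sup>+x. g x \<partial>\<mu>) = (\<integral>\<^sup>+t. emeasure \<mu> {x. ennreal t < g x} * indicator {0..} t \<partial>lborel)"
    and "(\<lambda>t. emeasure \<mu> {x. ennreal t < g x} * indicator {0..} t) \<in> borel_measurable lborel"
proof -
  interpret m: sigma_finite_measure \<mu> by (rule sf)
  interpret p: pair_sigma_finite lborel \<mu>
    by (rule pair_sigma_finite.intro[OF lborel.sigma_finite_measure_axioms sf])
  note [measurable_cong] = s
  have [measurable]: "g \<in> borel_measurable borel" by (rule g)
  have [measurable]: "(\<lambda>(t, x). indicator {p. 0 \<le> fst p \<and> ennreal (fst p) < g (snd p)} (t, x) :: ennreal)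
      \<in> borel_measurable (lborel \<Otimes>\<^sub>M \<mu>)"
    by measurable
  have sp: "space \<mu> = UNIV" using s by (metis sets_eq_imp_space_eq space_borel)
  have eq: "(\<integral>\<^sup>+x. indicator {p. 0 \<le> fst p \<and> ennreal (fst p) < g (snd p)} (t, x) \<partial>\<mu>)
     = emeasure \<mu> {x. ennreal t < g x} * indicator {0..} t" for t :: real
  proof -
    have "(\<integral>\<^sup>+x. indicator {p. 0 \<le> fst p \<and> ennreal (fst p) < g (snd p)} (t, x) \<partial>\<mu>)
       = (\<integral>\<^sup>+x. indicator {x. ennreal t < g x} x * indicator {0..} t \<partial>\<mu>)"
      by (intro nn_integral_cong) (auto simp: indicator_def)
    also have "\<dots> = (\<integral>\<^sup>+x. indicator {x. ennreal t < g x} x \<partial>\<mu>) * indicator {0..} t"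
      by (intro nn_integral_multc) measurable
    also have "\<dots> = emeasure \<mu> {x. ennreal t < g x} * indicator {0..} t" by simp
    finally show ?thesis .
  qed
  have slice: "(\<integral>\<^sup>+t. indicator {p. 0 \<le> fst p \<and> ennreal (fst p) < g (snd p)} (t, x) \<partial>lborel) = g x" for x
  proof -
    have "(\<integral>\<^sup>+t. indicator {p. 0 \<le> fst p \<and> ennreal (fst p) < g (snd p)} (t, x) \<partial>lborel)
       = (\<integral>\<^sup>+t. indicator {t. 0 \<le> t \<and> ennreal t < g x} t \<partial>lborel)"
      by (intro nn_integral_cong) (auto simp: indicator_def)
    also have "\<dots> = emeasure lborel {t. 0 \<le> t \<and> ennreal t < g x}" by (intro nn_integral_indicator) measurable
    also have "\<dots> = g x"
    proof (cases "g x")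
      case (real r)
      then have "{t. 0 \<le> t \<and> ennreal t < g x} = {0..<r}" by (auto simp: ennreal_less_iff)
      then show ?thesis using real by simp
    next
      case top
      then have "{t. 0 \<le> t \<and> ennreal t < g x} = {0..}" by auto
      moreover have "emeasure lborel {0::real..} = \<infinity>"
      proof (rule ccontr)
        assume "emeasure lborel {0::real..} \<noteq> \<infinity>"
        then obtain r where r: "emeasure lborel {0::real..} = ennreal r" "0 \<le> r"
          by (cases "emeasure lborel {0::real..}") auto
        have "emeasure lborel {0..r + 1} \<le> emeasure lborel {0::real..}" by (intro emeasure_mono) auto
        then show False using r by simp
      qed
      ultimately show ?thesis using top by simp
    qed
    finally show ?thesis .
  qed
  have "(\<integral>\<^sup>+x. g x \<partial>\<mu>) = (\<integral>\<^sup>+x. \<integral>\<^sup>+t. indicator {p. 0 \<le> fst p \<and> ennreal (fst p) < g (snd p)} (t, x) \<partial>lborel \<partial>\<mu>)"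
    by (simp only: slice)
  also have "\<dots> = (\<integral>\<^sup>+t. \<integral>\<^sup>+x. indicator {p. 0 \<le> fst p \<and> ennreal (fst p) < g (snd p)} (t, x) \<partial>\<mu> \<partial>lborel)"
    by (intro p.Fubini') measurable
  also have "\<dots> = (\<integral>\<^sup>+t. emeasure \<mu> {x. ennreal t < g x} * indicator {0..} t \<partial>lborel)" by (simp only: eq)
  finally show "(\<integral>\<^sup>+x. g x \<partial>\<mu>) = (\<integral>\<^sup>+t. emeasure \<mu> {x. ennreal t < g x} * indicator {0..} t \<partial>lborel)" .
  have "(\<lambda>t. \<integral>\<^sup>+x. indicator {p. 0 \<le> fst p \<and> ennreal (fst p) < g (snd p)} (t, x) \<partial>\<mu>) \<in> borel_measurable lborel"
    by measurable
  then show "(\<lambda>t. emeasure \<mu> {x. ennreal t < g x} * indicator {0..} t) \<in> borel_measurable lborel"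
    by (simp only: eq)
qed

locale perfect = lc_kernel +
  assumes perf: "perfect_kernel \<kappa>" and dom: "domination_principle \<kappa>"
begin

sublocale definite_kernel
  using perf by unfold_locales (simp add: perfect_kernel_def)

text \<open>Sequences suffice because the strong topology is metric; the memberships are included
  because \<open>strong_dist\<close> is a metric only on \<open>Eplus \<kappa>\<close>.\<close>

definition sconv :: "(nat \<Rightarrow> 'a measure) \<Rightarrow> 'a measure \<Rightarrow> bool" where
  "sconv s \<mu> \<longleftrightarrow> (\<forall>n. s n \<in> Eplus \<kappa>) \<and> \<mu> \<in> Eplus \<kappa> \<and> (\<lambda>n. strong_dist \<kappa> (s n) \<mu>) \<longlonglongrightarrow> 0"

lemma sconvD: "sconv s \<mu> \<Longrightarrow> s n \<in> Eplus \<kappa>" "sconv s \<mu> \<Longrightarrow> \<mu> \<in> Eplus \<kappa>"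
  by (auto simp: sconv_def)

lemma sconv_limitin:
  assumes "\<And>n. s n \<in> Eplus \<kappa>"
  shows "sconv s \<mu> \<longleftrightarrow> limitin (strong_topology \<kappa>) s \<mu> sequentially"
  using assms by (simp add: sconv_def strong_topology_def M.limitin_metric_dist_null)

lemma strongly_complete:
  assumes s: "\<And>n. s n \<in> Eplus \<kappa>"
    and c: "\<And>e. 0 < e \<Longrightarrow> \<exists>N. \<forall>n\<ge>N. \<forall>m\<ge>n. strong_dist \<kappa> (s n) (s m) < e"
  obtains \<mu> where "sconv s \<mu>"
proof -
  have "M.MCauchy s"
    unfolding M.MCauchy_def
  proof (intro conjI allI impI)
    show "range s \<subseteq> Eplus \<kappa>" using s by auto
    fix e :: real assume "0 < e"
    from c[OF this] obtain N where N: "\<And>n m. N \<le> n \<Longrightarrow> n \<le> m \<Longrightarrow> strong_dist \<kappa> (s n) (s m) < e" by blast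
    show "\<exists>N. \<forall>n n'. N \<le> n \<longrightarrow> N \<le> n' \<longrightarrow> strong_dist \<kappa> (s n) (s n') < e"
    proof (intro exI[of _ N] allI impI)
      fix n n' assume "N \<le> n" "N \<le> n'"
      then show "strong_dist \<kappa> (s n) (s n') < e"
        using N[of n n'] N[of n' n] M.commute[of "s n" "s n'"] by (cases "n \<le> n'") auto
    qed
  qed
  moreover have "M.mcomplete" using perf by (simp add: perfect_kernel_def)
  ultimately obtain \<mu> where "limitin M.mtopology s \<mu> sequentially"
    unfolding M.mcomplete_def by blast
  then have "sconv s \<mu>" using s by (simp add: sconv_limitin strong_topology_def)
  then show thesis by (rule that)
qed

text \<open>The set of measures whose integral of \<open>f\<close> lies in \<open>V\<close> is a
  generator of the vague topology, so by perfectness its trace on \<open>Eplus \<kappa>\<close> is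
  strongly open.\<close>

lemma sconv_vague:
  fixes f :: "'a \<Rightarrow> real"
  assumes sc: "sconv s \<mu>" and f: "continuous_on UNIV f" "compact (closure {x. f x \<noteq> 0})"
  shows "(\<lambda>n. \<integral>x. f x \<partial>s n) \<longlonglongrightarrow> (\<integral>x. f x \<partial>\<mu>)"
proof (rule topological_tendstoI)
  fix V :: "real set" assume V: "open V" "(\<integral>x. f x \<partial>\<mu>) \<in> V"
  let ?W = "{\<mu> \<in> radon. (\<integral>x. f x \<partial>\<mu>) \<in> V}"
  have "openin vague_topology ?W"
    unfolding vague_topology_def openin_topology_generated_by_iff
    using f V(1) by (intro generate_topology_on.Basis) blast
  then have "openin (subtopology vague_topology (Eplus \<kappa>)) (?W \<inter> Eplus \<kappa>)"
    by (rule openin_subtopology_Int)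
  then have o: "openin (strong_topology \<kappa>) (?W \<inter> Eplus \<kappa>)"
    using perf unfolding perfect_kernel_def by blast
  have "limitin (strong_topology \<kappa>) s \<mu> sequentially" using sc sconv_limitin sconvD(1)[OF sc] by blast
  moreover have "\<mu> \<in> ?W \<inter> Eplus \<kappa>" using sconvD(2)[OF sc] V by auto
  ultimately have "\<forall>\<^sub>F n in sequentially. s n \<in> ?W \<inter> Eplus \<kappa>"
    using o unfolding limitin_def by blast
  then show "\<forall>\<^sub>F n in sequentially. (\<integral>x. f x \<partial>s n) \<in> V" by eventually_elim simp
qed

lemma sconv_ip:
  assumes sc: "sconv s \<mu>" and t: "\<theta> \<in> Eplus \<kappa>"
  shows "(\<lambda>n. ip (s n) \<theta>) \<longlonglongrightarrow> ip \<mu> \<theta>"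
proof -
  have "(\<lambda>n. strong_dist \<kappa> (s n) \<mu> * sqrt (ip \<theta> \<theta>)) \<longlonglongrightarrow> 0 * sqrt (ip \<theta> \<theta>)"
    using sc unfolding sconv_def by (intro tendsto_intros) auto
  then have 0: "(\<lambda>n. strong_dist \<kappa> (s n) \<mu> * sqrt (ip \<theta> \<theta>)) \<longlonglongrightarrow> 0" by simp
  have "(\<lambda>n. ip (s n) \<theta> - ip \<mu> \<theta>) \<longlonglongrightarrow> 0"
    by (rule tendsto_rabs_zero_cancel, rule tendsto_sandwich[OF _ _ tendsto_const 0])
      (use ip_lipschitz[OF sconvD(1)[OF sc] sconvD(2)[OF sc] t] in auto)
  then show ?thesis by (rule LIM_zero_cancel)
qed

lemma sconv_ip_self:
  assumes sc: "sconv s \<mu>"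
  shows "(\<lambda>n. ip (s n) (s n)) \<longlonglongrightarrow> ip \<mu> \<mu>"
proof -
  note E = sconvD[OF sc]
  \<comment> \<open>The energy of \<open>s n\<close> is recovered from its squared distance to
    \<open>\<mu>\<close> and the mixed term, both of which converge.\<close>
  have "(\<lambda>n. (strong_dist \<kappa> (s n) \<mu>)\<^sup>2 - ip \<mu> \<mu> + 2 * ip (s n) \<mu>) \<longlonglongrightarrow> 0\<^sup>2 - ip \<mu> \<mu> + 2 * ip \<mu> \<mu>"
    using sc sconv_ip[OF sc E(2)] unfolding sconv_def by (intro tendsto_intros) auto
  moreover have "(strong_dist \<kappa> (s n) \<mu>)\<^sup>2 - ip \<mu> \<mu> + 2 * ip (s n) \<mu> = ip (s n) (s n)" for n
    using E by (simp add: strong_dist_eq sq_nonneg) (simp add: sq_def)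
  ultimately show ?thesis by simp
qed

lemma Eclosed_on_iff:
  "\<mu> \<in> Eclosed_on \<kappa> Q \<longleftrightarrow> (\<exists>s. (\<forall>n. s n \<in> Eplus_on \<kappa> Q) \<and> sconv s \<mu>)" (is "?L \<longleftrightarrow> ?R")
proof
  have sub: "Eplus_on \<kappa> Q \<subseteq> Eplus \<kappa>" by (auto simp: Eplus_on_def)
  assume ?L
  then obtain s where s: "range s \<subseteq> Eplus_on \<kappa> Q" "limitin (strong_topology \<kappa>) s \<mu> sequentially"
    unfolding Eclosed_on_def strong_topology_def M.closure_of_sequentially by blast
  then have "sconv s \<mu>" using sub by (subst sconv_limitin) auto
  then show ?R using s(1) by blast
next
  have sub: "Eplus_on \<kappa> Q \<subseteq> Eplus \<kappa>" by (auto simp: Eplus_on_def)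
  assume ?R
  then obtain s where s: "\<And>n. s n \<in> Eplus_on \<kappa> Q" "sconv s \<mu>" by blast
  then have "limitin (strong_topology \<kappa>) s \<mu> sequentially"
    using sconv_limitin sconvD by blast
  then show ?L
    unfolding Eclosed_on_def strong_topology_def M.closure_of_sequentially
    using s sub sconvD(2)[OF s(2)] by (auto simp: image_subset_iff)
qed

definition mid :: "'a measure \<Rightarrow> 'a measure \<Rightarrow> 'a measure" where
  "mid \<mu> \<nu> = scale_measure (ennreal (1/2)) (madd \<mu> \<nu>)"

lemma ip_mid:
  assumes "\<mu> \<in> Eplus \<kappa>" "\<nu> \<in> Eplus \<kappa>"
  shows "mid \<mu> \<nu> \<in> Eplus \<kappa>" "ip (mid \<mu> \<nu>) (mid \<mu> \<nu>) = (ip \<mu> \<mu> + ip \<nu> \<nu>) / 2 - sq \<mu> \<nu> / 4"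
  unfolding mid_def sq_def
proof -
  have E: "madd \<mu> \<nu> \<in> Eplus \<kappa>" using assms by simp
  show "scale_measure (ennreal (1/2)) (madd \<mu> \<nu>) \<in> Eplus \<kappa>" using E by (rule Eplus_scale)
  show "ip (scale_measure (ennreal (1/2)) (madd \<mu> \<nu>)) (scale_measure (ennreal (1/2)) (madd \<mu> \<nu>)) =
    (ip \<mu> \<mu> + ip \<nu> \<nu>) / 2 - (ip \<mu> \<mu> + ip \<nu> \<nu> - 2 * ip \<mu> \<nu>) / 4"
  proof -
    have h: "0 \<le> (1/2 :: real)" by simp
    show ?thesis
      unfolding ip_scale(1)[OF E Eplus_scale[OF E] h] ip_scale(2)[OF E E h]
      using assms E by (simp add: ip_madd ip_sym[of \<nu> \<mu>] field_simps)
  qed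
qed

text \<open>The parallelogram law makes almost minimizing sequences Cauchy.\<close>

lemma nested_minimizers:
  fixes S :: "nat \<Rightarrow> 'a measure set" and J L :: "'a measure \<Rightarrow> real"
  assumes J: "\<And>\<mu>. J \<mu> = ip \<mu> \<mu> - 2 * L \<mu>" and sub: "\<And>n. S n \<subseteq> Eplus \<kappa>" and anti: "decseq S"
    and mid: "\<And>n \<mu> \<nu>. \<mu> \<in> S n \<Longrightarrow> \<nu> \<in> S n \<Longrightarrow> mid \<mu> \<nu> \<in> S n"
    and Lmid: "\<And>\<mu> \<nu>. \<mu> \<in> S 0 \<Longrightarrow> \<nu> \<in> S 0 \<Longrightarrow> L (mid \<mu> \<nu>) = (L \<mu> + L \<nu>) / 2"
    and lower: "\<And>\<mu>. \<mu> \<in> S 0 \<Longrightarrow> a \<le> J \<mu>" and upper: "\<And>n. \<exists>\<mu>\<in>S n. J \<mu> \<le> b"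
  obtains s \<mu> where "sconv s \<mu>" "\<And>n. s n \<in> S n" "\<And>n \<nu>. \<nu> \<in> S n \<Longrightarrow> J (s n) \<le> J \<nu> + 1 / real (Suc n)"
proof -
  define w where "w n = Inf (J ` S n)" for n
  have S0: "S n \<subseteq> S m" if "m \<le> n" for n m using anti that by (auto simp: decseq_def)
  have bdd: "bdd_below (J ` S n)" for n
    using lower S0[of 0 n] by (intro bdd_belowI[of _ a]) auto
  have ne: "J ` S n \<noteq> {}" for n using upper[of n] by auto
  have w_le: "w n \<le> J \<mu>" if "\<mu> \<in> S n" for n \<mu>
    unfolding w_def using that bdd by (intro cInf_lower) auto
  have wb: "w n \<le> b" for n using upper[of n] w_le order_trans by blast
  have winc: "w m \<le> w n" if "m \<le> n" for m n
    unfolding w_def using S0[OF that] by (intro cInf_superset_mono ne bdd image_mono)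
  have "\<exists>\<mu>\<in>S n. J \<mu> < w n + 1 / real (Suc n)" for n
  proof -
    have "\<exists>y\<in>J ` S n. y < w n + 1 / real (Suc n)"
      unfolding w_def by (subst cInf_less_iff[symmetric, OF ne bdd]) simp
    then show ?thesis by blast
  qed
  then obtain s where s: "\<And>n. s n \<in> S n" "\<And>n. J (s n) < w n + 1 / real (Suc n)" by metis
  have sE: "s n \<in> Eplus \<kappa>" for n using s(1) sub by blast
  \<comment> \<open>Since \<open>s m\<close> also lies in the larger set \<open>S n\<close>, the
    midpoint competes there; comparing its value with the infimum \<open>w n\<close> bounds the
    distance.\<close>
  have sqb: "sq (s n) (s m) \<le> 4 / real (Suc n) + 2 * (w m - w n)" if "n \<le> m" for n m
  proof -
    have sm: "s m \<in> S n" using s(1)[of m] S0[OF that] by blast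
    have "w n \<le> J (mid (s n) (s m))" by (intro w_le mid s sm)
    also have "\<dots> = (J (s n) + J (s m)) / 2 - sq (s n) (s m) / 4"
    proof -
      have "s n \<in> S 0" "s m \<in> S 0" using s(1) S0[of 0] by blast+
      then show ?thesis
        unfolding J ip_mid(2)[OF sE sE, of n m] by (simp add: Lmid field_simps)
    qed
    finally have 1: "sq (s n) (s m) \<le> 2 * J (s n) + 2 * J (s m) - 4 * w n" by argo
    define p q where "p = 1 / real (Suc n)" and "q = 1 / real (Suc m)"
    have "q \<le> p" unfolding p_def q_def using that by (intro divide_left_mono) auto
    moreover have "J (s n) < w n + p" "J (s m) < w m + q" unfolding p_def q_def by (rule s(2))+
    ultimately have "sq (s n) (s m) \<le> 4 * p + 2 * (w m - w n)" using 1 by argo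
    then show ?thesis by (simp add: p_def)
  qed
  \<comment> \<open>The infima increase as the sets shrink and are bounded by \<open>b\<close>, so
    the gaps \<open>w m - w n\<close> become small and \<open>s\<close> is Cauchy.\<close>
  have "incseq w" using winc by (simp add: incseq_def)
  then obtain wl where wl: "w \<longlonglongrightarrow> wl" "\<And>n. w n \<le> wl" using incseq_convergent[of w b] wb by metis
  have lim: "(\<lambda>n. 4 / real (Suc n) + 2 * (wl - w n)) \<longlonglongrightarrow> 0"
  proof -
    have "(\<lambda>n. 4 * inverse (real (Suc n)) + 2 * (wl - w n)) \<longlonglongrightarrow> 4 * 0 + 2 * (wl - wl)"
      by (intro tendsto_intros wl LIMSEQ_inverse_real_of_nat)
    then show ?thesis by (simp add: field_simps)
  qed
  obtain \<mu> where "sconv s \<mu>"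
  proof (rule strongly_complete[OF sE])
    fix e :: real assume e: "0 < e"
    then have "\<forall>\<^sub>F n in sequentially. 4 / real (Suc n) + 2 * (wl - w n) < e\<^sup>2"
      using lim by (intro order_tendstoD) auto
    then obtain N where N: "\<And>n. N \<le> n \<Longrightarrow> 4 / real (Suc n) + 2 * (wl - w n) < e\<^sup>2"
      by (auto simp: eventually_sequentially)
    show "\<exists>N. \<forall>n\<ge>N. \<forall>m\<ge>n. strong_dist \<kappa> (s n) (s m) < e"
    proof (intro exI[of _ N] allI impI)
      fix n m assume nm: "N \<le> n" "n \<le> m"
      have "sq (s n) (s m) < e\<^sup>2" using sqb[OF nm(2)] N[OF nm(1)] wl(2)[of m] by argo
      then have "sqrt (sq (s n) (s m)) < sqrt (e\<^sup>2)" by (rule real_sqrt_less_mono)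
      then show "strong_dist \<kappa> (s n) (s m) < e" using e sE by (simp add: strong_dist_eq)
    qed
  qed
  then show thesis
  proof (rule that[OF _ s(1)])
    show "J (s n) \<le> J \<nu> + 1 / real (Suc n)" if "\<nu> \<in> S n" for n \<nu>
      using s(2)[of n] w_le[OF that] by linarith
  qed
qed

text \<open>A bump function between \<open>C\<close> and \<open>U\<close> has integral 0 against the
  late \<open>s n\<close>, hence against the limit, and it dominates the indicator of
  \<open>C\<close>. Asking for nullity only eventually allows for measures concentrated on shrinking
  sets.\<close>

lemma sconv_compact_null:
  assumes sc: "sconv s \<mu>" and C: "compact C" "open U" "C \<subseteq> U"
    and ev: "\<forall>\<^sub>F n in sequentially. emeasure (s n) U = 0"
  shows "emeasure \<mu> C = 0"
proof -
  obtain f where f: "continuous_on UNIV f" "compact (closure {x. f x \<noteq> 0})"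
    "\<And>x. 0 \<le> f x" "\<And>x. f x \<le> 1" "\<And>x. x \<in> C \<Longrightarrow> f x = (1::real)" "\<And>x. x \<notin> U \<Longrightarrow> f x = 0"
    by (rule compact_bump[OF lc C]) (rule that)
  have \<mu>: "\<mu> \<in> radon" and sr: "s n \<in> radon" for n using sconvD[OF sc] by auto
  note S = sets_radon[OF \<mu>] sets_radon[OF sr]
  have "\<forall>\<^sub>F n in sequentially. (\<integral>x. f x \<partial>s n) = 0"
    using ev
  proof eventually_elim
    case (elim n)
    have "AE x in s n. x \<notin> U" by (rule AE_I[of _ _ U]) (use elim C(2) S in auto)
    then have "AE x in s n. f x = 0" by eventually_elim (rule f(6))
    then show ?case by (rule integral_eq_zero_AE)
  qed
  then have "(\<lambda>n. \<integral>x. f x \<partial>s n) \<longlonglongrightarrow> 0" by (rule tendsto_eventually)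
  then have 0: "(\<integral>x. f x \<partial>\<mu>) = 0" using sconv_vague[OF sc f(1,2)] LIMSEQ_unique by blast
  have "emeasure \<mu> C = (\<integral>\<^sup>+x. indicator C x \<partial>\<mu>)" using compact_borel[OF C(1)] S by simp
  also have "\<dots> \<le> (\<integral>\<^sup>+x. ennreal (f x) \<partial>\<mu>)"
    using f(3,5) by (intro nn_integral_mono) (auto simp: indicator_def)
  also have "\<dots> = ennreal (\<integral>x. f x \<partial>\<mu>)"
    using integrable_compact_support[OF \<mu> f(1,2)] f(3) by (intro nn_integral_eq_integral) auto
  finally show ?thesis using 0 by simp
qed

lemma sconv_open_null:
  assumes sc: "sconv s \<mu>" and U: "open U" and ev: "\<And>n. emeasure (s n) U = 0"
  shows "emeasure \<mu> U = 0"
proof (rule ccontr)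
  assume "emeasure \<mu> U \<noteq> 0"
  then obtain C where "compact C" "C \<subseteq> U" "emeasure \<mu> C > 0"
    using radon_pos_compact[of \<mu> U 0] sconvD(2)[OF sc] U by (metis Eplus_radon borel_open not_gr_zero)
  then show False using sconv_compact_null[OF sc _ U, of C] ev by simp
qed

text \<open>The open-set half of the portmanteau theorem: a bump function is squeezed between a
  compact \<open>C\<close> and \<open>U\<close>, and inner regularity lets \<open>C\<close> exhaust
  \<open>U\<close>.\<close>

lemma sconv_open_liminf:
  assumes sc: "sconv s \<mu>" and U: "open U"
  shows "emeasure \<mu> U \<le> liminf (\<lambda>n. emeasure (s n) U)"
proof -
  have \<mu>: "\<mu> \<in> radon" and sr: "s n \<in> radon" for n using sconvD[OF sc] by auto
  note S = sets_radon[OF \<mu>] sets_radon[OF sr]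
  have "emeasure \<mu> C \<le> liminf (\<lambda>n. emeasure (s n) U)" if C: "compact C" "C \<subseteq> U" for C
  proof -
    obtain f where f: "continuous_on UNIV f" "compact (closure {x. f x \<noteq> 0})"
      "\<And>x. 0 \<le> f x" "\<And>x. f x \<le> 1" "\<And>x. x \<in> C \<Longrightarrow> f x = (1::real)" "\<And>x. x \<notin> U \<Longrightarrow> f x = 0"
      by (rule compact_bump[OF lc C(1) U C(2)]) (rule that)
    have eq: "(\<integral>\<^sup>+x. ennreal (f x) \<partial>\<nu>) = ennreal (\<integral>x. f x \<partial>\<nu>)" if "\<nu> \<in> radon" for \<nu>
      using integrable_compact_support[OF that f(1,2)] f(3) by (intro nn_integral_eq_integral) auto
    have "emeasure \<mu> C = (\<integral>\<^sup>+x. indicator C x \<partial>\<mu>)" using compact_borel[OF C(1)] S by simp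
    also have "\<dots> \<le> (\<integral>\<^sup>+x. ennreal (f x) \<partial>\<mu>)"
      using f(3,5) by (intro nn_integral_mono) (auto simp: indicator_def)
    also have "\<dots> = ennreal (\<integral>x. f x \<partial>\<mu>)" by (rule eq[OF \<mu>])
    also have "\<dots> = liminf (\<lambda>n. ennreal (\<integral>x. f x \<partial>s n))"
      by (intro lim_imp_Liminf[symmetric] tendsto_ennrealI sconv_vague[OF sc f(1,2)]) simp
    also have "\<dots> = liminf (\<lambda>n. \<integral>\<^sup>+x. ennreal (f x) \<partial>s n)" by (simp add: eq[OF sr])
    also have "\<dots> \<le> liminf (\<lambda>n. emeasure (s n) U)"
    proof (intro Liminf_mono always_eventually allI)
      fix n
      have "(\<integral>\<^sup>+x. ennreal (f x) \<partial>s n) \<le> (\<integral>\<^sup>+x. indicator U x \<partial>s n)"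
        using f(4,6) by (intro nn_integral_mono) (auto simp: indicator_def)
      also have "\<dots> = emeasure (s n) U" using U S by simp
      finally show "(\<integral>\<^sup>+x. ennreal (f x) \<partial>s n) \<le> emeasure (s n) U" .
    qed
    finally show ?thesis .
  qed
  then have "(SUP K\<in>{K. compact K \<and> K \<subseteq> U}. emeasure \<mu> K) \<le> liminf (\<lambda>n. emeasure (s n) U)"
    by (intro SUP_least) simp
  then show ?thesis using radon_SUP[OF \<mu>, of U] U by simp
qed

text \<open>At each level this is \<open>sconv_open_liminf\<close>, and Fatou's lemma integrates
  over the levels. It replaces strong continuity when \<open>g\<close> is the potential of a measure
  of infinite energy.\<close>

lemma sconv_lsc_liminf:
  assumes sc: "sconv s \<mu>" and g: "\<And>a. open {x. a < g x}"
  shows "(\<integral>\<^sup>+x. g x \<partial>\<mu>) \<le> liminf (\<lambda>n. \<integral>\<^sup>+x. g x \<partial>s n)"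
proof -
  have gm: "g \<in> borel_measurable borel" using g by (intro borel_measurableI_greater) simp
  have \<mu>: "\<mu> \<in> radon" and sr: "s n \<in> radon" for n using sconvD[OF sc] by auto
  note LC = layer_cake[OF radon_sigma_finite[OF lc] sets_radon gm]
  have "(\<integral>\<^sup>+x. g x \<partial>\<mu>) = (\<integral>\<^sup>+t. emeasure \<mu> {x. ennreal t < g x} * indicator {0..} t \<partial>lborel)"
    by (rule LC(1)[OF \<mu> \<mu>])
  also have "\<dots> \<le> (\<integral>\<^sup>+t. liminf (\<lambda>n. emeasure (s n) {x. ennreal t < g x} * indicator {0..} t) \<partial>lborel)"
  proof (rule nn_integral_mono)
    fix t :: real
    show "emeasure \<mu> {x. ennreal t < g x} * indicator {0..} t
      \<le> liminf (\<lambda>n. emeasure (s n) {x. ennreal t < g x} * indicator {0..} t)"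
      using sconv_open_liminf[OF sc g[of "ennreal t"]] by (cases "0 \<le> t") auto
  qed
  also have "\<dots> \<le> liminf (\<lambda>n. \<integral>\<^sup>+t. emeasure (s n) {x. ennreal t < g x} * indicator {0..} t \<partial>lborel)"
    by (intro nn_integral_liminf LC(2)[OF sr sr])
  also have "\<dots> = liminf (\<lambda>n. \<integral>\<^sup>+x. g x \<partial>s n)" by (simp only: LC(1)[OF sr sr])
  finally show ?thesis .
qed

end

section \<open>Projections onto compact sets\<close>

abbreviation restr :: "'a set \<Rightarrow> 'a measure \<Rightarrow> 'a measure" where
  "restr B \<mu> \<equiv> density \<mu> (indicator B)"

lemma nn_integral_restr:
  assumes "sets \<mu> = sets borel" "B \<in> sets borel" "f \<in> borel_measurable borel"
  shows "(\<integral>\<^sup>+x. f x \<partial>restr B \<mu>) = (\<integral>\<^sup>+x. indicator B x * f x \<partial>\<mu>)"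
  using assms by (intro nn_integral_density) (simp_all cong: measurable_cong_sets)

lemma emeasure_restr:
  assumes "sets \<mu> = sets borel" "B \<in> sets borel" "C \<in> sets borel"
  shows "emeasure (restr B \<mu>) C = emeasure \<mu> (B \<inter> C)"
proof -
  have "emeasure (restr B \<mu>) C = (\<integral>\<^sup>+x. indicator B x * indicator C x \<partial>\<mu>)"
    using assms by (intro emeasure_density) auto
  also have "\<dots> = (\<integral>\<^sup>+x. indicator (B \<inter> C) x \<partial>\<mu>)"
    by (intro nn_integral_cong) (auto simp: indicator_def)
  also have "\<dots> = emeasure \<mu> (B \<inter> C)" using assms by (intro nn_integral_indicator) auto
  finally show ?thesis .
qed

lemma AE_restr:
  assumes "sets \<mu> = sets borel" "B \<in> sets borel"
  shows "(AE x in restr B \<mu>. P x) \<longleftrightarrow> (AE x in \<mu>. x \<in> B \<longrightarrow> P x)"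
  using assms by (subst AE_density) (auto simp: indicator_def cong: AE_cong)

text \<open>On \<open>B\<close> one has \<open>f x < g x\<close> at every point, so the reversed
  inequality of the integrals over \<open>B\<close> forces \<open>B\<close> to be null. Finiteness
  excludes the case of two infinite integrals.\<close>

lemma AE_le_of_restr:
  assumes s: "sets \<mu> = sets borel" and f: "f \<in> borel_measurable borel" and g: "g \<in> borel_measurable borel"
    and B: "B = {x. f x < g x}"
    and le: "(\<integral>\<^sup>+x. g x \<partial>restr B \<mu>) \<le> (\<integral>\<^sup>+x. f x \<partial>restr B \<mu>)"
    and fin: "(\<integral>\<^sup>+x. g x \<partial>restr B \<mu>) < \<infinity>"
  shows "AE x in \<mu>. g x \<le> (f x :: ennreal)"
proof (rule ccontr)
  assume n: "\<not> (AE x in \<mu>. g x \<le> f x)"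
  have [measurable]: "f \<in> borel_measurable borel" "g \<in> borel_measurable borel" by fact+
  have Bm: "B \<in> sets borel" unfolding B by measurable
  have le1: "AE x in restr B \<mu>. f x \<le> g x"
    unfolding AE_restr[OF s Bm] by (auto simp: B)
  have n1: "\<not> (AE x in restr B \<mu>. g x \<le> f x)"
  proof
    assume "AE x in restr B \<mu>. g x \<le> f x"
    then have "AE x in \<mu>. g x \<le> f x"
      unfolding AE_restr[OF s Bm] by eventually_elim (auto simp: B not_le)
    then show False using n by simp
  qed
  have "(\<integral>\<^sup>+x. f x \<partial>restr B \<mu>) \<le> (\<integral>\<^sup>+x. g x \<partial>restr B \<mu>)"
    by (rule nn_integral_mono_AE[OF le1])
  then have "(\<integral>\<^sup>+x. f x \<partial>restr B \<mu>) \<noteq> \<infinity>" using fin by auto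
  then have "(\<integral>\<^sup>+x. f x \<partial>restr B \<mu>) < (\<integral>\<^sup>+x. g x \<partial>restr B \<mu>)"
    using le1 n1 s by (intro nn_integral_less) (simp_all cong: measurable_cong_sets add: f g)
  then show False using le by simp
qed

lemma AE_eq_of_nn_integral:
  assumes s: "sets \<mu> = sets borel" and f: "f \<in> borel_measurable borel" and g: "g \<in> borel_measurable borel"
    and le: "AE x in \<mu>. f x \<le> (g x :: ennreal)"
    and i: "(\<integral>\<^sup>+x. g x \<partial>\<mu>) \<le> (\<integral>\<^sup>+x. f x \<partial>\<mu>)" and fin: "(\<integral>\<^sup>+x. g x \<partial>\<mu>) < \<infinity>"
  shows "AE x in \<mu>. f x = g x"
proof -
  have "AE x in \<mu>. g x \<le> f x"
  proof (rule ccontr)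
    assume "\<not> (AE x in \<mu>. g x \<le> f x)"
    moreover have "(\<integral>\<^sup>+x. f x \<partial>\<mu>) \<noteq> \<infinity>" using nn_integral_mono_AE[OF le] fin by auto
    ultimately have "(\<integral>\<^sup>+x. f x \<partial>\<mu>) < (\<integral>\<^sup>+x. g x \<partial>\<mu>)"
      using le s f g by (intro nn_integral_less) (simp_all cong: measurable_cong_sets)
    then show False using i by simp
  qed
  with le show ?thesis by eventually_elim simp
qed

text \<open>The complement of the support is a union of open null sets, and by the Lindelof property
  countably many of them suffice.\<close>

lemma emeasure_Compl_meas_supp:
  fixes \<mu> :: "'a::{second_countable_topology, t2_space} measure"
  assumes s: "sets \<mu> = sets borel" and m: "meas_supp \<mu> \<subseteq> K"
  shows "emeasure \<mu> (- K) = 0"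
proof -
  define \<U> where "\<U> = {V. open V \<and> emeasure \<mu> V = 0}"
  obtain \<V> where V: "\<V> \<subseteq> \<U>" "countable \<V>" "\<Union>\<V> = \<Union>\<U>"
    by (rule Lindelof[of \<U>]) (auto simp: \<U>_def)
  have eq: "\<Union>\<U> = - meas_supp \<mu>"
    by (auto simp: \<U>_def meas_supp_def not_less)
  have "(\<Union>V\<in>\<V>. V) \<in> null_sets \<mu>"
    using V s by (intro null_sets_UN') (auto simp: \<U>_def null_sets_def)
  then have "- meas_supp \<mu> \<in> null_sets \<mu>" using V(3) eq by auto
  then have "emeasure \<mu> (- meas_supp \<mu>) = 0" "- meas_supp \<mu> \<in> sets \<mu>" by auto
  moreover have "- K \<subseteq> - meas_supp \<mu>" using m by auto
  ultimately show ?thesis using emeasure_mono[of "- K" "- meas_supp \<mu>" \<mu>] by simp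
qed

text \<open>The first-variation step: dividing by \<open>t\<close> and letting it tend to 0 leaves
  \<open>a\<close>. Only \<open>t \<le> 1\<close> is tested because one of the variations scales a
  measure by \<open>1 - t\<close>.\<close>

lemma small_step_nonneg:
  fixes a b :: real
  assumes "\<And>t. 0 < t \<Longrightarrow> t \<le> 1 \<Longrightarrow> 0 \<le> t * (a + t * b)"
  shows "0 \<le> a"
proof (rule ccontr)
  assume a: "\<not> 0 \<le> a"
  \<comment> \<open>Small enough that \<open>t * b\<close> is at most \<open>- a / 2\<close>, which
    keeps \<open>a + t * b\<close> negative.\<close>
  define t where "t = min 1 (- a / (2 * (\<bar>b\<bar> + 1)))"
  have t: "0 < t" "t \<le> 1" "t \<le> - a / (2 * (\<bar>b\<bar> + 1))" using a by (auto simp: t_def field_simps)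
  have "t * b \<le> t * (\<bar>b\<bar> + 1)" using t(1) by (intro mult_left_mono) auto
  also have "\<dots> \<le> - a / 2" using t(3) by (simp add: field_simps)
  finally have "a + t * b < 0" using a by simp
  then show False using assms[OF t(1,2)] t(1) by (simp add: zero_le_mult_iff)
qed

context perfect begin

section \<open>Measures concentrated on a set, and sets of capacity zero\<close>

lemma Eplus_on_iff: "\<mu> \<in> Eplus_on \<kappa> Q \<longleftrightarrow> \<mu> \<in> Eplus \<kappa> \<and> (AE x in \<mu>. x \<in> Q)"
  by (simp add: Eplus_on_def concentrated_on_iff_AE[OF lc])

lemma Eplus_onD: "\<mu> \<in> Eplus_on \<kappa> Q \<Longrightarrow> \<mu> \<in> Eplus \<kappa>"
  by (simp add: Eplus_on_iff)

lemma Eplus_on_mono: "\<mu> \<in> Eplus_on \<kappa> Q \<Longrightarrow> Q \<subseteq> Q' \<Longrightarrow> \<mu> \<in> Eplus_on \<kappa> Q'"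
  by (auto simp: Eplus_on_iff elim: AE_mp)

lemma Eplus_on_borel:
  assumes "K \<in> sets borel"
  shows "\<mu> \<in> Eplus_on \<kappa> K \<longleftrightarrow> \<mu> \<in> Eplus \<kappa> \<and> emeasure \<mu> (- K) = 0"
proof -
  have "(AE x in \<mu>. x \<in> K) \<longleftrightarrow> emeasure \<mu> (- K) = 0" if "\<mu> \<in> Eplus \<kappa>"
  proof -
    have "space \<mu> - K = - K" using space_radon[of \<mu>] that by auto
    then show ?thesis
      using AE_iff_measurable[of "- K" \<mu> "\<lambda>x. x \<in> K"] assms that space_radon[of \<mu>] by auto
  qed
  then show ?thesis by (auto simp: Eplus_on_iff)
qed

lemma restr_Eplus_on:
  assumes \<mu>: "\<mu> \<in> Eplus \<kappa>" and B: "B \<in> sets borel"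
  shows "restr B \<mu> \<in> Eplus_on \<kappa> B" "energy \<kappa> (restr B \<mu>) (restr B \<mu>) \<le> energy \<kappa> \<mu> \<mu>"
proof -
  have s: "sets \<mu> = sets borel" and r: "\<mu> \<in> radon" using \<mu> by auto
  have rB: "restr B \<mu> \<in> radon" using B by (intro radon_density[OF lc r]) (auto simp: indicator_def)
  have le: "energy \<kappa> (restr B \<mu>) \<nu> \<le> energy \<kappa> \<mu> \<nu>" if "\<nu> \<in> radon" for \<nu>
    using that rB r s B unfolding energy_eq_pot[OF rB that] energy_eq_pot[OF r that]
    by (subst nn_integral_restr) (auto simp: pot_measurable indicator_def intro!: nn_integral_mono)
  have "energy \<kappa> (restr B \<mu>) (restr B \<mu>) \<le> energy \<kappa> \<mu> (restr B \<mu>)" by (rule le[OF rB])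
  also have "\<dots> = energy \<kappa> (restr B \<mu>) \<mu>" by (rule energy_sym[OF r rB])
  also have "\<dots> \<le> energy \<kappa> \<mu> \<mu>" by (rule le[OF r])
  finally show e: "energy \<kappa> (restr B \<mu>) (restr B \<mu>) \<le> energy \<kappa> \<mu> \<mu>" .
  have "restr B \<mu> \<in> Eplus \<kappa>" using rB e Eplus_self_finite[OF \<mu>] by (intro EplusI) (auto simp: le_less_trans)
  then show "restr B \<mu> \<in> Eplus_on \<kappa> B" using AE_restr[OF s B] by (simp add: Eplus_on_iff)
qed

lemma restr_Eplus_on':
  assumes "\<mu> \<in> Eplus_on \<kappa> Q" "B \<in> sets borel"
  shows "restr B \<mu> \<in> Eplus_on \<kappa> Q"
  using assms restr_Eplus_on(1)[of \<mu> B] AE_restr[of \<mu> B "\<lambda>x. x \<in> Q"]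
  by (auto simp: Eplus_on_iff elim: AE_mp)

lemma Eplus_on_madd:
  assumes "\<mu> \<in> Eplus_on \<kappa> K" "\<nu> \<in> Eplus_on \<kappa> K" "K \<in> sets borel"
  shows "madd \<mu> \<nu> \<in> Eplus_on \<kappa> K"
  using assms by (auto simp: Eplus_on_borel emeasure_madd)

lemma Eplus_on_scale:
  assumes "\<mu> \<in> Eplus_on \<kappa> K" "K \<in> sets borel"
  shows "scale_measure (ennreal c) \<mu> \<in> Eplus_on \<kappa> K"
  using assms by (auto simp: Eplus_on_borel)

lemma energy_pot_ip:
  assumes "\<mu> \<in> Eplus \<kappa>" "\<nu> \<in> Eplus \<kappa>"
  shows "(\<integral>\<^sup>+x. pot \<kappa> \<nu> x \<partial>\<mu>) = ennreal (ip \<nu> \<mu>)"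
  using assms by (simp add: energy_eq_pot[symmetric] energy_ip ip_sym)

lemma Eplus_mass_finite:
  assumes "compact K" "\<mu> \<in> Eplus_on \<kappa> K" shows "emeasure \<mu> UNIV = emeasure \<mu> K" "emeasure \<mu> UNIV < \<infinity>"
proof -
  have E: "\<mu> \<in> Eplus \<kappa>" "AE x in \<mu>. x \<in> K" using assms by (auto simp: Eplus_on_iff)
  show "emeasure \<mu> UNIV = emeasure \<mu> K"
    using E compact_borel[OF assms(1)] by (intro emeasure_eq_AE) auto
  then show "emeasure \<mu> UNIV < \<infinity>" using radon_compact_finite[of \<mu> K] E assms(1) by simp
qed

text \<open>Normalization removes the infimum and the unit mass from the definition. Compactness
  makes the mass finite, so that it can be normalized, and the complement open, so that support in
  \<open>K\<close> and concentration on \<open>K\<close> agree.\<close>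

lemma cap_pos_iff:
  assumes K: "compact K"
  shows "cap \<kappa> K \<noteq> 0 \<longleftrightarrow> (\<exists>\<mu>\<in>Eplus_on \<kappa> K. emeasure \<mu> UNIV \<noteq> 0)"
proof
  note Kb = compact_borel[OF K]
  define I where "I = (INF \<mu>\<in>{\<mu>\<in>radon. meas_supp \<mu> \<subseteq> K \<and> emeasure \<mu> UNIV = 1}. energy \<kappa> \<mu> \<mu>)"
  have cI: "cap \<kappa> K = 1 / I" by (simp add: cap_def I_def)
  {
    assume "cap \<kappa> K \<noteq> 0"
    then have "I < \<infinity>" unfolding cI by (auto simp: less_top)
    then obtain \<mu> where \<mu>: "\<mu> \<in> radon" "meas_supp \<mu> \<subseteq> K" "emeasure \<mu> UNIV = 1" "energy \<kappa> \<mu> \<mu> < \<infinity>"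
      unfolding I_def INF_less_iff by auto
    have "emeasure \<mu> (- K) = 0" by (rule emeasure_Compl_meas_supp[OF sets_radon[OF \<mu>(1)] \<mu>(2)])
    then have "\<mu> \<in> Eplus_on \<kappa> K" using \<mu> Kb by (simp add: Eplus_on_borel EplusI)
    then show "\<exists>\<mu>\<in>Eplus_on \<kappa> K. emeasure \<mu> UNIV \<noteq> 0" using \<mu>(3) by (intro bexI[of _ \<mu>]) auto
  }
  assume "\<exists>\<mu>\<in>Eplus_on \<kappa> K. emeasure \<mu> UNIV \<noteq> 0"
  then obtain \<mu> where \<mu>: "\<mu> \<in> Eplus_on \<kappa> K" "emeasure \<mu> UNIV \<noteq> 0" by blast
  obtain r where r: "emeasure \<mu> UNIV = ennreal r" "0 < r"
    using Eplus_mass_finite(2)[OF K \<mu>(1)] \<mu>(2) by (cases "emeasure \<mu> UNIV") (auto simp: less_le)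
  define \<nu> where "\<nu> = scale_measure (ennreal (1/r)) \<mu>"
  have \<nu>: "\<nu> \<in> Eplus_on \<kappa> K" unfolding \<nu>_def by (rule Eplus_on_scale[OF \<mu>(1) Kb])
  then have \<nu>E: "\<nu> \<in> Eplus \<kappa>" "emeasure \<nu> (- K) = 0" by (simp_all add: Eplus_on_borel Kb)
  have "emeasure \<nu> UNIV = ennreal (1/r) * ennreal r" unfolding \<nu>_def by (simp add: r)
  also have "\<dots> = ennreal ((1/r) * r)" using r(2) by (intro ennreal_mult[symmetric]) auto
  finally have m: "emeasure \<nu> UNIV = 1" using r(2) by simp
  have "meas_supp \<nu> \<subseteq> K"
  proof
    fix x assume x: "x \<in> meas_supp \<nu>"
    show "x \<in> K"
    proof (rule ccontr)
      assume "x \<notin> K"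
      then have "emeasure \<nu> (- K) > 0" using x K unfolding meas_supp_def
        by (auto simp: compact_imp_closed open_Compl)
      then show False using \<nu>E by simp
    qed
  qed
  then have "I \<le> energy \<kappa> \<nu> \<nu>" unfolding I_def using \<nu>E(1) m by (intro INF_lower) auto
  then have "I < \<infinity>" using Eplus_self_finite[OF \<nu>E(1)] by (simp add: le_less_trans)
  then show "cap \<kappa> K \<noteq> 0" unfolding cI by (simp add: ennreal_divide_eq_0_iff)
qed

lemma nearly_everywhere_iff:
  "nearly_everywhere \<kappa> Q P \<longleftrightarrow>
    (\<forall>K \<mu>. compact K \<longrightarrow> K \<subseteq> {x\<in>Q. \<not> P x} \<longrightarrow> \<mu> \<in> Eplus_on \<kappa> K \<longrightarrow> emeasure \<mu> UNIV = 0)"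
proof -
  have "nearly_everywhere \<kappa> Q P \<longleftrightarrow> (\<forall>K. compact K \<and> K \<subseteq> {x\<in>Q. \<not> P x} \<longrightarrow> cap \<kappa> K = 0)"
    unfolding nearly_everywhere_def inner_cap_def bot_ennreal[symmetric] SUP_bot_conv by simp
  then show ?thesis using cap_pos_iff by blast
qed

text \<open>\<open>Q\<close> may be non-measurable. Removing a Borel null set \<open>N\<close> that
  covers its complement leaves a Borel exceptional set inside \<open>Q\<close>; if that set had
  positive measure, a compact part of it would carry a nonzero measure of finite energy.\<close>

lemma nearly_everywhere_AE:
  assumes ne: "nearly_everywhere \<kappa> Q P" and P: "{x. P x} \<in> sets borel" and \<mu>: "\<mu> \<in> Eplus_on \<kappa> Q"
  shows "AE x in \<mu>. P x"
proof -
  have E: "\<mu> \<in> Eplus \<kappa>" "AE x in \<mu>. x \<in> Q" using \<mu> by (auto simp: Eplus_on_iff)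
  have s: "sets \<mu> = sets borel" and sp: "space \<mu> = UNIV" using E space_radon by auto
  obtain N where N: "{x \<in> space \<mu>. \<not> x \<in> Q} \<subseteq> N" "emeasure \<mu> N = 0" "N \<in> sets \<mu>"
    using E(2) by (rule AE_E)
  define B where "B = - {x. P x} - N"
  have B: "B \<in> sets borel" unfolding B_def using P N(3) s by auto
  have "emeasure \<mu> B = 0"
  proof (rule ccontr)
    assume "emeasure \<mu> B \<noteq> 0"
    then have "0 < emeasure \<mu> B" by (simp add: zero_less_iff_neq_zero)
    from radon_pos_compact[OF Eplus_radon[OF E(1)] B this]
    obtain K where K: "compact K" "K \<subseteq> B" "0 < emeasure \<mu> K" .
    have "K \<subseteq> {x\<in>Q. \<not> P x}" using K(2) N(1) sp unfolding B_def by blast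
    then have "emeasure (restr K \<mu>) UNIV = 0"
      using ne restr_Eplus_on(1)[OF E(1) compact_borel[OF K(1)]] K(1) unfolding nearly_everywhere_iff by blast
    then show False using K(3) emeasure_restr[OF s compact_borel[OF K(1)], of UNIV] by simp
  qed
  then have "B \<in> null_sets \<mu>" "N \<in> null_sets \<mu>" using B N s by (auto simp: null_sets_def)
  then have "B \<union> N \<in> null_sets \<mu>" by (rule null_sets.Un)
  moreover have "{x \<in> space \<mu>. \<not> P x} \<subseteq> B \<union> N" unfolding B_def by blast
  ultimately show ?thesis by (rule AE_I')
qed

text \<open>Exactly what minimizing \<open>ip \<mu> \<mu> - 2 \<integral> f d\<mu>\<close> over the measures on \<open>K\<close> requires of \<open>f\<close>. The two
  instances are continuous functions and potentials of finite energy.\<close>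

definition admissible :: "'a set \<Rightarrow> ('a \<Rightarrow> ennreal) \<Rightarrow> bool" where
  "admissible K f \<longleftrightarrow> f \<in> borel_measurable borel \<and>
    (\<forall>\<mu>\<in>Eplus_on \<kappa> K. (\<integral>\<^sup>+x. f x \<partial>\<mu>) < \<infinity>) \<and>
    (\<exists>c. \<forall>\<mu>\<in>Eplus_on \<kappa> K. enn2real (\<integral>\<^sup>+x. f x \<partial>\<mu>) \<le> c * sqrt (ip \<mu> \<mu>)) \<and>
    (\<forall>s \<mu>. sconv s \<mu> \<longrightarrow> (\<forall>n. s n \<in> Eplus_on \<kappa> K) \<longrightarrow> \<mu> \<in> Eplus_on \<kappa> K \<longrightarrow>
      (\<lambda>n. enn2real (\<integral>\<^sup>+x. f x \<partial>s n)) \<longlonglongrightarrow> enn2real (\<integral>\<^sup>+x. f x \<partial>\<mu>))"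

text \<open>The minimizer of \<open>J\<close> is the projection of \<open>f\<close> onto the cone of
  measures on \<open>K\<close>: adding a small multiple of \<open>\<mu>\<close> gives the
  inequality, shrinking \<open>\<nu>\<close> itself gives the equality. With \<open>f\<close> the
  constant 1 this produces the equilibrium measure.\<close>

lemma compact_projection:
  assumes K: "compact K" and ad: "admissible K f"
  obtains \<nu> where "\<nu> \<in> Eplus_on \<kappa> K" "\<And>\<mu>. \<mu> \<in> Eplus_on \<kappa> K \<Longrightarrow> (\<integral>\<^sup>+x. f x \<partial>\<mu>) \<le> ennreal (ip \<nu> \<mu>)"
    "(\<integral>\<^sup>+x. f x \<partial>\<nu>) = ennreal (ip \<nu> \<nu>)" "AE x in \<nu>. pot \<kappa> \<nu> x = f x"
proof -
  define L where "L \<mu> = enn2real (\<integral>\<^sup>+x. f x \<partial>\<mu>)" for \<mu>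
  define J where "J \<mu> = ip \<mu> \<mu> - 2 * L \<mu>" for \<mu>
  note Kb = compact_borel[OF K]
  have f: "f \<in> borel_measurable borel" using ad by (simp add: admissible_def)
  have fin: "(\<integral>\<^sup>+x. f x \<partial>\<mu>) < \<infinity>" if "\<mu> \<in> Eplus_on \<kappa> K" for \<mu>
    using ad that by (simp add: admissible_def)
  have Leq: "(\<integral>\<^sup>+x. f x \<partial>\<mu>) = ennreal (L \<mu>)" if "\<mu> \<in> Eplus_on \<kappa> K" for \<mu>
    using fin[OF that] by (simp add: L_def)
  have L0: "0 \<le> L \<mu>" for \<mu> by (simp add: L_def)
  obtain c where c: "\<And>\<mu>. \<mu> \<in> Eplus_on \<kappa> K \<Longrightarrow> L \<mu> \<le> c * sqrt (ip \<mu> \<mu>)"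
    using ad unfolding admissible_def L_def by blast
  have cont: "(\<lambda>n. L (s n)) \<longlonglongrightarrow> L \<mu>" if "sconv s \<mu>" "\<And>n. s n \<in> Eplus_on \<kappa> K" "\<mu> \<in> Eplus_on \<kappa> K" for s \<mu>
    using ad that unfolding admissible_def L_def by blast
  have Lmadd: "L (madd \<mu> \<nu>) = L \<mu> + L \<nu>" if "\<mu> \<in> Eplus_on \<kappa> K" "\<nu> \<in> Eplus_on \<kappa> K" for \<mu> \<nu>
    using fin[OF that(1)] fin[OF that(2)] that f
    by (simp add: L_def nn_integral_madd Eplus_onD enn2real_plus)
  have Lscale: "L (scale_measure (ennreal t) \<mu>) = t * L \<mu>" if "\<mu> \<in> Eplus_on \<kappa> K" "0 \<le> t" for \<mu> t
  proof -
    have "f \<in> borel_measurable \<mu>" using f that(1) by (simp add: Eplus_onD cong: measurable_cong_sets)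
    then show ?thesis using that by (simp add: L_def nn_integral_scale_measure enn2real_mult)
  qed
  have midK: "mid \<mu> \<nu> \<in> Eplus_on \<kappa> K" if "\<mu> \<in> Eplus_on \<kappa> K" "\<nu> \<in> Eplus_on \<kappa> K" for \<mu> \<nu>
    unfolding mid_def using that Kb by (intro Eplus_on_scale Eplus_on_madd)
  have Lmid: "L (mid \<mu> \<nu>) = (L \<mu> + L \<nu>) / 2" if "\<mu> \<in> Eplus_on \<kappa> K" "\<nu> \<in> Eplus_on \<kappa> K" for \<mu> \<nu>
    unfolding mid_def using Lscale[OF Eplus_on_madd[OF that Kb], of "1/2"] Lmadd[OF that] by simp
  \<comment> \<open>Completing the square: the linear term is at most \<open>c\<close> times the
    norm, so \<open>J\<close> is bounded below.\<close>
  have lower: "- (c\<^sup>2) \<le> J \<mu>" if "\<mu> \<in> Eplus_on \<kappa> K" for \<mu>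
  proof -
    have "0 \<le> (sqrt (ip \<mu> \<mu>) - c)\<^sup>2" by simp
    also have "\<dots> = ip \<mu> \<mu> - 2 * (c * sqrt (ip \<mu> \<mu>)) + c\<^sup>2" by (simp add: power2_diff)
    finally show ?thesis using c[OF that] by (simp add: J_def)
  qed
  have nullK: "null_measure borel \<in> Eplus_on \<kappa> K" by (simp add: Eplus_on_borel Kb)
  have dec: "decseq (\<lambda>n::nat. Eplus_on \<kappa> K)" by (simp add: decseq_def)
  have sub: "Eplus_on \<kappa> K \<subseteq> Eplus \<kappa>" by (auto simp: Eplus_onD)
  have up: "\<exists>\<mu>\<in>Eplus_on \<kappa> K. J \<mu> \<le> J (null_measure borel)" using nullK by blast
  \<comment> \<open>The sets do not vary with \<open>n\<close> here; the null measure provides the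
    upper bound.\<close>
  obtain s \<nu> where s: "sconv s \<nu>" "\<And>n. s n \<in> Eplus_on \<kappa> K"
      "\<And>n \<mu>. \<mu> \<in> Eplus_on \<kappa> K \<Longrightarrow> J (s n) \<le> J \<mu> + 1 / real (Suc n)"
    by (rule nested_minimizers[OF J_def sub dec midK Lmid lower up]) blast+
  have \<nu>E: "\<nu> \<in> Eplus \<kappa>" using s(1) by (rule sconvD)
  have "emeasure \<nu> (- K) = 0"
    using s(2) K by (intro sconv_open_null[OF s(1)]) (auto simp: Eplus_on_borel Kb open_Compl compact_imp_closed)
  then have \<nu>K: "\<nu> \<in> Eplus_on \<kappa> K" using \<nu>E by (simp add: Eplus_on_borel Kb)
  have min: "J \<nu> \<le> J \<mu>" if "\<mu> \<in> Eplus_on \<kappa> K" for \<mu>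
  proof (rule LIMSEQ_le)
    show "(\<lambda>n. J (s n)) \<longlonglongrightarrow> J \<nu>"
      unfolding J_def by (intro tendsto_intros sconv_ip_self s(1) cont s(2) \<nu>K)
    have "(\<lambda>n. J \<mu> + inverse (real (Suc n))) \<longlonglongrightarrow> J \<mu> + 0"
      by (intro tendsto_intros LIMSEQ_inverse_real_of_nat)
    then show "(\<lambda>n. J \<mu> + 1 / real (Suc n)) \<longlonglongrightarrow> J \<mu>" by (simp add: inverse_eq_divide)
    show "\<exists>N. \<forall>n\<ge>N. J (s n) \<le> J \<mu> + 1 / real (Suc n)" using s(3)[OF that] by blast
  qed
  have var: "L \<mu> \<le> ip \<nu> \<mu>" if \<mu>: "\<mu> \<in> Eplus_on \<kappa> K" for \<mu>
  proof -
    have \<mu>E: "\<mu> \<in> Eplus \<kappa>" using \<mu> by (rule Eplus_onD)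
    have "0 \<le> 2 * (ip \<nu> \<mu> - L \<mu>)"
    proof (rule small_step_nonneg)
      fix t :: real assume t: "0 < t" "t \<le> 1"
      let ?m = "scale_measure (ennreal t) \<mu>"
      have m: "?m \<in> Eplus_on \<kappa> K" "?m \<in> Eplus \<kappa>" using \<mu> \<mu>E Kb by (auto intro: Eplus_on_scale)
      have "J \<nu> \<le> J (madd \<nu> ?m)" by (intro min Eplus_on_madd \<nu>K m Kb)
      also have "J (madd \<nu> ?m) = J \<nu> + t * (2 * (ip \<nu> \<mu> - L \<mu>) + t * ip \<mu> \<mu>)"
        unfolding J_def using t(1) m \<nu>E \<mu>E \<mu> \<nu>K
        by (simp add: ip_madd ip_scale Lmadd Lscale ip_sym[of \<mu> \<nu>] algebra_simps)
      finally show "0 \<le> t * (2 * (ip \<nu> \<mu> - L \<mu>) + t * ip \<mu> \<mu>)" by simp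
    qed
    then show ?thesis by simp
  qed
  have "0 \<le> 2 * (L \<nu> - ip \<nu> \<nu>)"
  proof (rule small_step_nonneg)
    fix t :: real assume t: "0 < t" "t \<le> 1"
    let ?m = "scale_measure (ennreal (1 - t)) \<nu>"
    have "J \<nu> \<le> J ?m" by (intro min Eplus_on_scale \<nu>K Kb)
    also have "J ?m = J \<nu> + t * (2 * (L \<nu> - ip \<nu> \<nu>) + t * ip \<nu> \<nu>)"
      unfolding J_def using t \<nu>E \<nu>K by (simp add: ip_scale Lscale algebra_simps)
    finally show "0 \<le> t * (2 * (L \<nu> - ip \<nu> \<nu>) + t * ip \<nu> \<nu>)" by simp
  qed
  then have LI: "L \<nu> = ip \<nu> \<nu>" using var[OF \<nu>K] by simp
  have fle: "(\<integral>\<^sup>+x. f x \<partial>\<mu>) \<le> ennreal (ip \<nu> \<mu>)" if "\<mu> \<in> Eplus_on \<kappa> K" for \<mu>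
    unfolding Leq[OF that] by (intro ennreal_leI var that)
  have feq: "(\<integral>\<^sup>+x. f x \<partial>\<nu>) = ennreal (ip \<nu> \<nu>)" unfolding Leq[OF \<nu>K] LI ..
  have ps: "sets \<nu> = sets borel" "pot \<kappa> \<nu> \<in> borel_measurable borel" using \<nu>E by (auto intro: pot_measurable)
  have [measurable]: "pot \<kappa> \<nu> \<in> borel_measurable borel" "f \<in> borel_measurable borel" by fact+
  \<comment> \<open>Restricting \<open>\<nu>\<close> to the set where its potential is too small
    gives a measure on \<open>K\<close>, so the variational inequality shows this set to be null;
    the equality of the integrals then excludes a strict inequality in the other direction.\<close>
  define B where "B = {x. pot \<kappa> \<nu> x < f x}"
  have Bm: "B \<in> sets borel" unfolding B_def by measurable
  have rB: "restr B \<nu> \<in> Eplus_on \<kappa> K" by (rule restr_Eplus_on'[OF \<nu>K Bm])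
  have "AE x in \<nu>. f x \<le> pot \<kappa> \<nu> x"
  proof (rule AE_le_of_restr[OF ps f B_def])
    show "(\<integral>\<^sup>+x. f x \<partial>restr B \<nu>) \<le> (\<integral>\<^sup>+x. pot \<kappa> \<nu> x \<partial>restr B \<nu>)"
      using fle[OF rB] energy_pot_ip[OF Eplus_onD[OF rB] \<nu>E] by simp
    show "(\<integral>\<^sup>+x. f x \<partial>restr B \<nu>) < \<infinity>" by (rule fin[OF rB])
  qed
  then have "AE x in \<nu>. f x = pot \<kappa> \<nu> x"
    by (rule AE_eq_of_nn_integral[OF ps(1) f ps(2)]) (simp_all add: feq energy_pot_ip \<nu>E)
  then have "AE x in \<nu>. pot \<kappa> \<nu> x = f x" by eventually_elim simp
  with \<nu>K fle feq show thesis by (rule that)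
qed

lemma compact_sweep:
  assumes K: "compact K" and \<sigma>: "\<sigma> \<in> radon" and ad: "admissible K (pot \<kappa> \<sigma>)"
  obtains \<nu> where "\<nu> \<in> Eplus_on \<kappa> K"
    "\<And>\<mu>. \<mu> \<in> Eplus_on \<kappa> K \<Longrightarrow> (\<integral>\<^sup>+x. pot \<kappa> \<sigma> x \<partial>\<mu>) \<le> ennreal (ip \<nu> \<mu>)"
    "(\<integral>\<^sup>+x. pot \<kappa> \<sigma> x \<partial>\<nu>) = ennreal (ip \<nu> \<nu>)" "\<And>x. pot \<kappa> \<nu> x \<le> pot \<kappa> \<sigma> x"
proof -
  obtain \<nu> where \<nu>: "\<nu> \<in> Eplus_on \<kappa> K"
    "\<And>\<mu>. \<mu> \<in> Eplus_on \<kappa> K \<Longrightarrow> (\<integral>\<^sup>+x. pot \<kappa> \<sigma> x \<partial>\<mu>) \<le> ennreal (ip \<nu> \<mu>)"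
    "(\<integral>\<^sup>+x. pot \<kappa> \<sigma> x \<partial>\<nu>) = ennreal (ip \<nu> \<nu>)" "AE x in \<nu>. pot \<kappa> \<nu> x = pot \<kappa> \<sigma> x"
    by (rule compact_projection[OF K ad]) (rule that)
  have "AE x in \<nu>. pot \<kappa> \<nu> x \<le> pot \<kappa> \<sigma> x" using \<nu>(4) by eventually_elim simp
  then have "\<forall>x. pot \<kappa> \<nu> x \<le> pot \<kappa> \<sigma> x"
    using dom Eplus_onD[OF \<nu>(1)] \<sigma> unfolding domination_principle_def by blast
  then show thesis using \<nu> that by blast
qed

text \<open>Otherwise there are unit measures on \<open>K\<close> whose norms tend to 0. They
  converge strongly, hence vaguely, to 0, although a bump function equal to 1 on \<open>K\<close>
  has integral 1 against each of them.\<close>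

lemma compact_mass_bound:
  assumes K: "compact K"
  obtains c where "\<And>\<mu>. \<mu> \<in> Eplus_on \<kappa> K \<Longrightarrow> enn2real (emeasure \<mu> UNIV) \<le> c * sqrt (ip \<mu> \<mu>)"
proof (rule ccontr)
  note Kb = compact_borel[OF K]
  assume "\<not> thesis"
  then have "\<forall>c. \<exists>\<mu>\<in>Eplus_on \<kappa> K. c * sqrt (ip \<mu> \<mu>) < enn2real (emeasure \<mu> UNIV)"
    using that by (meson not_le)
  then have "\<forall>n. \<exists>\<mu>\<in>Eplus_on \<kappa> K. real (Suc n) * sqrt (ip \<mu> \<mu>) < enn2real (emeasure \<mu> UNIV)" by blast
  then obtain m where m: "\<And>n. m n \<in> Eplus_on \<kappa> K"
    "\<And>n. real (Suc n) * sqrt (ip (m n) (m n)) < enn2real (emeasure (m n) UNIV)" by metis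
  define r where "r n = enn2real (emeasure (m n) UNIV)" for n
  have mr: "emeasure (m n) UNIV = ennreal (r n)" for n
    using Eplus_mass_finite(2)[OF K m(1)[of n]] by (simp add: r_def)
  have r0: "0 < r n" for n
    using m(2)[of n] unfolding r_def by (rule le_less_trans[rotated]) simp
  define s where "s n = scale_measure (ennreal (1 / r n)) (m n)" for n
  have sK: "s n \<in> Eplus_on \<kappa> K" for n unfolding s_def by (rule Eplus_on_scale[OF m(1) Kb])
  have sE: "s n \<in> Eplus \<kappa>" for n using sK by (rule Eplus_onD)
  have s1: "emeasure (s n) UNIV = 1" for n
  proof -
    have "emeasure (s n) UNIV = ennreal (1 / r n) * ennreal (r n)" by (simp add: s_def mr)
    also have "\<dots> = ennreal ((1 / r n) * r n)" using r0[of n] by (intro ennreal_mult[symmetric]) auto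
    finally show ?thesis using r0[of n] by simp
  qed
  have ipb: "sqrt (ip (s n) (s n)) \<le> 1 / real (Suc n)" for n
  proof -
    have E: "m n \<in> Eplus \<kappa>" using m(1) by (rule Eplus_onD)
    have "ip (s n) (s n) = (1 / r n) * ((1 / r n) * ip (m n) (m n))"
      unfolding s_def using E r0[of n] by (simp add: ip_scale)
    then have "sqrt (ip (s n) (s n)) = (1 / r n) * sqrt (ip (m n) (m n))"
      using r0[of n] by (simp add: real_sqrt_divide real_sqrt_mult)
    also have "\<dots> \<le> (1 / r n) * (r n / real (Suc n))"
      using m(2)[of n] r0[of n] by (intro mult_left_mono) (auto simp: r_def field_simps)
    also have "\<dots> = 1 / real (Suc n)" using r0[of n] by simp
    finally show ?thesis .
  qed
  have "(\<lambda>n. strong_dist \<kappa> (s n) (null_measure borel)) \<longlonglongrightarrow> 0"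
  proof (rule tendsto_sandwich[OF _ _ tendsto_const])
    show "\<forall>\<^sub>F n in sequentially. 0 \<le> strong_dist \<kappa> (s n) (null_measure borel)" by simp
    show "\<forall>\<^sub>F n in sequentially. strong_dist \<kappa> (s n) (null_measure borel) \<le> inverse (real (Suc n))"
      using ipb sE by (simp add: strong_dist_eq inverse_eq_divide)
  qed (rule LIMSEQ_inverse_real_of_nat)
  then have sc: "sconv s (null_measure borel)" using sE by (simp add: sconv_def)
  obtain f where f: "continuous_on UNIV f" "compact (closure {x. f x \<noteq> 0})"
    "\<And>x. 0 \<le> f x" "\<And>x. f x \<le> 1" "\<And>x. x \<in> K \<Longrightarrow> f x = (1::real)" "\<And>x. x \<notin> UNIV \<Longrightarrow> f x = 0"
    by (rule compact_bump[OF lc K open_UNIV subset_UNIV]) (rule that)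
  have "(\<integral>x. f x \<partial>s n) = 1" for n
  proof -
    have "AE x in s n. x \<in> K" using sK[of n] by (simp add: Eplus_on_iff)
    then have "AE x in s n. f x = 1" by eventually_elim (rule f(5))
    moreover have "f \<in> borel_measurable (s n)"
      using borel_measurable_continuous_onI[OF f(1)] sE by (simp cong: measurable_cong_sets)
    ultimately have "(\<integral>x. f x \<partial>s n) = (\<integral>x. 1 \<partial>s n)" by (intro integral_cong_AE) auto
    also have "\<dots> = 1" using s1[of n] space_radon[OF Eplus_radon[OF sE]] by (simp add: measure_def)
    finally show ?thesis .
  qed
  then have "(\<lambda>n. 1::real) \<longlonglongrightarrow> (\<integral>x. f x \<partial>null_measure borel)" using sconv_vague[OF sc f(1,2)] by simp
  moreover have "(\<integral>x. f x \<partial>null_measure borel) = 0"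
    by (intro integral_eq_zero_AE AE_I[of _ _ UNIV]) auto
  ultimately show False by (simp add: LIMSEQ_const_iff)
qed

text \<open>Continuity of \<open>f\<close> on \<open>K\<close> is what makes integration against \<open>f\<close> strongly continuous: there the
  strong topology only gives vague convergence.\<close>

lemma admissible_continuous:
  assumes K: "compact K" and f: "f \<in> borel_measurable borel" and c: "continuous_on K f"
    and b: "\<And>x. x \<in> K \<Longrightarrow> f x \<le> ennreal b" and b0: "0 \<le> b"
  shows "admissible K f"
proof -
  have fin: "x \<in> K \<Longrightarrow> f x < \<infinity>" for x using b[of x] by (auto simp: le_less_trans)
  have cr: "continuous_on K (\<lambda>x. enn2real (f x))"
    using c fin unfolding continuous_on_def by (auto intro!: tendsto_enn2real simp: less_top)
  \<comment> \<open>A test function that measures on \<open>K\<close> cannot distinguish from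
    \<open>f\<close>.\<close>
  obtain g where g: "continuous_on UNIV g" "compact (closure {x. g x \<noteq> 0})" "\<And>x. x \<in> K \<Longrightarrow> g x = enn2real (f x)"
    by (rule compact_supported_extension[OF lc K cr]) (rule that)
  have up: "(\<integral>\<^sup>+x. f x \<partial>\<mu>) \<le> ennreal b * emeasure \<mu> UNIV" if \<mu>: "\<mu> \<in> Eplus_on \<kappa> K" for \<mu>
  proof -
    have "AE x in \<mu>. x \<in> K" using \<mu> by (simp add: Eplus_on_iff)
    then have "AE x in \<mu>. f x \<le> ennreal b" by eventually_elim (rule b)
    then have "(\<integral>\<^sup>+x. f x \<partial>\<mu>) \<le> (\<integral>\<^sup>+x. ennreal b \<partial>\<mu>)" by (rule nn_integral_mono_AE)
    then show ?thesis using space_radon[OF Eplus_radon[OF Eplus_onD[OF \<mu>]]] by simp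
  qed
  have eq: "enn2real (\<integral>\<^sup>+x. f x \<partial>\<mu>) = (\<integral>x. g x \<partial>\<mu>)" if \<mu>: "\<mu> \<in> Eplus_on \<kappa> K" for \<mu>
  proof -
    have K': "AE x in \<mu>. x \<in> K" using \<mu> by (simp add: Eplus_on_iff)
    have E: "\<mu> \<in> Eplus \<kappa>" using \<mu> by (rule Eplus_onD)
    have i: "integrable \<mu> g" using E by (intro integrable_compact_support[OF _ g(1,2)]) auto
    have g0: "AE x in \<mu>. 0 \<le> g x" using K' by eventually_elim (simp add: g(3))
    have "AE x in \<mu>. f x = ennreal (g x)" using K' by eventually_elim (use g(3) fin in simp)
    then have "(\<integral>\<^sup>+x. f x \<partial>\<mu>) = (\<integral>\<^sup>+x. ennreal (g x) \<partial>\<mu>)" by (rule nn_integral_cong_AE)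
    also have "\<dots> = ennreal (\<integral>x. g x \<partial>\<mu>)"
      by (intro nn_integral_eq_integral i g0)
    finally show ?thesis using integral_nonneg_AE[OF g0] by simp
  qed
  obtain c where c: "\<And>\<mu>. \<mu> \<in> Eplus_on \<kappa> K \<Longrightarrow> enn2real (emeasure \<mu> UNIV) \<le> c * sqrt (ip \<mu> \<mu>)"
    by (rule compact_mass_bound[OF K]) (rule that)
  show ?thesis
    unfolding admissible_def
  proof (intro conjI ballI allI impI f)
    fix \<mu> assume \<mu>: "\<mu> \<in> Eplus_on \<kappa> K"
    show "(\<integral>\<^sup>+x. f x \<partial>\<mu>) < \<infinity>"
      using up[OF \<mu>] Eplus_mass_finite(2)[OF K \<mu>] by (auto simp: ennreal_mult_less_top le_less_trans)
  next
    show "\<exists>c. \<forall>\<mu>\<in>Eplus_on \<kappa> K. enn2real (\<integral>\<^sup>+x. f x \<partial>\<mu>) \<le> c * sqrt (ip \<mu> \<mu>)"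
    proof (intro exI[of _ "b * c"] ballI)
      fix \<mu> assume \<mu>: "\<mu> \<in> Eplus_on \<kappa> K"
      have "enn2real (\<integral>\<^sup>+x. f x \<partial>\<mu>) \<le> enn2real (ennreal b * emeasure \<mu> UNIV)"
        using up[OF \<mu>] Eplus_mass_finite(2)[OF K \<mu>] by (intro enn2real_mono) (auto simp: ennreal_mult_less_top)
      also have "\<dots> = b * enn2real (emeasure \<mu> UNIV)" using b0 by (simp add: enn2real_mult)
      also have "\<dots> \<le> b * (c * sqrt (ip \<mu> \<mu>))" using c[OF \<mu>] b0 by (intro mult_left_mono)
      finally show "enn2real (\<integral>\<^sup>+x. f x \<partial>\<mu>) \<le> b * c * sqrt (ip \<mu> \<mu>)" by simp
    qed
  next
    fix s \<mu> assume "sconv s \<mu>" "\<forall>n. s n \<in> Eplus_on \<kappa> K" "\<mu> \<in> Eplus_on \<kappa> K"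
    then show "(\<lambda>n. enn2real (\<integral>\<^sup>+x. f x \<partial>s n)) \<longlonglongrightarrow> enn2real (\<integral>\<^sup>+x. f x \<partial>\<mu>)"
      using sconv_vague[OF _ g(1,2)] by (simp add: eq)
  qed
qed

lemma admissible_pot:
  assumes "\<sigma> \<in> Eplus \<kappa>" shows "admissible K (pot \<kappa> \<sigma>)"
proof -
  have eq: "enn2real (\<integral>\<^sup>+x. pot \<kappa> \<sigma> x \<partial>\<mu>) = ip \<mu> \<sigma>" if "\<mu> \<in> Eplus \<kappa>" for \<mu>
    using that assms by (simp add: energy_pot_ip ip_sym)
  show ?thesis
    unfolding admissible_def
  proof (intro conjI ballI allI impI)
    show "pot \<kappa> \<sigma> \<in> borel_measurable borel" using assms by (intro pot_measurable) auto
    show "\<exists>c. \<forall>\<mu>\<in>Eplus_on \<kappa> K. enn2real (\<integral>\<^sup>+x. pot \<kappa> \<sigma> x \<partial>\<mu>) \<le> c * sqrt (ip \<mu> \<mu>)"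
    proof (intro exI[of _ "sqrt (ip \<sigma> \<sigma>)"] ballI)
      fix \<mu> assume "\<mu> \<in> Eplus_on \<kappa> K"
      then have E: "\<mu> \<in> Eplus \<kappa>" by (rule Eplus_onD)
      show "enn2real (\<integral>\<^sup>+x. pot \<kappa> \<sigma> x \<partial>\<mu>) \<le> sqrt (ip \<sigma> \<sigma>) * sqrt (ip \<mu> \<mu>)"
        unfolding eq[OF E] using ip_Cauchy_Schwarz[OF E assms] by (simp add: mult.commute)
    qed
  next
    fix \<mu> assume "\<mu> \<in> Eplus_on \<kappa> K"
    then show "(\<integral>\<^sup>+x. pot \<kappa> \<sigma> x \<partial>\<mu>) < \<infinity>" using assms by (simp add: energy_pot_ip Eplus_onD)
  next
    fix s \<mu> assume s: "sconv s \<mu>"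
    then show "(\<lambda>n. enn2real (\<integral>\<^sup>+x. pot \<kappa> \<sigma> x \<partial>s n)) \<longlonglongrightarrow> enn2real (\<integral>\<^sup>+x. pot \<kappa> \<sigma> x \<partial>\<mu>)"
      using sconv_ip[OF s assms] sconvD[OF s] by (simp add: eq)
  qed
qed

end

section \<open>Sweeping and balayage\<close>

context perfect begin

lemma Eclosed_on_Eplus: "\<nu> \<in> Eclosed_on \<kappa> Q \<Longrightarrow> \<nu> \<in> Eplus \<kappa>"
  unfolding Eclosed_on_iff by (auto dest: sconvD(2))

lemma Eclosed_on_mono:
  assumes "\<nu> \<in> Eclosed_on \<kappa> Q" "Q \<subseteq> Q'" shows "\<nu> \<in> Eclosed_on \<kappa> Q'"
proof -
  obtain s where s: "\<And>n. s n \<in> Eplus_on \<kappa> Q" "sconv s \<nu>" using assms(1) unfolding Eclosed_on_iff by blast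
  have "\<forall>n. s n \<in> Eplus_on \<kappa> Q'" using Eplus_on_mono[OF s(1) assms(2)] by simp
  then show ?thesis using s(2) unfolding Eclosed_on_iff by blast
qed

text \<open>The compact sweeps form an increasing net for which \<open>ip (N L) (N K) \<ge> ip (N K) (N K)\<close>
  whenever \<open>K \<subseteq> L\<close>, so \<open>sq (N L) (N K)\<close> is at most the increase of the energy.\<close>

lemma sweep:
  assumes \<sigma>: "\<sigma> \<in> radon" and ad: "\<And>K. compact K \<Longrightarrow> K \<subseteq> Q \<Longrightarrow> admissible K (pot \<kappa> \<sigma>)"
    and bnd: "\<And>K \<nu>. compact K \<Longrightarrow> K \<subseteq> Q \<Longrightarrow> \<nu> \<in> Eplus_on \<kappa> K \<Longrightarrow> (\<And>x. pot \<kappa> \<nu> x \<le> pot \<kappa> \<sigma> x) \<Longrightarrow>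
        (\<integral>\<^sup>+x. pot \<kappa> \<sigma> x \<partial>\<nu>) = ennreal (ip \<nu> \<nu>) \<Longrightarrow> ip \<nu> \<nu> \<le> S"
  obtains K :: "nat \<Rightarrow> 'a set" and \<nu> where "\<And>n. compact (K n)" "\<And>n. K n \<subseteq> Q"
    "\<nu> \<in> Eclosed_on \<kappa> (\<Union>n. K n)" "\<And>x. pot \<kappa> \<nu> x \<le> pot \<kappa> \<sigma> x"
    "nearly_everywhere \<kappa> Q (\<lambda>x. pot \<kappa> \<nu> x = pot \<kappa> \<sigma> x)"
proof -
  \<comment> \<open>All properties of a compact sweep are bundled so that a single choice function
    \<open>N\<close> provides them for every compact subset.\<close>
  define P where "P K \<nu> \<longleftrightarrow> \<nu> \<in> Eplus_on \<kappa> K \<and>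
      (\<forall>\<mu>\<in>Eplus_on \<kappa> K. (\<integral>\<^sup>+x. pot \<kappa> \<sigma> x \<partial>\<mu>) \<le> ennreal (ip \<nu> \<mu>)) \<and>
      (\<integral>\<^sup>+x. pot \<kappa> \<sigma> x \<partial>\<nu>) = ennreal (ip \<nu> \<nu>) \<and> (\<forall>x. pot \<kappa> \<nu> x \<le> pot \<kappa> \<sigma> x)" for K \<nu>
  have P: "\<exists>\<nu>. P K \<nu>" if K: "compact K" "K \<subseteq> Q" for K
  proof -
    obtain \<nu> where "\<nu> \<in> Eplus_on \<kappa> K"
      "\<And>\<mu>. \<mu> \<in> Eplus_on \<kappa> K \<Longrightarrow> (\<integral>\<^sup>+x. pot \<kappa> \<sigma> x \<partial>\<mu>) \<le> ennreal (ip \<nu> \<mu>)"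
      "(\<integral>\<^sup>+x. pot \<kappa> \<sigma> x \<partial>\<nu>) = ennreal (ip \<nu> \<nu>)" "\<And>x. pot \<kappa> \<nu> x \<le> pot \<kappa> \<sigma> x"
      by (rule compact_sweep[OF K(1) \<sigma> ad[OF K]]) (rule that)
    then have "P K \<nu>" by (simp add: P_def)
    then show ?thesis ..
  qed
  define N where "N K = (SOME \<nu>. P K \<nu>)" for K
  have PN: "P K (N K)" if "compact K" "K \<subseteq> Q" for K unfolding N_def using P[OF that] by (rule someI_ex)
  have N: "\<And>K. compact K \<Longrightarrow> K \<subseteq> Q \<Longrightarrow> N K \<in> Eplus_on \<kappa> K"
    "\<And>K \<mu>. compact K \<Longrightarrow> K \<subseteq> Q \<Longrightarrow> \<mu> \<in> Eplus_on \<kappa> K \<Longrightarrow> (\<integral>\<^sup>+x. pot \<kappa> \<sigma> x \<partial>\<mu>) \<le> ennreal (ip (N K) \<mu>)"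
    "\<And>K. compact K \<Longrightarrow> K \<subseteq> Q \<Longrightarrow> (\<integral>\<^sup>+x. pot \<kappa> \<sigma> x \<partial>N K) = ennreal (ip (N K) (N K))"
    "\<And>K x. compact K \<Longrightarrow> K \<subseteq> Q \<Longrightarrow> pot \<kappa> (N K) x \<le> pot \<kappa> \<sigma> x"
    using PN by (simp_all add: P_def)
  have NE: "N K \<in> Eplus \<kappa>" if "compact K" "K \<subseteq> Q" for K using N(1)[OF that] by (rule Eplus_onD)
  have sqN: "sq (N L) (N K) \<le> ip (N L) (N L) - ip (N K) (N K)"
    if K: "compact K" and L: "compact L" "L \<subseteq> Q" and KL: "K \<subseteq> L" for K L
  proof -
    have K': "K \<subseteq> Q" using KL L(2) by (rule order_trans)
    have "ennreal (ip (N K) (N K)) \<le> ennreal (ip (N L) (N K))"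
      using N(2)[OF L Eplus_on_mono[OF N(1)[OF K K'] KL]] N(3)[OF K K'] by simp
    then have "ip (N K) (N K) \<le> ip (N L) (N K)" by simp
    then show ?thesis by (simp add: sq_def)
  qed
  define E where "E K = ip (N K) (N K)" for K
  define \<K> where "\<K> = {K. compact K \<and> K \<subseteq> Q}"
  define T where "T = Sup (E ` \<K>)"
  have ES: "E K \<le> S" if "K \<in> \<K>" for K
    using bnd[OF _ _ N(1) N(4) N(3)] that by (simp add: E_def \<K>_def)
  have bdd: "bdd_above (E ` \<K>)" using ES by (intro bdd_aboveI[of _ S]) auto
  have ne: "E ` \<K> \<noteq> {}" by (auto simp: \<K>_def)
  have ET: "E K \<le> T" if "K \<in> \<K>" for K unfolding T_def using that bdd by (intro cSup_upper) auto
  have "\<exists>K\<in>\<K>. T - 1 / real (Suc n) < E K" for n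
  proof -
    have "\<exists>y\<in>E ` \<K>. T - 1 / real (Suc n) < y"
      unfolding T_def by (subst less_cSup_iff[symmetric, OF ne bdd]) simp
    then show ?thesis by blast
  qed
  then obtain C where C: "\<And>n. C n \<in> \<K>" "\<And>n. T - 1 / real (Suc n) < E (C n)" by metis
  \<comment> \<open>Finite unions make the sequence increasing; as energies grow with the set, it
    still exhausts the supremum \<open>T\<close>.\<close>
  define K where "K n = (\<Union>i\<le>n. C i)" for n
  have Kc: "compact (K n)" "K n \<subseteq> Q" for n
  proof -
    show "compact (K n)" unfolding K_def using C(1) by (intro compact_UN) (auto simp: \<K>_def)
    show "K n \<subseteq> Q" unfolding K_def using C(1) by (intro UN_least) (auto simp: \<K>_def)
  qed
  have KK: "K n \<in> \<K>" for n using Kc by (simp add: \<K>_def)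
  have near: "sq (N L) (N (K n)) \<le> 1 / real (Suc n)" if L: "L \<in> \<K>" "K n \<subseteq> L" for L n
  proof -
    have "C n \<subseteq> K n" unfolding K_def by blast
    then have "0 \<le> E (K n) - E (C n)"
      using sqN[of "C n" "K n"] sq_nonneg[OF NE NE, of "K n" "C n"] C(1)[of n] Kc[of n]
      by (simp add: E_def \<K>_def)
    moreover have "sq (N L) (N (K n)) \<le> E L - E (K n)"
      using sqN[of "K n" L] L Kc[of n] by (simp add: E_def \<K>_def)
    ultimately show ?thesis using C(2)[of n] ET[OF L(1)] by linarith
  qed
  have Kmono: "K n \<subseteq> K m" if "n \<le> m" for n m unfolding K_def using that by (intro UN_mono) auto
  have dN: "strong_dist \<kappa> (N (K n)) (N L) \<le> sqrt (1 / real (Suc n))" if L: "L \<in> \<K>" "K n \<subseteq> L" for L n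
  proof -
    have "strong_dist \<kappa> (N (K n)) (N L) = strong_dist \<kappa> (N L) (N (K n))" by (rule M.commute)
    also have "\<dots> = sqrt (sq (N L) (N (K n)))"
      using L NE Kc by (intro strong_dist_eq) (auto simp: \<K>_def)
    also have "\<dots> \<le> sqrt (1 / real (Suc n))" using near[OF L] by (rule real_sqrt_le_mono)
    finally show ?thesis .
  qed
  have lim0: "(\<lambda>n. sqrt (1 / real (Suc n))) \<longlonglongrightarrow> 0"
    using tendsto_real_sqrt[OF LIMSEQ_inverse_real_of_nat] by (simp add: inverse_eq_divide)
  obtain \<nu> where \<nu>: "sconv (\<lambda>n. N (K n)) \<nu>"
  proof (rule strongly_complete[of "\<lambda>n. N (K n)"])
    show "N (K n) \<in> Eplus \<kappa>" for n using NE Kc by blast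
    fix e :: real assume "0 < e"
    then have "\<forall>\<^sub>F n in sequentially. sqrt (1 / real (Suc n)) < e" using lim0 by (intro order_tendstoD)
    then obtain M where "\<And>n. M \<le> n \<Longrightarrow> sqrt (1 / real (Suc n)) < e" unfolding eventually_sequentially by blast
    then show "\<exists>M. \<forall>n\<ge>M. \<forall>m\<ge>n. strong_dist \<kappa> (N (K n)) (N (K m)) < e"
      using dN[OF KK Kmono] by (intro exI[of _ M]) (auto intro: le_less_trans)
  qed
  have \<nu>E: "\<nu> \<in> Eplus \<kappa>" using \<nu> by (rule sconvD)
  \<comment> \<open>The limit inherits the bound by \<open>pot \<kappa> \<sigma>\<close> only in
    integrated form. Testing it on the part of \<open>\<nu>\<close> where the bound fails gives it
    a.e., and domination then gives it at every point.\<close>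
  have below: "ennreal (ip \<nu> \<mu>) \<le> (\<integral>\<^sup>+x. pot \<kappa> \<sigma> x \<partial>\<mu>)" if \<mu>: "\<mu> \<in> Eplus \<kappa>" for \<mu>
  proof (rule LIMSEQ_le_const2)
    show "(\<lambda>n. ennreal (ip (N (K n)) \<mu>)) \<longlonglongrightarrow> ennreal (ip \<nu> \<mu>)"
      by (intro tendsto_ennrealI sconv_ip \<nu> \<mu>)
    have "ennreal (ip (N (K n)) \<mu>) \<le> (\<integral>\<^sup>+x. pot \<kappa> \<sigma> x \<partial>\<mu>)" for n
      using N(4)[OF Kc[of n]] energy_pot_ip[OF \<mu> NE[OF Kc[of n]]]
      by (subst energy_pot_ip[OF \<mu> NE[OF Kc[of n]], symmetric]) (intro nn_integral_mono)
    then show "\<exists>M. \<forall>n\<ge>M. ennreal (ip (N (K n)) \<mu>) \<le> (\<integral>\<^sup>+x. pot \<kappa> \<sigma> x \<partial>\<mu>)" by blast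
  qed
  have m: "pot \<kappa> \<sigma> \<in> borel_measurable borel" "pot \<kappa> \<nu> \<in> borel_measurable borel" "sets \<nu> = sets borel"
    using \<sigma> \<nu>E by (auto intro: pot_measurable)
  note [measurable] = m(1,2)
  define B where "B = {x. pot \<kappa> \<sigma> x < pot \<kappa> \<nu> x}"
  have Bm: "B \<in> sets borel" unfolding B_def by measurable
  have rB: "restr B \<nu> \<in> Eplus \<kappa>" using restr_Eplus_on(1)[OF \<nu>E Bm] by (rule Eplus_onD)
  have "AE x in \<nu>. pot \<kappa> \<nu> x \<le> pot \<kappa> \<sigma> x"
    by (rule AE_le_of_restr[OF m(3,1,2) B_def]) (use below[OF rB] energy_pot_ip[OF rB \<nu>E] in simp_all)
  then have le: "pot \<kappa> \<nu> x \<le> pot \<kappa> \<sigma> x" for x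
    using dom \<nu>E \<sigma> unfolding domination_principle_def by blast
  have above: "(\<integral>\<^sup>+x. pot \<kappa> \<sigma> x \<partial>\<mu>) \<le> ennreal (ip \<nu> \<mu>)"
    if L: "compact L" "L \<subseteq> Q" and \<mu>: "\<mu> \<in> Eplus_on \<kappa> L" for L \<mu>
  proof (rule LIMSEQ_le_const)
    let ?L = "\<lambda>n. L \<union> K n"
    have LK: "?L n \<in> \<K>" "compact (?L n)" "?L n \<subseteq> Q" for n using L Kc by (auto simp: \<K>_def compact_Un)
    have "(\<lambda>n. strong_dist \<kappa> (N (?L n)) \<nu>) \<longlonglongrightarrow> 0"
    proof (rule tendsto_sandwich[OF _ _ tendsto_const])
      show "\<forall>\<^sub>F n in sequentially. 0 \<le> strong_dist \<kappa> (N (?L n)) \<nu>" by simp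
      have "strong_dist \<kappa> (N (?L n)) \<nu> \<le> sqrt (1 / real (Suc n)) + strong_dist \<kappa> (N (K n)) \<nu>" for n
        using M.triangle[of "N (?L n)" "N (K n)" \<nu>] dN[OF LK(1)[of n]] M.commute[of "N (?L n)" "N (K n)"]
          NE[OF LK(2,3)] NE[OF Kc] \<nu>E by force
      then show "\<forall>\<^sub>F n in sequentially. strong_dist \<kappa> (N (?L n)) \<nu>
          \<le> sqrt (1 / real (Suc n)) + strong_dist \<kappa> (N (K n)) \<nu>" by simp
      show "(\<lambda>n. sqrt (1 / real (Suc n)) + strong_dist \<kappa> (N (K n)) \<nu>) \<longlonglongrightarrow> 0"
        using tendsto_add[OF lim0, of "\<lambda>n. strong_dist \<kappa> (N (K n)) \<nu>" 0] \<nu> unfolding sconv_def by simp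
    qed
    then have "sconv (\<lambda>n. N (?L n)) \<nu>" using NE[OF LK(2,3)] \<nu>E by (simp add: sconv_def)
    then show "(\<lambda>n. ennreal (ip (N (?L n)) \<mu>)) \<longlonglongrightarrow> ennreal (ip \<nu> \<mu>)"
      by (intro tendsto_ennrealI sconv_ip Eplus_onD[OF \<mu>])
    have "(\<integral>\<^sup>+x. pot \<kappa> \<sigma> x \<partial>\<mu>) \<le> ennreal (ip (N (?L n)) \<mu>)" for n
      by (rule N(2)[OF LK(2,3) Eplus_on_mono[OF \<mu>]]) simp
    then show "\<exists>M. \<forall>n\<ge>M. (\<integral>\<^sup>+x. pot \<kappa> \<sigma> x \<partial>\<mu>) \<le> ennreal (ip (N (?L n)) \<mu>)" by blast
  qed
  have nev: "nearly_everywhere \<kappa> Q (\<lambda>x. pot \<kappa> \<nu> x = pot \<kappa> \<sigma> x)"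
    unfolding nearly_everywhere_iff
  proof (intro allI impI)
    fix L \<mu> assume L: "compact L" "L \<subseteq> {x\<in>Q. pot \<kappa> \<nu> x \<noteq> pot \<kappa> \<sigma> x}" and \<mu>: "\<mu> \<in> Eplus_on \<kappa> L"
    have LQ: "L \<subseteq> Q" using L(2) by blast
    have \<mu>E: "\<mu> \<in> Eplus \<kappa>" "AE x in \<mu>. x \<in> L" using \<mu> by (auto simp: Eplus_on_iff)
    note ab = above[OF L(1) LQ \<mu>]
    have "AE x in \<mu>. pot \<kappa> \<nu> x = pot \<kappa> \<sigma> x"
    proof (rule AE_eq_of_nn_integral[OF _ m(2,1)])
      show "(\<integral>\<^sup>+x. pot \<kappa> \<sigma> x \<partial>\<mu>) \<le> (\<integral>\<^sup>+x. pot \<kappa> \<nu> x \<partial>\<mu>)" using ab energy_pot_ip[OF \<mu>E(1) \<nu>E] by simp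
      show "(\<integral>\<^sup>+x. pot \<kappa> \<sigma> x \<partial>\<mu>) < \<infinity>" using ab by (auto simp: le_less_trans)
    qed (use \<mu>E le in auto)
    with \<mu>E(2) have "AE x in \<mu>. False" by eventually_elim (use L(2) in blast)
    then have "\<mu> \<in> Eplus_on \<kappa> {}" using \<mu>E(1) by (simp add: Eplus_on_iff)
    then show "emeasure \<mu> UNIV = 0" by (simp add: Eplus_on_borel)
  qed
  have "N (K n) \<in> Eplus_on \<kappa> (\<Union>n. K n)" for n
    by (rule Eplus_on_mono[OF N(1)[OF Kc]]) blast
  then have "\<nu> \<in> Eclosed_on \<kappa> (\<Union>n. K n)" using \<nu> unfolding Eclosed_on_iff
    by (intro exI[of _ "\<lambda>n. N (K n)"]) simp
  then show thesis using that[of K \<nu>] Kc le nev by blast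
qed

text \<open>For finite energy the bound on the compact sweeps is Cauchy-Schwarz: the squared norm of
  \<open>\<nu>\<close> equals \<open>ip \<theta> \<nu>\<close>, so its norm is at most that of
  \<open>\<theta>\<close>.\<close>

lemma swept_exists:
  assumes t: "\<theta> \<in> Eplus \<kappa>"
  obtains \<nu> where "\<nu> \<in> Eclosed_on \<kappa> Q" "\<And>x. pot \<kappa> \<nu> x \<le> pot \<kappa> \<theta> x"
    "nearly_everywhere \<kappa> Q (\<lambda>x. pot \<kappa> \<nu> x = pot \<kappa> \<theta> x)"
proof -
  have bnd: "ip \<nu> \<nu> \<le> ip \<theta> \<theta>" if \<nu>: "\<nu> \<in> Eplus_on \<kappa> K"
    and e: "(\<integral>\<^sup>+x. pot \<kappa> \<theta> x \<partial>\<nu>) = ennreal (ip \<nu> \<nu>)" for K \<nu>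
  proof -
    have E: "\<nu> \<in> Eplus \<kappa>" using \<nu> by (rule Eplus_onD)
    have "ip \<nu> \<nu> = ip \<theta> \<nu>" using e energy_pot_ip[OF E t] by simp
    also have "\<dots> \<le> sqrt (ip \<theta> \<theta>) * sqrt (ip \<nu> \<nu>)" by (rule ip_Cauchy_Schwarz[OF t E])
    finally have "sqrt (ip \<nu> \<nu>) * sqrt (ip \<nu> \<nu>) \<le> sqrt (ip \<theta> \<theta>) * sqrt (ip \<nu> \<nu>)" by simp
    then have le: "sqrt (ip \<nu> \<nu>) * sqrt (ip \<nu> \<nu>) \<le> sqrt (ip \<theta> \<theta>) * sqrt (ip \<nu> \<nu>)" .
    have "sqrt (ip \<nu> \<nu>) \<le> sqrt (ip \<theta> \<theta>)"
    proof (cases "ip \<nu> \<nu> = 0")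
      case False
      then have "0 < sqrt (ip \<nu> \<nu>)" by (simp add: less_le)
      with le show ?thesis by (rule mult_right_le_imp_le)
    qed simp
    then show ?thesis by simp
  qed
  obtain K \<nu> where K: "\<And>n::nat. compact (K n)" "\<And>n. K n \<subseteq> Q" and \<nu>: "\<nu> \<in> Eclosed_on \<kappa> (\<Union>n. K n)"
    "\<And>x. pot \<kappa> \<nu> x \<le> pot \<kappa> \<theta> x" "nearly_everywhere \<kappa> Q (\<lambda>x. pot \<kappa> \<nu> x = pot \<kappa> \<theta> x)"
  proof (rule sweep[OF Eplus_radon[OF t], of Q "ip \<theta> \<theta>"])
    show "admissible K (pot \<kappa> \<theta>)" for K by (rule admissible_pot[OF t])
    show "ip \<nu> \<nu> \<le> ip \<theta> \<theta>" if "\<nu> \<in> Eplus_on \<kappa> K" "(\<integral>\<^sup>+x. pot \<kappa> \<theta> x \<partial>\<nu>) = ennreal (ip \<nu> \<nu>)" for K \<nu>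
      using that by (rule bnd)
  qed (rule that)
  have "\<nu> \<in> Eclosed_on \<kappa> Q" using \<nu>(1) by (rule Eclosed_on_mono) (rule UN_least[OF K(2)])
  then show thesis using \<nu>(2,3) by (rule that)
qed

text \<open>Since \<open>\<mu>\<close> need not be concentrated on \<open>Q\<close>, the equality
  n.e. is integrated against approximating measures on \<open>Q\<close> and carried to the limit by
  strong continuity of \<open>ip\<close>.\<close>

lemma nearly_everywhere_ip:
  assumes n: "\<nu> \<in> Eplus \<kappa>" and t: "\<theta> \<in> Eplus \<kappa>"
    and ne: "nearly_everywhere \<kappa> Q (\<lambda>x. pot \<kappa> \<nu> x = pot \<kappa> \<theta> x)" and \<mu>: "\<mu> \<in> Eclosed_on \<kappa> Q"
  shows "ip \<nu> \<mu> = ip \<theta> \<mu>"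
proof -
  have [measurable]: "pot \<kappa> \<nu> \<in> borel_measurable borel" "pot \<kappa> \<theta> \<in> borel_measurable borel"
    using n t by (auto intro: pot_measurable)
  have Pm: "{x. pot \<kappa> \<nu> x = pot \<kappa> \<theta> x} \<in> sets borel" by measurable
  have on: "ip \<nu> \<rho> = ip \<theta> \<rho>" if "\<rho> \<in> Eplus_on \<kappa> Q" for \<rho>
  proof -
    have "AE x in \<rho>. pot \<kappa> \<nu> x = pot \<kappa> \<theta> x" by (rule nearly_everywhere_AE[OF ne Pm that])
    then have "(\<integral>\<^sup>+x. pot \<kappa> \<nu> x \<partial>\<rho>) = (\<integral>\<^sup>+x. pot \<kappa> \<theta> x \<partial>\<rho>)" by (rule nn_integral_cong_AE)
    then show ?thesis using energy_pot_ip[OF Eplus_onD[OF that]] n t by simp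
  qed
  obtain s where s: "\<And>n. s n \<in> Eplus_on \<kappa> Q" "sconv s \<mu>" using \<mu> unfolding Eclosed_on_iff by blast
  have \<mu>E: "\<mu> \<in> Eplus \<kappa>" using s(2) by (rule sconvD)
  have "ip (s k) \<nu> = ip (s k) \<theta>" for k
    using on[OF s(1)[of k]] Eplus_onD[OF s(1)[of k]] n t by (simp add: ip_sym)
  then have "ip \<mu> \<nu> = ip \<mu> \<theta>" using sconv_ip[OF s(2) n] sconv_ip[OF s(2) t] LIMSEQ_unique by simp
  then show ?thesis using \<mu>E n t by (simp add: ip_sym)
qed

lemma Eplus_eqI:
  assumes "\<mu> \<in> Eplus \<kappa>" "\<nu> \<in> Eplus \<kappa>" "ip \<mu> \<mu> = ip \<nu> \<mu>" "ip \<mu> \<nu> = ip \<nu> \<nu>"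
  shows "\<mu> = \<nu>"
  using assms by (intro ip_definite) (simp_all add: ip_sym)

lemma swept_unique:
  assumes t: "\<theta> \<in> Eplus \<kappa>"
    and a: "\<mu> \<in> Eclosed_on \<kappa> Q" "nearly_everywhere \<kappa> Q (\<lambda>x. pot \<kappa> \<mu> x = pot \<kappa> \<theta> x)"
    and b: "\<nu> \<in> Eclosed_on \<kappa> Q" "nearly_everywhere \<kappa> Q (\<lambda>x. pot \<kappa> \<nu> x = pot \<kappa> \<theta> x)"
  shows "\<mu> = \<nu>"
proof -
  have E: "\<mu> \<in> Eplus \<kappa>" "\<nu> \<in> Eplus \<kappa>" using a(1) b(1) by (simp_all add: Eclosed_on_Eplus)
  note i = nearly_everywhere_ip[OF E(1) t a(2)] nearly_everywhere_ip[OF E(2) t b(2)]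
  show ?thesis by (rule Eplus_eqI[OF E]) (simp_all add: i a(1) b(1))
qed

lemma inner_swept_props:
  assumes t: "\<theta> \<in> Eplus \<kappa>"
  shows "inner_swept \<kappa> Q \<theta> \<in> Eclosed_on \<kappa> Q"
    "nearly_everywhere \<kappa> Q (\<lambda>x. pot \<kappa> (inner_swept \<kappa> Q \<theta>) x = pot \<kappa> \<theta> x)"
    "pot \<kappa> (inner_swept \<kappa> Q \<theta>) x \<le> pot \<kappa> \<theta> x"
proof -
  obtain \<nu> where \<nu>: "\<nu> \<in> Eclosed_on \<kappa> Q" "\<And>x. pot \<kappa> \<nu> x \<le> pot \<kappa> \<theta> x"
    "nearly_everywhere \<kappa> Q (\<lambda>x. pot \<kappa> \<nu> x = pot \<kappa> \<theta> x)"
    by (rule swept_exists[OF t]) (rule that)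
  have "inner_swept \<kappa> Q \<theta> = \<nu>"
    unfolding inner_swept_def using \<nu>(1,3) swept_unique[OF t] by (intro the_equality) auto
  then show "inner_swept \<kappa> Q \<theta> \<in> Eclosed_on \<kappa> Q"
    "nearly_everywhere \<kappa> Q (\<lambda>x. pot \<kappa> (inner_swept \<kappa> Q \<theta>) x = pot \<kappa> \<theta> x)"
    "pot \<kappa> (inner_swept \<kappa> Q \<theta>) x \<le> pot \<kappa> \<theta> x" using \<nu> by simp_all
qed

section \<open>Balayage of measures of possibly infinite energy\<close>

lemma inner_balayage_unique:
  assumes "is_inner_balayage \<kappa> Q \<omega> \<mu>" "is_inner_balayage \<kappa> Q \<omega> \<nu>" shows "\<mu> = \<nu>"
proof -
  have E: "\<mu> \<in> Eplus \<kappa>" "\<nu> \<in> Eplus \<kappa>" using assms unfolding is_inner_balayage_def by (blast intro: Eclosed_on_Eplus)+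
  have "energy \<kappa> \<mu> \<theta> = energy \<kappa> \<nu> \<theta>" if "\<theta> \<in> Eplus \<kappa>" for \<theta>
    using assms that by (simp add: is_inner_balayage_def)
  then have "ip \<mu> \<theta> = ip \<nu> \<theta>" if "\<theta> \<in> Eplus \<kappa>" for \<theta> using that by (simp add: ip_def)
  then show ?thesis using E by (intro Eplus_eqI) auto
qed

text \<open>Allowing any \<open>Q \<subseteq> A\<close> lets one \<open>\<nu>\<close> be recognized
  as the balayage to \<open>A\<close> and to a smaller set. If \<tau> sweeps \<theta> onto
  \<open>Q\<close>, then \<open>ip \<tau> \<nu> = ip \<theta> \<nu>\<close>, and it remains to see
  that the integral of \<open>pot \<kappa> \<omega>\<close> against \<tau> is
  \<open>ip \<tau> \<nu>\<close>: it is at most that by lower semicontinuity along measures on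
  \<open>Q\<close>, and at least that by \<open>le\<close>.\<close>

lemma is_inner_balayageI:
  assumes \<omega>: "\<omega> \<in> radon" and \<nu>: "\<nu> \<in> Eclosed_on \<kappa> Q" and QA: "Q \<subseteq> A"
    and le: "\<And>x. pot \<kappa> \<nu> x \<le> pot \<kappa> \<omega> x"
    and ne: "nearly_everywhere \<kappa> A (\<lambda>x. pot \<kappa> \<nu> x = pot \<kappa> \<omega> x)"
  shows "is_inner_balayage \<kappa> Q \<omega> \<nu>"
  unfolding is_inner_balayage_def
proof (intro conjI \<nu> ballI)
  fix \<theta> assume t: "\<theta> \<in> Eplus \<kappa>"
  define \<tau> where "\<tau> = inner_swept \<kappa> Q \<theta>"
  have \<tau>: "\<tau> \<in> Eclosed_on \<kappa> Q" "nearly_everywhere \<kappa> Q (\<lambda>x. pot \<kappa> \<tau> x = pot \<kappa> \<theta> x)"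
    unfolding \<tau>_def by (rule inner_swept_props[OF t])+
  have E: "\<nu> \<in> Eplus \<kappa>" "\<tau> \<in> Eplus \<kappa>" using \<nu> \<tau>(1) by (simp_all add: Eclosed_on_Eplus)
  have [measurable]: "pot \<kappa> \<nu> \<in> borel_measurable borel" "pot \<kappa> \<omega> \<in> borel_measurable borel"
    using E \<omega> by (auto intro: pot_measurable)
  have Pm: "{x. pot \<kappa> \<nu> x = pot \<kappa> \<omega> x} \<in> sets borel" by measurable
  obtain s where s: "\<And>n. s n \<in> Eplus_on \<kappa> Q" "sconv s \<tau>" using \<tau>(1) unfolding Eclosed_on_iff by blast
  have on: "(\<integral>\<^sup>+x. pot \<kappa> \<omega> x \<partial>s n) = ennreal (ip (s n) \<nu>)" for n
  proof -
    have "AE x in s n. pot \<kappa> \<nu> x = pot \<kappa> \<omega> x"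
      by (rule nearly_everywhere_AE[OF ne Pm Eplus_on_mono[OF s(1) QA]])
    then have "(\<integral>\<^sup>+x. pot \<kappa> \<nu> x \<partial>s n) = (\<integral>\<^sup>+x. pot \<kappa> \<omega> x \<partial>s n)" by (rule nn_integral_cong_AE)
    then show ?thesis using energy_pot_ip[OF Eplus_onD[OF s(1)] E(1)] Eplus_onD[OF s(1)] E(1) by (simp add: ip_sym)
  qed
  have "(\<integral>\<^sup>+x. pot \<kappa> \<omega> x \<partial>\<tau>) \<le> liminf (\<lambda>n. \<integral>\<^sup>+x. pot \<kappa> \<omega> x \<partial>s n)"
    by (rule sconv_lsc_liminf[OF s(2) pot_lsc[OF \<omega>]])
  also have "\<dots> = ennreal (ip \<tau> \<nu>)"
    unfolding on by (intro lim_imp_Liminf tendsto_ennrealI sconv_ip s(2) E(1)) simp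
  finally have 1: "(\<integral>\<^sup>+x. pot \<kappa> \<omega> x \<partial>\<tau>) \<le> ennreal (ip \<tau> \<nu>)" .
  have "ennreal (ip \<tau> \<nu>) = (\<integral>\<^sup>+x. pot \<kappa> \<nu> x \<partial>\<tau>)" using energy_pot_ip[OF E(2,1)] E by (simp add: ip_sym)
  also have "\<dots> \<le> (\<integral>\<^sup>+x. pot \<kappa> \<omega> x \<partial>\<tau>)" by (intro nn_integral_mono le)
  finally have "(\<integral>\<^sup>+x. pot \<kappa> \<omega> x \<partial>\<tau>) = ennreal (ip \<tau> \<nu>)" using 1 by simp
  also have "ip \<tau> \<nu> = ip \<theta> \<nu>" by (rule nearly_everywhere_ip[OF E(2) t \<tau>(2) \<nu>])
  also have "ennreal (ip \<theta> \<nu>) = energy \<kappa> \<nu> \<theta>" using t E(1) by (simp add: energy_ip ip_sym)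
  finally show "energy \<kappa> \<nu> \<theta> = energy \<kappa> (inner_swept \<kappa> Q \<theta>) \<omega>"
    using E(2) \<omega> by (simp add: energy_eq_pot flip: \<tau>_def)
qed

text \<open>A form of "outer capacity zero" for which countable subadditivity is immediate.\<close>

definition thin :: "'a set \<Rightarrow> bool" where
  "thin N \<longleftrightarrow> (\<forall>e::real>0. \<exists>D. open D \<and> N \<subseteq> D \<and>
     (\<forall>\<mu>\<in>Eplus \<kappa>. emeasure \<mu> D \<le> ennreal (e * sqrt (ip \<mu> \<mu>))))"

lemma thin_subset: "thin N \<Longrightarrow> M \<subseteq> N \<Longrightarrow> thin M"
  unfolding thin_def by (metis order_trans)

lemma thin_UN:
  assumes "\<And>n::nat. thin (N n)" shows "thin (\<Union>n. N n)"
  unfolding thin_def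
proof (intro allI impI)
  fix e :: real assume e: "0 < e"
  \<comment> \<open>The shares \<open>(1/2) ^ Suc n\<close> of the tolerance sum to 1.\<close>
  have "\<exists>D. open D \<and> N n \<subseteq> D \<and> (\<forall>\<mu>\<in>Eplus \<kappa>. emeasure \<mu> D \<le> ennreal (e * (1/2) ^ Suc n * sqrt (ip \<mu> \<mu>)))" for n
    by (rule assms[of n, unfolded thin_def, rule_format]) (use e in simp)
  then obtain D where D: "\<And>n. open (D n)" "\<And>n. N n \<subseteq> D n"
    "\<And>n \<mu>. \<mu> \<in> Eplus \<kappa> \<Longrightarrow> emeasure \<mu> (D n) \<le> ennreal (e * (1/2) ^ Suc n * sqrt (ip \<mu> \<mu>))" by metis
  show "\<exists>D. open D \<and> (\<Union>n. N n) \<subseteq> D \<and> (\<forall>\<mu>\<in>Eplus \<kappa>. emeasure \<mu> D \<le> ennreal (e * sqrt (ip \<mu> \<mu>)))"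
  proof (intro exI[of _ "\<Union>n. D n"] conjI ballI)
    show "open (\<Union>n. D n)" using D(1) by (intro open_UN) auto
    show "(\<Union>n. N n) \<subseteq> (\<Union>n. D n)" using D(2) by (intro UN_mono) auto
    fix \<mu> assume \<mu>: "\<mu> \<in> Eplus \<kappa>"
    have "emeasure \<mu> (\<Union>n. D n) \<le> (\<Sum>n. emeasure \<mu> (D n))"
      using D(1) \<mu> by (intro emeasure_subadditive_countably) auto
    also have "\<dots> \<le> (\<Sum>n. ennreal (e * (1/2) ^ Suc n * sqrt (ip \<mu> \<mu>)))" by (intro suminf_le D(3) \<mu>) auto
    also have "\<dots> = ennreal (e * sqrt (ip \<mu> \<mu>))"
    proof (rule suminf_ennreal_eq)
      show "(\<lambda>n. e * (1/2) ^ Suc n * sqrt (ip \<mu> \<mu>)) sums (e * sqrt (ip \<mu> \<mu>))"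
        using sums_mult[OF power_half_series, of "e * sqrt (ip \<mu> \<mu>)"] by (simp add: mult_ac)
    qed (use e in simp)
    finally show "emeasure \<mu> (\<Union>n. D n) \<le> ennreal (e * sqrt (ip \<mu> \<mu>))" .
  qed
qed

text \<open>With tolerance \<open>sqrt e\<close>, every unit measure on a compact subset of
  \<open>D\<close> has norm at least \<open>1 / sqrt e\<close>, hence energy at least
  \<open>1 / e\<close>, and the capacity of the subset is at most \<open>e\<close>.\<close>

lemma thin_outer_cap:
  assumes "thin N" shows "outer_cap \<kappa> N = 0"
proof -
  have "outer_cap \<kappa> N \<le> 0"
  proof (rule ennreal_le_epsilon)
    fix e :: real assume e: "0 < e"
    then have "0 < sqrt e" by simp
    from assms[unfolded thin_def, rule_format, OF this]
    obtain D where D: "open D" "N \<subseteq> D" "\<forall>\<mu>\<in>Eplus \<kappa>. emeasure \<mu> D \<le> ennreal (sqrt e * sqrt (ip \<mu> \<mu>))"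
      by (elim exE conjE)
    have "inner_cap \<kappa> D \<le> ennreal e"
      unfolding inner_cap_def
    proof (rule SUP_least)
      fix K assume "K \<in> {K. compact K \<and> K \<subseteq> D}"
      then have K: "compact K" "K \<subseteq> D" by auto
      define I where "I = (INF \<mu>\<in>{\<mu>\<in>radon. meas_supp \<mu> \<subseteq> K \<and> emeasure \<mu> UNIV = 1}. energy \<kappa> \<mu> \<mu>)"
      have I: "ennreal (1 / e) \<le> I"
        unfolding I_def
      proof (rule INF_greatest)
        fix \<mu> assume "\<mu> \<in> {\<mu>\<in>radon. meas_supp \<mu> \<subseteq> K \<and> emeasure \<mu> UNIV = 1}"
        then have \<mu>: "\<mu> \<in> radon" "meas_supp \<mu> \<subseteq> K" "emeasure \<mu> UNIV = 1" by auto
        show "ennreal (1 / e) \<le> energy \<kappa> \<mu> \<mu>"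
        proof (cases "energy \<kappa> \<mu> \<mu> < \<infinity>")
          case True
          then have E: "\<mu> \<in> Eplus \<kappa>" using \<mu>(1) by (rule EplusI[rotated])
          have s: "D \<in> sets \<mu>" "- D \<in> sets \<mu>" using D(1) E by auto
          have "emeasure \<mu> (- D) = 0"
            using \<mu>(2) K(2) by (intro emeasure_Compl_meas_supp[OF Eplus_sets[OF E]]) auto
          then have "emeasure \<mu> D = 1"
            using plus_emeasure[OF s] \<mu>(3) by (simp add: Compl_partition)
          then have "ennreal 1 \<le> ennreal (sqrt e * sqrt (ip \<mu> \<mu>))" using D(3)[rule_format, OF E] by simp
          then have "1 \<le> sqrt (e * ip \<mu> \<mu>)" using e by (simp add: ennreal_le_iff2 real_sqrt_mult del: ennreal_1)
          then have "1 / e \<le> ip \<mu> \<mu>" using e by (simp add: field_simps)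
          then show ?thesis using E by (simp add: energy_ip ennreal_leI)
        qed (simp add: less_top[symmetric])
      qed
      have "ennreal 1 = ennreal e * ennreal (1 / e)" using e by (simp flip: ennreal_mult)
      also have "\<dots> \<le> ennreal e * I" using I by (rule mult_left_mono) simp
      finally have "1 \<le> ennreal e * I" by simp
      moreover have "0 < ennreal (1 / e)" using e by simp
      then have "0 < I" using I by (rule less_le_trans)
      ultimately show "cap \<kappa> K \<le> ennreal e"
        unfolding cap_def I_def[symmetric] by (intro divide_le_posI_ennreal) (simp_all add: mult.commute)
    qed
    moreover have "outer_cap \<kappa> N \<le> inner_cap \<kappa> D" unfolding outer_cap_def using D by (intro INF_lower) auto
    ultimately show "outer_cap \<kappa> N \<le> 0 + ennreal e" by simp
  qed
  then show ?thesis by simp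
qed

text \<open>Otherwise each neighbourhood \<open>D n\<close> of \<open>C\<close> carries a unit
  measure of energy at most \<open>1 / e\<^sup>2\<close>. Almost minimizers over these shrinking
  neighbourhoods converge strongly; their limit sits on \<open>C\<close>, and by vague convergence
  inside a fixed compact set it is not zero, against \<open>null\<close>.\<close>

lemma compact_null_thin:
  assumes C: "compact C" and null: "\<And>\<mu>. \<mu> \<in> Eplus_on \<kappa> C \<Longrightarrow> emeasure \<mu> UNIV = 0"
  shows "thin C"
proof (rule ccontr)
  assume "\<not> thin C"
  then obtain e :: real where e: "0 < e" "\<And>D. open D \<Longrightarrow> C \<subseteq> D \<Longrightarrow>
      \<exists>\<mu>\<in>Eplus \<kappa>. \<not> emeasure \<mu> D \<le> ennreal (e * sqrt (ip \<mu> \<mu>))"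
    unfolding thin_def by meson
  obtain V L where VL: "open V" "compact L" "C \<subseteq> V" "V \<subseteq> L"
    by (rule compact_neighbourhood[OF lc C open_UNIV subset_UNIV]) (rule that)
  have oC: "open (- C)" using C by (simp add: compact_imp_closed open_Compl)
  obtain F :: "nat \<Rightarrow> 'a set" where F: "\<And>n. compact (F n)" "\<And>n. F n \<subseteq> interior (F (Suc n))"
    "(\<Union>n. F n) = - C" "incseq F"
    by (rule compact_exhaustion[OF lc oC]) (rule that)
  \<comment> \<open>Staying inside \<open>V\<close>, hence inside the compact \<open>L\<close>,
    prevents mass from escaping; removing an exhaustion of the complement makes the neighbourhoods
    shrink to \<open>C\<close>.\<close>
  define D where "D n = V - F n" for n
  have D: "open (D n)" "C \<subseteq> D n" "D n \<subseteq> L" "D n \<in> sets borel" for n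
  proof -
    show o: "open (D n)" unfolding D_def using VL(1) F(1) by (simp add: open_Diff compact_imp_closed)
    then show "D n \<in> sets borel" by simp
    have "F n \<subseteq> - C" using F(3) by (metis UN_upper UNIV_I)
    then show "C \<subseteq> D n" unfolding D_def using VL(3) by blast
    show "D n \<subseteq> L" unfolding D_def using VL(4) by blast
  qed
  define S where "S n = {\<mu> \<in> Eplus \<kappa>. emeasure \<mu> (- D n) = 0 \<and> emeasure \<mu> UNIV = 1}" for n
  have sub: "S n \<subseteq> Eplus \<kappa>" for n by (auto simp: S_def)
  have dec: "decseq S"
  proof (rule decseq_SucI)
    fix n
    have "D (Suc n) \<subseteq> D n" unfolding D_def using F(4) by (auto simp: incseq_Suc_iff)
    then have "emeasure \<mu> (- D n) \<le> emeasure \<mu> (- D (Suc n))" if "\<mu> \<in> Eplus \<kappa>" for \<mu>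
      using that D(4) by (intro emeasure_mono) auto
    then show "S (Suc n) \<subseteq> S n" unfolding S_def by fastforce
  qed
  have midS: "mid \<mu> \<nu> \<in> S n" if "\<mu> \<in> S n" "\<nu> \<in> S n" for \<mu> \<nu> n
  proof -
    have E: "\<mu> \<in> Eplus \<kappa>" "\<nu> \<in> Eplus \<kappa>" using that by (auto simp: S_def)
    have "emeasure (mid \<mu> \<nu>) UNIV = ennreal (1/2) * (ennreal 1 + ennreal 1)"
      unfolding mid_def using that E by (simp add: S_def emeasure_madd del: ennreal_1) simp
    also have "ennreal 1 + ennreal 1 = ennreal 2" by (subst ennreal_plus[symmetric]) auto
    also have "ennreal (1/2) * ennreal 2 = ennreal (1/2 * 2)" by (rule ennreal_mult[symmetric]) auto
    also have "\<dots> = 1" by simp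
    finally show ?thesis using that E D(4) ip_mid(1)[OF E]
      by (simp add: S_def mid_def emeasure_madd)
  qed
  have upper: "\<exists>\<mu>\<in>S n. ip \<mu> \<mu> \<le> 1 / e\<^sup>2" for n
  proof -
    obtain \<mu> where \<mu>: "\<mu> \<in> Eplus \<kappa>" "\<not> emeasure \<mu> (D n) \<le> ennreal (e * sqrt (ip \<mu> \<mu>))"
      using e(2)[OF D(1,2)] by blast
    note r = restr_Eplus_on[OF \<mu>(1) D(4)[of n]]
    have "emeasure \<mu> (D n) \<le> emeasure \<mu> L" using D(3) compact_borel[OF VL(2)] \<mu>(1) by (intro emeasure_mono) auto
    also have "\<dots> < \<infinity>" by (rule radon_compact_finite[OF Eplus_radon[OF \<mu>(1)] VL(2)])
    finally obtain a where a: "emeasure \<mu> (D n) = ennreal a" "0 \<le> a" by (cases "emeasure \<mu> (D n)") auto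
    have a1: "e * sqrt (ip \<mu> \<mu>) < a" using \<mu>(2) a e(1) by (simp add: not_le ennreal_less_iff)
    have "0 \<le> e * sqrt (ip \<mu> \<mu>)" using e(1) by simp
    then have a0: "0 < a" using a1 by (rule le_less_trans)
    \<comment> \<open>Restriction to \<open>D n\<close> does not raise the energy and keeps the mass
      \<open>a\<close>; division by \<open>a\<close> turns the failed estimate into the energy bound
      \<open>1 / e\<^sup>2\<close>.\<close>
    define \<rho> where "\<rho> = scale_measure (ennreal (1/a)) (restr (D n) \<mu>)"
    have rE: "restr (D n) \<mu> \<in> Eplus \<kappa>" using r(1) by (rule Eplus_onD)
    have "ip (restr (D n) \<mu>) (restr (D n) \<mu>) \<le> ip \<mu> \<mu>" using r(2) rE \<mu>(1) by (simp add: energy_ip)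
    then have ipr: "ip \<rho> \<rho> \<le> ip \<mu> \<mu> / a\<^sup>2"
      unfolding \<rho>_def using rE a0 by (simp add: ip_scale power2_eq_square divide_right_mono)
    have "(e * sqrt (ip \<mu> \<mu>))\<^sup>2 \<le> a\<^sup>2" using a1 e(1) by (intro power_mono) auto
    then have "ip \<mu> \<mu> / a\<^sup>2 \<le> 1 / e\<^sup>2" using e(1) a0 by (simp add: power_mult_distrib field_simps)
    with ipr have "ip \<rho> \<rho> \<le> 1 / e\<^sup>2" by simp
    moreover have "\<rho> \<in> S n"
    proof -
      have "\<rho> \<in> Eplus_on \<kappa> (D n)" unfolding \<rho>_def by (rule Eplus_on_scale[OF r(1) D(4)])
      moreover have "emeasure \<rho> UNIV = ennreal (1/a) * ennreal a"
        unfolding \<rho>_def using emeasure_restr[of \<mu> "D n" UNIV] \<mu>(1) D(4) a by simp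
      then have "emeasure \<rho> UNIV = 1" using a0 by (simp flip: ennreal_mult)
      ultimately show ?thesis by (simp add: S_def Eplus_on_borel D(4))
    qed
    ultimately show ?thesis by blast
  qed
  \<comment> \<open>Without a linear term \<open>J\<close> is the energy itself, bounded below by
    0.\<close>
  obtain s \<mu> where s: "sconv s \<mu>" "\<And>n. s n \<in> S n"
    by (rule nested_minimizers[of "\<lambda>\<mu>. ip \<mu> \<mu>" "\<lambda>_. 0" S 0 "1 / e\<^sup>2"]) (use sub dec midS upper in auto)
  have \<mu>E: "\<mu> \<in> Eplus \<kappa>" using s(1) by (rule sconvD)
  \<comment> \<open>The interior of \<open>F (Suc j)\<close> misses \<open>D n\<close> for every
    \<open>n > j\<close>, so the limit vanishes on all of the complement of
    \<open>C\<close>.\<close>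
  have "emeasure \<mu> (F j) = 0" for j
  proof (rule sconv_compact_null[OF s(1) F(1)])
    show "open (interior (F (Suc j)))" "F j \<subseteq> interior (F (Suc j))" using F(2) by auto
    show "\<forall>\<^sub>F n in sequentially. emeasure (s n) (interior (F (Suc j))) = 0"
      using eventually_ge_at_top[of "Suc j"]
    proof eventually_elim
      case (elim n)
      have "interior (F (Suc j)) \<subseteq> F n" using interior_subset[of "F (Suc j)"] F(4) elim by (auto simp: incseq_def)
      then have "interior (F (Suc j)) \<subseteq> - D n" unfolding D_def by blast
      then have "emeasure (s n) (interior (F (Suc j))) \<le> emeasure (s n) (- D n)"
        using s(2)[of n] D(4)[of n] by (intro emeasure_mono) (auto simp: S_def)
      then show ?case using s(2)[of n] by (simp add: S_def)
    qed
  qed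
  then have "emeasure \<mu> (\<Union>j. F j) = 0" using F(1) \<mu>E by (intro emeasure_UN_eq_0) (auto simp: compact_borel)
  then have "\<mu> \<in> Eplus_on \<kappa> C" using \<mu>E F(3) C by (simp add: Eplus_on_borel compact_borel)
  then have m0: "emeasure \<mu> UNIV = 0" by (rule null)
  obtain f where f: "continuous_on UNIV f" "compact (closure {x. f x \<noteq> 0})"
    "\<And>x. 0 \<le> f x" "\<And>x. f x \<le> 1" "\<And>x. x \<in> L \<Longrightarrow> f x = (1::real)" "\<And>x. x \<notin> UNIV \<Longrightarrow> f x = 0"
    by (rule compact_bump[OF lc VL(2) open_UNIV subset_UNIV]) (rule that)
  have "(\<integral>x. f x \<partial>s n) = 1" for n
  proof -
    have E: "s n \<in> Eplus \<kappa>" "emeasure (s n) (- D n) = 0" "emeasure (s n) UNIV = 1" using s(2)[of n] by (auto simp: S_def)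
    then have "AE x in s n. x \<in> D n" using Eplus_on_borel[OF D(4)] Eplus_on_iff by blast
    then have "AE x in s n. f x = 1" by eventually_elim (use f(5) D(3) in blast)
    moreover have "f \<in> borel_measurable (s n)"
      using borel_measurable_continuous_onI[OF f(1)] E by (simp cong: measurable_cong_sets)
    ultimately have "(\<integral>x. f x \<partial>s n) = (\<integral>x. 1 \<partial>s n)" by (intro integral_cong_AE) auto
    also have "\<dots> = 1" using E(3) space_radon[OF Eplus_radon[OF E(1)]] by (simp add: measure_def)
    finally show ?thesis .
  qed
  then have "(\<lambda>n. 1::real) \<longlonglongrightarrow> (\<integral>x. f x \<partial>\<mu>)" using sconv_vague[OF s(1) f(1,2)] by simp
  moreover have "(\<integral>x. f x \<partial>\<mu>) = 0"
    using m0 \<mu>E by (intro integral_eq_zero_AE AE_I[of _ _ UNIV]) auto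
  ultimately show False by (simp add: LIMSEQ_const_iff)
qed

text \<open>The exceptional set \<open>{U\<^sup>\<nu> < U\<^sup>\<theta>}\<close> is a union of the sets \<open>{U\<^sup>\<nu> \<le> q} \<inter> {U\<^sup>\<theta> > q}\<close>, \<open>q\<close> rational,
  where lower semicontinuity makes the first set closed and the second one open, hence \<open>\<sigma>\<close>-compact.\<close>

lemma nearly_everywhere_imp_quasi_everywhere:
  assumes \<nu>: "\<nu> \<in> radon" and t: "\<theta> \<in> radon" and le: "\<And>x. pot \<kappa> \<nu> x \<le> pot \<kappa> \<theta> x"
    and K: "\<And>n::nat. compact (K n)"
    and ne: "nearly_everywhere \<kappa> (\<Union>n. K n) (\<lambda>x. pot \<kappa> \<nu> x = pot \<kappa> \<theta> x)"
  shows "quasi_everywhere \<kappa> (\<Union>n. K n) (\<lambda>x. pot \<kappa> \<nu> x = pot \<kappa> \<theta> x)"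
proof -
  define q where "q k = ennreal (real_of_rat (nat_to_rat_surj k))" for k
  have "\<exists>F :: nat \<Rightarrow> 'a set. (\<forall>i. compact (F i)) \<and> (\<Union>i. F i) = {x. q k < pot \<kappa> \<theta> x}" for k
  proof -
    obtain F :: "nat \<Rightarrow> 'a set" where "\<And>n. compact (F n)" "\<And>n. F n \<subseteq> interior (F (Suc n))"
      "(\<Union>n. F n) = {x. q k < pot \<kappa> \<theta> x}" "incseq F"
      by (rule compact_exhaustion[OF lc pot_lsc[OF t]]) (rule that)
    then show ?thesis by blast
  qed
  then obtain F :: "nat \<Rightarrow> nat \<Rightarrow> 'a set" where F: "\<And>k i. compact (F k i)" "\<And>k. (\<Union>i. F k i) = {x. q k < pot \<kappa> \<theta> x}"
    by metis
  let ?N = "{x \<in> (\<Union>n. K n). \<not> pot \<kappa> \<nu> x = pot \<kappa> \<theta> x}"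
  define C where "C n k i = K n \<inter> F k i \<inter> {x. pot \<kappa> \<nu> x \<le> q k}" for n k i
  have "thin (C n k i)" for n k i
  proof (rule compact_null_thin)
    have "- {x. pot \<kappa> \<nu> x \<le> q k} = {x. q k < pot \<kappa> \<nu> x}" by auto
    then have "closed {x. pot \<kappa> \<nu> x \<le> q k}" using pot_lsc[OF \<nu>] by (simp add: closed_def)
    then show c: "compact (C n k i)" unfolding C_def
      using K F(1) by (intro compact_Int_closed compact_Int)
    have "F k i \<subseteq> {x. q k < pot \<kappa> \<theta> x}" using F(2)[of k] by blast
    then have "C n k i \<subseteq> ?N" unfolding C_def by fastforce
    then show "emeasure \<mu> UNIV = 0" if "\<mu> \<in> Eplus_on \<kappa> (C n k i)" for \<mu>
      using ne c that unfolding nearly_everywhere_iff by blast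
  qed
  then have th: "thin (\<Union>n. \<Union>k. \<Union>i. C n k i)" by (intro thin_UN)
  have "?N \<subseteq> (\<Union>n. \<Union>k. \<Union>i. C n k i)"
  proof
    fix x assume x: "x \<in> ?N"
    then obtain n where n: "x \<in> K n" by blast
    have "pot \<kappa> \<nu> x < pot \<kappa> \<theta> x" using x le[of x] by (simp add: less_le)
    then obtain r :: rat where r: "pot \<kappa> \<nu> x < ennreal (real_of_rat r)" "ennreal (real_of_rat r) < pot \<kappa> \<theta> x"
      using ennreal_rat_dense by blast
    obtain k where k: "r = nat_to_rat_surj k" using surj_nat_to_rat_surj by (metis surjD)
    have "x \<in> (\<Union>i. F k i)" unfolding F(2) using r(2) k by (simp add: q_def)
    then obtain i where "x \<in> F k i" by blast
    then have "x \<in> C n k i" unfolding C_def using n r(1) k by (simp add: q_def)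
    then show "x \<in> (\<Union>n. \<Union>k. \<Union>i. C n k i)" by blast
  qed
  then have "thin ?N" by (rule thin_subset[OF th])
  then show ?thesis unfolding quasi_everywhere_def by (rule thin_outer_cap)
qed

lemma quasi_everywhere_imp_nearly_everywhere:
  assumes "quasi_everywhere \<kappa> Q P" shows "nearly_everywhere \<kappa> Q P"
proof -
  have "inner_cap \<kappa> {x\<in>Q. \<not> P x} \<le> outer_cap \<kappa> {x\<in>Q. \<not> P x}"
    unfolding outer_cap_def
  proof (rule INF_greatest)
    fix D assume "D \<in> {D. open D \<and> {x\<in>Q. \<not> P x} \<subseteq> D}"
    then show "inner_cap \<kappa> {x\<in>Q. \<not> P x} \<le> inner_cap \<kappa> D"
      unfolding inner_cap_def by (intro SUP_subset_mono) auto
  qed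
  then show ?thesis using assms unfolding nearly_everywhere_def quasi_everywhere_def by simp
qed

section \<open>Outer balayage on countable unions of compact sets\<close>

lemma outer_swept_eq_inner_swept:
  assumes t: "\<theta> \<in> Eplus \<kappa>" and K: "\<And>n::nat. compact (K n)"
  shows "outer_swept \<kappa> (\<Union>n. K n) \<theta> = inner_swept \<kappa> (\<Union>n. K n) \<theta>"
proof -
  let ?A = "\<Union>n. K n"
  note p = inner_swept_props[OF t, of ?A]
  have r: "inner_swept \<kappa> ?A \<theta> \<in> radon" "\<theta> \<in> radon" using Eclosed_on_Eplus[OF p(1)] t by auto
  have "quasi_everywhere \<kappa> ?A (\<lambda>x. pot \<kappa> (inner_swept \<kappa> ?A \<theta>) x = pot \<kappa> \<theta> x)"
    by (rule nearly_everywhere_imp_quasi_everywhere[OF r p(3) K p(2)])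
  \<comment> \<open>Uniqueness of the outer sweep is inherited from the inner one, since equality
    q.e. implies equality n.e.\<close>
  then show ?thesis
    unfolding outer_swept_def using p(1)
    by (intro the_equality conjI) (auto intro: swept_unique[OF t _ _ p(1,2)] quasi_everywhere_imp_nearly_everywhere)
qed

lemma is_outer_balayage_iff:
  assumes "\<And>n::nat. compact (K n)"
  shows "is_outer_balayage \<kappa> (\<Union>n. K n) \<omega> = is_inner_balayage \<kappa> (\<Union>n. K n) \<omega>"
  unfolding is_outer_balayage_def[abs_def] is_inner_balayage_def[abs_def]
  using outer_swept_eq_inner_swept[OF _ assms] by (intro ext) simp

text \<open>Ugaheri's principle bounds the equilibrium potential of \<open>K\<close> by \<open>h\<close>; integrating it against \<open>\<omega>\<close>
  bounds the mass, and hence the energy, of a measure on \<open>K\<close> whose potential is below that of \<open>\<omega>\<close>.\<close>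

lemma swept_energy_bound:
  assumes ug: "ugaheri_principle \<kappa> h" and \<omega>: "\<omega> \<in> radon" and K: "compact K"
    and b: "\<And>x. x \<in> K \<Longrightarrow> pot \<kappa> \<omega> x \<le> M"
    and \<nu>: "\<nu> \<in> Eplus_on \<kappa> K" and le: "\<And>x. pot \<kappa> \<nu> x \<le> pot \<kappa> \<omega> x"
  shows "(\<integral>\<^sup>+x. pot \<kappa> \<omega> x \<partial>\<nu>) \<le> M * (ennreal h * emeasure \<omega> UNIV)"
proof -
  have E: "\<nu> \<in> Eplus \<kappa>" "AE x in \<nu>. x \<in> K" using \<nu> by (auto simp: Eplus_on_iff)
  \<comment> \<open>The equilibrium measure \<open>\<gamma>\<close> of \<open>K\<close> arises as
    the projection of the constant function 1.\<close>
  have "admissible K (\<lambda>_. 1)" by (rule admissible_continuous[OF K, of _ 1]) auto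
  then obtain \<gamma> where \<gamma>: "\<gamma> \<in> Eplus_on \<kappa> K" "\<And>\<mu>. \<mu> \<in> Eplus_on \<kappa> K \<Longrightarrow> (\<integral>\<^sup>+x. 1 \<partial>\<mu>) \<le> ennreal (ip \<gamma> \<mu>)"
     "AE x in \<gamma>. pot \<kappa> \<gamma> x = 1"
    by (rule compact_projection[OF K]) blast
  have \<gamma>E: "\<gamma> \<in> Eplus \<kappa>" using \<gamma>(1) by (rule Eplus_onD)
  have "AE x in \<gamma>. pot \<kappa> \<gamma> x \<le> ennreal 1" using \<gamma>(3) by eventually_elim simp
  then have \<gamma>h: "pot \<kappa> \<gamma> x \<le> ennreal h" for x
    using ug \<gamma>E zero_less_one unfolding ugaheri_principle_def by (metis mult.right_neutral)
  have "AE x in \<nu>. pot \<kappa> \<omega> x \<le> M" using E(2) by eventually_elim (rule b)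
  then have "(\<integral>\<^sup>+x. pot \<kappa> \<omega> x \<partial>\<nu>) \<le> (\<integral>\<^sup>+x. M \<partial>\<nu>)" by (rule nn_integral_mono_AE)
  also have "\<dots> = M * emeasure \<nu> UNIV" using space_radon[OF Eplus_radon[OF E(1)]] by simp
  also have "emeasure \<nu> UNIV \<le> ennreal (ip \<gamma> \<nu>)"
    using \<gamma>(2)[OF \<nu>] space_radon[OF Eplus_radon[OF E(1)]] by simp
  also have "ennreal (ip \<gamma> \<nu>) = (\<integral>\<^sup>+x. pot \<kappa> \<nu> x \<partial>\<gamma>)" using energy_pot_ip[OF \<gamma>E E(1)] \<gamma>E E(1) by (simp add: ip_sym)
  also have "\<dots> \<le> (\<integral>\<^sup>+x. pot \<kappa> \<omega> x \<partial>\<gamma>)" by (intro nn_integral_mono le)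
  also have "\<dots> = (\<integral>\<^sup>+x. pot \<kappa> \<gamma> x \<partial>\<omega>)"
    using energy_eq_pot[of \<gamma> \<omega>] energy_eq_pot[of \<omega> \<gamma>] energy_sym[of \<gamma> \<omega>] \<gamma>E \<omega> by simp
  also have "\<dots> \<le> (\<integral>\<^sup>+x. ennreal h \<partial>\<omega>)" by (intro nn_integral_mono \<gamma>h)
  also have "\<dots> = ennreal h * emeasure \<omega> UNIV" using space_radon[OF \<omega>] by simp
  finally show ?thesis by (simp add: mult_left_mono)
qed

lemma balayage_on_K_sigma:
  assumes ug: "ugaheri_principle \<kappa> h" and \<omega>: "\<omega> \<in> radon" and fin: "emeasure \<omega> UNIV < \<infinity>"
    and cont: "\<And>K. compact K \<Longrightarrow> K \<subseteq> A \<Longrightarrow> continuous_on K (pot \<kappa> \<omega>)"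
    and bd: "(SUP x\<in>A. pot \<kappa> \<omega> x) < \<infinity>"
  obtains K :: "nat \<Rightarrow> 'a set" and \<nu> where "\<And>n. compact (K n)" "(\<Union>n. K n) \<subseteq> A"
    "is_inner_balayage \<kappa> A \<omega> \<nu>" "is_inner_balayage \<kappa> (\<Union>n. K n) \<omega> \<nu>"
proof -
  obtain m where m: "(SUP x\<in>A. pot \<kappa> \<omega> x) = ennreal m" "0 \<le> m" using bd by (cases "SUP x\<in>A. pot \<kappa> \<omega> x") auto
  have le_m: "pot \<kappa> \<omega> x \<le> ennreal m" if "x \<in> A" for x unfolding m(1)[symmetric] using that by (rule SUP_upper)
  define S where "S = enn2real (ennreal m * (ennreal h * emeasure \<omega> UNIV))"
  have "ennreal m * (ennreal h * emeasure \<omega> UNIV) < \<infinity>" using fin by (simp add: ennreal_mult_less_top)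
  then have S: "ennreal m * (ennreal h * emeasure \<omega> UNIV) = ennreal S" "0 \<le> S" by (simp_all add: S_def)
  have ad: "admissible K (pot \<kappa> \<omega>)" if "compact K" "K \<subseteq> A" for K
    using that m(2) le_m by (intro admissible_continuous[where b=m] pot_measurable \<omega> cont) auto
  have ipS: "ip \<nu> \<nu> \<le> S" if "compact K" "K \<subseteq> A" "\<nu> \<in> Eplus_on \<kappa> K" "\<And>x. pot \<kappa> \<nu> x \<le> pot \<kappa> \<omega> x"
    "(\<integral>\<^sup>+x. pot \<kappa> \<omega> x \<partial>\<nu>) = ennreal (ip \<nu> \<nu>)" for K \<nu>
  proof -
    have "(\<integral>\<^sup>+x. pot \<kappa> \<omega> x \<partial>\<nu>) \<le> ennreal m * (ennreal h * emeasure \<omega> UNIV)"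
      using that(1-4) le_m by (intro swept_energy_bound[OF ug \<omega>]) auto
    then show ?thesis using that(5) S by simp
  qed
  obtain K \<nu> where K: "\<And>n::nat. compact (K n)" "\<And>n. K n \<subseteq> A" and \<nu>: "\<nu> \<in> Eclosed_on \<kappa> (\<Union>n. K n)"
    "\<And>x. pot \<kappa> \<nu> x \<le> pot \<kappa> \<omega> x" "nearly_everywhere \<kappa> A (\<lambda>x. pot \<kappa> \<nu> x = pot \<kappa> \<omega> x)"
  proof (rule sweep[OF \<omega>, of A S])
    show "admissible K (pot \<kappa> \<omega>)" if "compact K" "K \<subseteq> A" for K using that by (rule ad)
    show "ip \<nu> \<nu> \<le> S" if "compact K" "K \<subseteq> A" "\<nu> \<in> Eplus_on \<kappa> K" "\<And>x. pot \<kappa> \<nu> x \<le> pot \<kappa> \<omega> x"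
      "(\<integral>\<^sup>+x. pot \<kappa> \<omega> x \<partial>\<nu>) = ennreal (ip \<nu> \<nu>)" for K \<nu> using that by (rule ipS)
  qed (rule that)
  have KA: "(\<Union>n. K n) \<subseteq> A" using K(2) by (rule UN_least)
  \<comment> \<open>The same \<open>\<nu>\<close>, with its equality n.e. on \<open>A\<close>, is
    used once for \<open>A\<close> itself and once for the union of the \<open>K n\<close>.\<close>
  show thesis
    by (rule that[OF K(1) KA is_inner_balayageI[OF \<omega> Eclosed_on_mono[OF \<nu>(1) KA] order_refl \<nu>(2,3)]
          is_inner_balayageI[OF \<omega> \<nu>(1) KA \<nu>(2,3)]])
qed

end

theorem theorem4p8:
  fixes \<kappa> :: "'a::{second_countable_topology, t2_space} kernel"
    and A :: "'a set" and \<omega> :: "'a measure" and h :: real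
  assumes "locally_compact_space (euclidean :: 'a topology)"
    and "is_kernel \<kappa>"
    and "perfect_kernel \<kappa>"
    and "domination_principle \<kappa>"
    and "1 \<le> h"
    and "ugaheri_principle \<kappa> h"
    and "inner_cap \<kappa> A > 0"
    and "\<omega> \<in> radon"
    and "\<omega> \<noteq> null_measure borel"
    and "emeasure \<omega> UNIV < \<infinity>"
    and "\<And>K. compact K \<Longrightarrow> K \<subseteq> A \<Longrightarrow> continuous_on K (pot \<kappa> \<omega>)"
    and "(SUP x\<in>A. pot \<kappa> \<omega> x) < \<infinity>"
  shows "\<exists>A\<^sub>0. A\<^sub>0 \<subseteq> A \<and> (countable union_of compact) A\<^sub>0 \<and>
           (\<exists>!\<nu>. is_inner_balayage \<kappa> A \<omega> \<nu>) \<and>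
           (\<exists>!\<nu>. is_inner_balayage \<kappa> A\<^sub>0 \<omega> \<nu>) \<and>
           (\<exists>!\<nu>. is_outer_balayage \<kappa> A\<^sub>0 \<omega> \<nu>) \<and>
           inner_balayage \<kappa> A \<omega> = inner_balayage \<kappa> A\<^sub>0 \<omega> \<and>
           inner_balayage \<kappa> A\<^sub>0 \<omega> = outer_balayage \<kappa> A\<^sub>0 \<omega>"
proof -
  interpret perfect \<kappa> using assms(1-4) by unfold_locales
  obtain K :: "nat \<Rightarrow> 'a set" and \<nu> where K: "\<And>n. compact (K n)" "(\<Union>n. K n) \<subseteq> A"
    and \<nu>: "is_inner_balayage \<kappa> A \<omega> \<nu>" "is_inner_balayage \<kappa> (\<Union>n. K n) \<omega> \<nu>"
  proof (rule balayage_on_K_sigma[OF assms(6,8,10), of A])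
    show "continuous_on K (pot \<kappa> \<omega>)" if "compact K" "K \<subseteq> A" for K using that by (rule assms(11))
    show "(SUP x\<in>A. pot \<kappa> \<omega> x) < \<infinity>" by (rule assms(12))
  qed (rule that)
  have u: "\<exists>!\<nu>. is_inner_balayage \<kappa> Q \<omega> \<nu>" "inner_balayage \<kappa> Q \<omega> = \<nu>" if "is_inner_balayage \<kappa> Q \<omega> \<nu>" for Q
    using that inner_balayage_unique[of Q \<omega>] unfolding inner_balayage_def by (blast, intro the_equality)
  \<comment> \<open>An equality of predicates transfers existence, uniqueness and the value of the
    description operator at once.\<close>
  have o: "is_outer_balayage \<kappa> (\<Union>n. K n) \<omega> = is_inner_balayage \<kappa> (\<Union>n. K n) \<omega>"
    by (rule is_outer_balayage_iff[OF K(1)])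
  have "outer_balayage \<kappa> (\<Union>n. K n) \<omega> = inner_balayage \<kappa> (\<Union>n. K n) \<omega>"
    unfolding outer_balayage_def inner_balayage_def o ..
  moreover have "(countable union_of compact) (\<Union>n. K n)"
    unfolding union_of_def using K(1) by (intro exI[of _ "range K"]) auto
  ultimately show ?thesis
    using K(2) u[OF \<nu>(1)] u[OF \<nu>(2)] by (intro exI[of _ "\<Union>n. K n"] conjI) (simp_all add: o)
qed

end
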